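(* Let $n\ge 2$ and $d>n$ be integers, let $N:=\frac{(n+1+d)!}{(n+1)!\,d!}-1$, let $\mathcal X\subset\mathbb P^{n+1}\times\mathbb P^{N}$ be the universal hypersurface of degree $d$, let $J^n_{\rm vert}(\mathcal X)$ be its space of vertical $n$-jets, and let $J^n_{\rm vert}(\mathcal X_0)$ be the space of vertical affine $n$-jets, with coordinates $(z_i,a_\alpha,z'_{j_1},\dots,z^{(n)}_{j_n})$. Let $\widetilde\Sigma$ be the closure in $J^n_{\rm vert}(\mathcal X)$ of the Zariski closed subset of $J^n_{\rm vert}(\mathcal X_0)$ $$\widetilde\Sigma_0:=\big\{(z_i,a_\alpha,z'_{j_1},\dots,z^{(n)}_{j_n}) : z'_1=z'_2=\cdots=z'_{n+1}=0\big\}$$ (so that in any other standard affine chart $(t_0,\dots,t_{\upsilon-1},t_{\upsilon+1},\dots,t_{n+1})\in\mathbb C^{n+1}$ on $\mathbb P^{n+1}$, the set $\widetilde\Sigma$ is given by the same equations $0=t'_0=\cdots=t'_{\upsilon-1}=t'_{\upsilon+1}=\cdots=t'_{n+1}$). Then the following two properties hold. (1) $J^n_{\rm vert}(\mathcal X)\setminus\widetilde\Sigma$ is smooth of pure codimension $n+1$ at every point (in the space of vertical $n$-jets of $\mathbb P^{n+1}\times\mathbb P^N$), that is, it is of pure dimension $$j^d_n:=(n+1)+N+n(n+1)-(n+1)=N+n(n+1).$$ (2) The twisted tangent bundle $$T_{J^n_{\rm vert}(\mathcal X)}\otimes\mathcal O_{\mathbb P^{n+1}}(n^2+2n)\otimes\mathcal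 O_{\mathbb P^{N}}(1)$$ is generated by its global sections on $J^n_{\rm vert}(\mathcal X)\setminus\widetilde\Sigma$; that is, at every point $p\in J^n_{\rm vert}(\mathcal X)\setminus\widetilde\Sigma$ one may find $j_n^d$ global sections $\mathsf T_1,\dots,\mathsf T_{j^d_n}$ of this twisted tangent bundle over $J^n_{\rm vert}(\mathcal X)$ such that $$\mathbb C\,\mathsf T_1(p)\oplus\cdots\oplus\mathbb C\,\mathsf T_{j^d_n}(p)=T_{J^n_{\rm vert}(\mathcal X),\,p}$$ (the right-hand side being understood up to tensoring by the one-dimensional fibres at $p$ of the twisting line bundles).
   Context: Everything is over $\mathbb C$. Universal hypersurface: with homogeneous coordinates $[Z]=[Z_0:\cdots:Z_{n+1}]\in\mathbb P^{n+1}$ and $[A]=[(A_\alpha)_{\alpha\in\mathbb N^{n+2},\,|\alpha|=d}]\in\mathbb P^{N}$, where $|\alpha|=\alpha_0+\cdots+\alpha_{n+1}$ and $Z^\alpha=Z_0^{\alpha_0}\cdots Z_{n+1}^{\alpha_{n+1}}$, $$\mathcal X=\Big\{([Z],[A]):\ \sum_{|\alpha|=d}A_\alpha Z^\alpha=0\Big\}.$$ Vertical jets: $J^n_{\rm vert}(\mathcal X)$ is the space of $n$-jets of germs of holomorphic maps $(\mathbb C,0)\to\mathcal X$ that are tangent to the fibres of the projection $\mathcal X\to\mathbb P^N$, i.e. the space of $n$-jets of holomorphic discs in $\mathbb P^{n+1}$ satisfying, up to order $n$, the equation of the hypersurface with coefficients $[A]$ held constant. The space of vertical $n$-jets of $\mathbb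 P^{n+1}\times\mathbb P^N$ is $J^n(\mathbb C,\mathbb P^{n+1})\times\mathbb P^N$. Affine chart: on $\{Z_0\ne0\}\times\{A_{0d0\cdots0}\neq0\}$ put $z_i=Z_i/Z_0$ $(1\le i\le n+1)$ and $a_{\alpha_1\cdots\alpha_{n+1}}=A_{\alpha_0\alpha_1\cdots\alpha_{n+1}}/A_{0d0\cdots0}$ with $\alpha_0=d-\alpha_1-\cdots-\alpha_{n+1}$. In this chart $\mathcal X$ becomes $$\mathcal X_0:\quad 0=z_1^d+\sum_{\alpha\in\mathbb N^{n+1},\,|\alpha|\le d,\,\alpha_1<d}a_\alpha z^\alpha ,$$ also written $0=\sum_{|\alpha|\le d}a_\alpha z^\alpha$ with the convention $a_{d0\cdots0}=1$. With independent jet coordinates $z^{(\lambda)}_k$ ($1\le k\le n+1$, $1\le\lambda\le n$, and $z^{(0)}_k=z_k$), and the total differentiation operator $$\mathsf D(\bullet)=\sum_{\lambda\in\mathbb N}\sum_{k=1}^{n+1}\frac{\partial(\bullet)}{\partial z_k^{(\lambda)}}\,z_k^{(\lambda+1)},$$ $J^n_{\rm vert}(\mathcal X_0)$ is the subset of the affine space with coordinates $(z_i,a_\alpha,z'_{j_1},\dots,z^{(n)}_{j_n})$ defined by the $n+1$ equations $0=\mathsf D^\kappa\big(\sum_\alpha a_\alpha z^\alpha\big)$, $\kappa=0,1,\dots,n$. The line bundles $\mathcal O_{\mathbb P^{n+1}}(\cdot)$ and $\mathcal O_{\mathbb P^N}(\cdot)$ are pulled back to $J^n_{\rm vert}(\mathcal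 X)$ via the natural projections $J^n_{\rm vert}(\mathcal X)\to\mathbb P^{n+1}$ and $J^n_{\rm vert}(\mathcal X)\to\mathbb P^N$. At possible singular points of $J^n_{\rm vert}(\mathcal X)$ (which lie in $\widetilde\Sigma$), $T_{J^n_{\rm vert}(\mathcal X)}$ is understood as the tangent sheaf. *)

theory Defs
  imports "HOL-Complex_Analysis.Complex_Analysis" "HOL-Library.Groups_Big_Fun"
begin

text \<open>
  Everything is done in the category of complex algebraic varieties.  The space of vertical
  jets of \<open>\<P>\<^sup>n\<^sup>+\<^sup>1 \<times> \<P>\<^sup>N\<close> is a smooth variety covered by the standard charts
  \<open>{Z\<^sub>u \<noteq> 0} \<times> {A\<^sub>b \<noteq> 0}\<close>; each of them is an affine space, on which regular functions are
  polynomial functions.  The twisted vector fields are described by their components in these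
  charts together with the transition rule.
\<close>


section \<open>Projective spaces\<close>

definition hom_vecs :: "'i set \<Rightarrow> ('i \<Rightarrow> complex) set" where
  "hom_vecs I = {Z. (\<forall>i. i \<notin> I \<longrightarrow> Z i = 0) \<and> (\<exists>i\<in>I. Z i \<noteq> 0)}"

definition proj_rel :: "'i set \<Rightarrow> (('i \<Rightarrow> complex) \<times> ('i \<Rightarrow> complex)) set" where
  "proj_rel I = {(Z, W). Z \<in> hom_vecs I \<and> W \<in> hom_vecs I \<and> (\<exists>c. c \<noteq> 0 \<and> W = (\<lambda>i. c * Z i))}"

definition proj_space :: "'i set \<Rightarrow> ('i \<Rightarrow> complex) set set" where
  "proj_space I = hom_vecs I // proj_rel I"

definition std_open :: "'i set \<Rightarrow> 'i \<Rightarrow> ('i \<Rightarrow> complex) set set" where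
  "std_open I u = {P \<in> proj_space I. \<forall>Z\<in>P. Z u \<noteq> 0}"

definition aff_coord :: "'i \<Rightarrow> ('i \<Rightarrow> complex) set \<Rightarrow> 'i \<Rightarrow> complex" where
  "aff_coord u P i = (THE c. \<exists>Z\<in>P. c = Z i / Z u)"


section \<open>Jets of holomorphic germs in projective space\<close>

text \<open>
  Germs \<open>(\<complex>, 0) \<rightarrow> \<P>\<^sup>m\<close> are represented by total functions whose values away from \<open>0\<close> are
  irrelevant.
\<close>

definition hol_germs :: "nat \<Rightarrow> (complex \<Rightarrow> (nat \<Rightarrow> complex) set) set" where
  "hol_germs m = {g. \<exists>u\<le>m. (\<forall>\<^sub>F t in nhds 0. g t \<in> std_open {..m} u) \<and>
     (\<forall>i\<le>m. (\<lambda>t. aff_coord u (g t) i) analytic_on {0})}"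

definition germ_deriv :: "nat \<Rightarrow> (complex \<Rightarrow> (nat \<Rightarrow> complex) set) \<Rightarrow> nat \<Rightarrow> nat \<Rightarrow> complex" where
  "germ_deriv u g i l = (deriv ^^ l) (\<lambda>t. aff_coord u (g t) i) 0"

definition jet_rel :: "nat \<Rightarrow> nat \<Rightarrow>
    ((complex \<Rightarrow> (nat \<Rightarrow> complex) set) \<times> (complex \<Rightarrow> (nat \<Rightarrow> complex) set)) set" where
  "jet_rel m n = {(g, h). g \<in> hol_germs m \<and> h \<in> hol_germs m \<and> g 0 = h 0 \<and>
     (\<forall>u\<le>m. g 0 \<in> std_open {..m} u \<longrightarrow>
        (\<forall>i\<le>m. \<forall>l\<le>n. germ_deriv u g i l = germ_deriv u h i l))}"

definition jets :: "nat \<Rightarrow> nat \<Rightarrow> (complex \<Rightarrow> (nat \<Rightarrow> complex) set) set set" where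
  "jets m n = hol_germs m // jet_rel m n"


section \<open>Vertical jets of the universal hypersurface\<close>

definition mindices :: "nat \<Rightarrow> nat \<Rightarrow> (nat \<Rightarrow> nat) set" where
  "mindices m d = {\<alpha>. (\<forall>i>m. \<alpha> i = 0) \<and> (\<Sum>i\<le>m. \<alpha> i) = d}"

text \<open>The universal hypersurface is \<open>\<X> = {([Z], [A]). univ_form n d A Z = 0}\<close>.\<close>

definition univ_form :: "nat \<Rightarrow> nat \<Rightarrow> ((nat \<Rightarrow> nat) \<Rightarrow> complex) \<Rightarrow> (nat \<Rightarrow> complex) \<Rightarrow> complex" where
  "univ_form n d A Z = (\<Sum>\<alpha>\<in>mindices (n+1) d. A \<alpha> * (\<Prod>i\<le>n+1. Z i ^ \<alpha> i))"

type_synonym vjet =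
  "(complex \<Rightarrow> (nat \<Rightarrow> complex) set) set \<times> ((nat \<Rightarrow> nat) \<Rightarrow> complex) set"

definition vjets :: "nat \<Rightarrow> nat \<Rightarrow> vjet set" where
  "vjets n d = jets (n+1) n \<times> proj_space (mindices (n+1) d)"

text \<open>
  The equation of \<open>\<X>\<close> with constant coefficients \<open>A\<close> holds up to order \<open>n\<close> along the
  disc.  In the chart \<open>{Z\<^sub>u \<noteq> 0}\<close> the disc is lifted by its affine coordinates, with
  \<open>u\<close>-th coordinate \<open>1\<close>.
\<close>

definition Jvert :: "nat \<Rightarrow> nat \<Rightarrow> vjet set" where
  "Jvert n d = {(J, P) \<in> vjets n d. \<forall>g\<in>J. \<forall>A\<in>P. \<forall>u\<le>n+1. g 0 \<in> std_open {..n+1} u \<longrightarrow>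
     (\<forall>\<kappa>\<le>n. (deriv ^^ \<kappa>) (\<lambda>t. univ_form n d A (aff_coord u (g t))) 0 = 0)}"


section \<open>Affine charts\<close>

text \<open>
  \<open>Jet k l\<close> stands for \<open>z\<^sub>k\<^sup>(\<^sup>l\<^sup>)\<close> and \<open>Coef \<alpha>\<close> for \<open>a\<^sub>\<alpha>\<close>, where \<open>\<alpha>\<close> is kept homogeneous
  (\<open>\<bar>\<alpha>\<bar> = d\<close>) in all charts.  The chart \<open>(u, b)\<close> normalises \<open>Z\<^sub>u = 1\<close> and \<open>A\<^sub>b = 1\<close>; accordingly
  the coordinates \<open>Jet u 0\<close> and \<open>Coef b\<close> are kept, with constant value \<open>1\<close>, and all other
  coordinates outside \<open>free_coords\<close> are \<open>0\<close>.
\<close>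

datatype coord = Jet nat nat | Coef "nat \<Rightarrow> nat"

type_synonym chart = "nat \<times> (nat \<Rightarrow> nat)"

definition charts :: "nat \<Rightarrow> nat \<Rightarrow> chart set" where
  "charts n d = {..n+1} \<times> mindices (n+1) d"

definition chart_dom :: "nat \<Rightarrow> nat \<Rightarrow> chart \<Rightarrow> vjet set" where
  "chart_dom n d = (\<lambda>(u, b). {(J, P) \<in> vjets n d.
     (\<forall>g\<in>J. g 0 \<in> std_open {..n+1} u) \<and> P \<in> std_open (mindices (n+1) d) b})"

definition chart_map :: "nat \<Rightarrow> nat \<Rightarrow> chart \<Rightarrow> vjet \<Rightarrow> coord \<Rightarrow> complex" where
  "chart_map n d = (\<lambda>(u, b) (J, P) c. case c of
       Jet k l \<Rightarrow> if k \<le> n+1 \<and> l \<le> n then THE w. \<exists>g\<in>J. w = germ_deriv u g k l else 0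
     | Coef \<alpha> \<Rightarrow> if \<alpha> \<in> mindices (n+1) d then aff_coord b P \<alpha> else 0)"

definition free_coords :: "nat \<Rightarrow> nat \<Rightarrow> chart \<Rightarrow> coord set" where
  "free_coords n d = (\<lambda>(u, b).
     {Jet k l | k l. k \<le> n+1 \<and> k \<noteq> u \<and> l \<le> n} \<union> {Coef \<alpha> | \<alpha>. \<alpha> \<in> mindices (n+1) d \<and> \<alpha> \<noteq> b})"

definition chart_space :: "nat \<Rightarrow> nat \<Rightarrow> chart \<Rightarrow> (coord \<Rightarrow> complex) set" where
  "chart_space n d = (\<lambda>(u, b). {x. x (Jet u 0) = 1 \<and> x (Coef b) = 1 \<and>
     (\<forall>i. i \<notin> free_coords n d (u, b) \<union> {Jet u 0, Coef b} \<longrightarrow> x i = 0)})"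

definition Jvert_chart :: "nat \<Rightarrow> nat \<Rightarrow> chart \<Rightarrow> (coord \<Rightarrow> complex) set" where
  "Jvert_chart n d c = chart_map n d c ` (Jvert n d \<inter> chart_dom n d c)"

inductive_set poly_funs :: "((coord \<Rightarrow> complex) \<Rightarrow> complex) set" where
  const: "(\<lambda>_. w) \<in> poly_funs"
| coord: "(\<lambda>x. x i) \<in> poly_funs"
| add: "f \<in> poly_funs \<Longrightarrow> g \<in> poly_funs \<Longrightarrow> (\<lambda>x. f x + g x) \<in> poly_funs"
| mult: "f \<in> poly_funs \<Longrightarrow> g \<in> poly_funs \<Longrightarrow> (\<lambda>x. f x * g x) \<in> poly_funs"

definition pderiv_coord :: "coord \<Rightarrow> ((coord \<Rightarrow> complex) \<Rightarrow> complex) \<Rightarrow> (coord \<Rightarrow> complex) \<Rightarrow> complex" where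
  "pderiv_coord i f x = deriv (\<lambda>s. f (x(i := s))) (x i)"

definition vec_apply :: "nat \<Rightarrow> nat \<Rightarrow> chart \<Rightarrow> (coord \<Rightarrow> complex) \<Rightarrow> (coord \<Rightarrow> complex) \<Rightarrow>
    ((coord \<Rightarrow> complex) \<Rightarrow> complex) \<Rightarrow> complex" where
  "vec_apply n d c v x f = (\<Sum>i\<in>free_coords n d c. v i * pderiv_coord i f x)"

definition chart_vecs :: "nat \<Rightarrow> nat \<Rightarrow> chart \<Rightarrow> (coord \<Rightarrow> complex) set" where
  "chart_vecs n d c = {v. \<forall>i. i \<notin> free_coords n d c \<longrightarrow> v i = 0}"


section \<open>The affine jet space and the exceptional locus\<close>

definition pivot :: "nat \<Rightarrow> nat \<Rightarrow> nat" where
  "pivot d = (\<lambda>i. if i = 1 then d else 0)"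

definition aff_form :: "nat \<Rightarrow> nat \<Rightarrow> (coord \<Rightarrow> complex) \<Rightarrow> complex" where
  "aff_form n d x =
     (\<Sum>\<alpha>\<in>mindices (n+1) d. x (Coef \<alpha>) * (\<Prod>k\<in>{1..n+1}. x (Jet k 0) ^ \<alpha> k))"

text \<open>
  The total differentiation operator \<open>\<D>\<close>.  For a polynomial function, only finitely many
  terms of the sum over all orders \<open>l\<close> are nonzero.
\<close>

definition total_diff :: "nat \<Rightarrow> ((coord \<Rightarrow> complex) \<Rightarrow> complex) \<Rightarrow> (coord \<Rightarrow> complex) \<Rightarrow> complex" where
  "total_diff n f x =
     Sum_any (\<lambda>l. \<Sum>k\<in>{1..n+1}. pderiv_coord (Jet k l) f x * x (Jet k (Suc l)))"

definition Jvert_aff :: "nat \<Rightarrow> nat \<Rightarrow> (coord \<Rightarrow> complex) set" where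
  "Jvert_aff n d = {x \<in> chart_space n d (0, pivot d).
     \<forall>\<kappa>\<le>n. (total_diff n ^^ \<kappa>) (aff_form n d) x = 0}"

definition Sigma0 :: "nat \<Rightarrow> nat \<Rightarrow> (coord \<Rightarrow> complex) set" where
  "Sigma0 n d = {x \<in> Jvert_aff n d. \<forall>k\<in>{1..n+1}. x (Jet k 1) = 0}"

definition zariski_closed :: "nat \<Rightarrow> nat \<Rightarrow> vjet set \<Rightarrow> bool" where
  "zariski_closed n d S \<longleftrightarrow> S \<subseteq> Jvert n d \<and>
     (\<forall>c\<in>charts n d. \<exists>F\<subseteq>poly_funs. S \<inter> chart_dom n d c =
        {p \<in> Jvert n d \<inter> chart_dom n d c. \<forall>f\<in>F. f (chart_map n d c p) = 0})"

definition zariski_closure :: "nat \<Rightarrow> nat \<Rightarrow> vjet set \<Rightarrow> vjet set" where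
  "zariski_closure n d S = \<Inter>{C. zariski_closed n d C \<and> S \<subseteq> C}"

definition Sigma_tilde :: "nat \<Rightarrow> nat \<Rightarrow> vjet set" where
  "Sigma_tilde n d = zariski_closure n d
     {p \<in> Jvert n d \<inter> chart_dom n d (0, pivot d). chart_map n d (0, pivot d) p \<in> Sigma0 n d}"


section \<open>Smoothness\<close>

text \<open>
  Near \<open>p\<close>, in each chart, \<open>Jvert\<close> is cut out by \<open>r\<close> regular functions whose differentials
  at \<open>p\<close> are linearly independent; the set \<open>{h \<noteq> 0}\<close> is a Zariski neighbourhood of \<open>p\<close>.
\<close>

definition smooth_codim_at :: "nat \<Rightarrow> nat \<Rightarrow> vjet \<Rightarrow> nat \<Rightarrow> bool" where
  "smooth_codim_at n d p r \<longleftrightarrow> (\<forall>c\<in>charts n d. p \<in> chart_dom n d c \<longrightarrow>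
     (\<exists>h\<in>poly_funs. \<exists>f. h (chart_map n d c p) \<noteq> 0 \<and> (\<forall>i<r. f i \<in> poly_funs) \<and>
        (\<forall>x\<in>chart_space n d c. h x \<noteq> 0 \<longrightarrow>
           (x \<in> Jvert_chart n d c \<longleftrightarrow> (\<forall>i<r. f i x = 0))) \<and>
        (\<forall>w::nat \<Rightarrow> complex.
           (\<forall>v\<in>chart_vecs n d c. (\<Sum>i<r. w i * vec_apply n d c v (chart_map n d c p) (f i)) = 0)
             \<longrightarrow> (\<forall>i<r. w i = 0))))"

text \<open>\<open>free_coords\<close> are the coordinates of the ambient jet space, whose number is its dimension.\<close>

definition smooth_dim_at :: "nat \<Rightarrow> nat \<Rightarrow> vjet \<Rightarrow> nat \<Rightarrow> bool" where
  "smooth_dim_at n d p k \<longleftrightarrow>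
     (\<exists>r. smooth_codim_at n d p r \<and> (\<forall>c\<in>charts n d. card (free_coords n d c) = r + k))"


section \<open>The twisted tangent sheaf\<close>

text \<open>The Zariski tangent space of \<open>Jvert\<close> at \<open>p\<close>, in the coordinates of the chart \<open>c\<close>.\<close>

definition tangent_space :: "nat \<Rightarrow> nat \<Rightarrow> chart \<Rightarrow> vjet \<Rightarrow> (coord \<Rightarrow> complex) set" where
  "tangent_space n d c p = {v \<in> chart_vecs n d c. \<forall>f\<in>poly_funs.
     (\<forall>x\<in>Jvert_chart n d c. f x = 0) \<longrightarrow> vec_apply n d c v (chart_map n d c p) f = 0}"

definition transition :: "nat \<Rightarrow> nat \<Rightarrow> chart \<Rightarrow> chart \<Rightarrow> (coord \<Rightarrow> complex) \<Rightarrow> coord \<Rightarrow> complex" where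
  "transition n d c c' x =
     chart_map n d c' (inv_into (chart_dom n d c) (chart_map n d c) x)"

text \<open>
  Global sections of the tangent sheaf of \<open>Jvert\<close> twisted by \<open>\<O>(q)\<close> on \<open>\<P>\<^sup>n\<^sup>+\<^sup>1\<close>
  and by \<open>\<O>(e)\<close> on \<open>\<P>\<^sup>N\<close>.  In the chart \<open>(u, b)\<close> the section is \<open>s (u, b) \<otimes> Z\<^sub>u\<^sup>q A\<^sub>b\<^sup>e\<close>, where
  \<open>s (u, b)\<close> has regular components and is a derivation of the ring of regular functions,
  that is, it maps functions vanishing on \<open>Jvert\<close> to such functions (at singular points
  too).  Changing charts multiplies by \<open>(Z\<^sub>u / Z\<^sub>u\<^sub>')\<^sup>q (A\<^sub>b / A\<^sub>b\<^sub>')\<^sup>e\<close>, which is expressed by the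
  coordinates of the target chart \<open>(u', b')\<close>, and by the Jacobian matrix of the coordinate
  change.
\<close>

definition twisted_section ::
    "nat \<Rightarrow> nat \<Rightarrow> nat \<Rightarrow> nat \<Rightarrow> (chart \<Rightarrow> vjet \<Rightarrow> coord \<Rightarrow> complex) \<Rightarrow> bool" where
  "twisted_section n d q e s \<longleftrightarrow>
     (\<forall>c\<in>charts n d. \<forall>p\<in>Jvert n d \<inter> chart_dom n d c. s c p \<in> tangent_space n d c p) \<and>
     (\<forall>c\<in>charts n d. \<forall>i\<in>free_coords n d c. \<exists>f\<in>poly_funs.
        \<forall>p\<in>Jvert n d \<inter> chart_dom n d c. s c p i = f (chart_map n d c p)) \<and>
     (\<forall>u b u' b'. (u, b) \<in> charts n d \<longrightarrow> (u', b') \<in> charts n d \<longrightarrow>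
        (\<forall>p\<in>Jvert n d \<inter> chart_dom n d (u, b) \<inter> chart_dom n d (u', b').
         \<forall>i\<in>free_coords n d (u', b').
           s (u', b') p i =
             chart_map n d (u', b') p (Jet u 0) ^ q * chart_map n d (u', b') p (Coef b) ^ e *
             vec_apply n d (u, b) (s (u, b) p) (chart_map n d (u, b) p)
               (\<lambda>x. transition n d (u, b) (u', b') x i)))"

text \<open>\<open>\<complex> T\<^sub>0 \<oplus> \<dots> \<oplus> \<complex> T\<^sub>k\<^sub>-\<^sub>1 = V\<close>, with all \<open>T\<^sub>i\<close> nonzero.\<close>

definition is_frame :: "nat \<Rightarrow> (nat \<Rightarrow> coord \<Rightarrow> complex) \<Rightarrow> (coord \<Rightarrow> complex) set \<Rightarrow> bool" where
  "is_frame k T V \<longleftrightarrow>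
     V = {v. \<exists>w::nat \<Rightarrow> complex. v = (\<lambda>i. \<Sum>l<k. w l * T l i)} \<and>
     (\<forall>w::nat \<Rightarrow> complex. (\<forall>i. (\<Sum>l<k. w l * T l i) = 0) \<longrightarrow> (\<forall>l<k. w l = 0))"

end

theory Submission
  imports Defs
begin

text \<open>
  Along a disc whose first derivative does not vanish, the equations of vertical jets are
  \<open>n + 1\<close> linear conditions on the coefficients \<open>A\<close>.  Choose a coordinate with \<open>z\<^sub>k' \<noteq> 0\<close>;
  then \<open>\<tau> = z\<^sub>k - z\<^sub>k(0)\<close> is a local parameter of the disc, and \<open>1, \<tau>, \<dots>, \<tau>\<^sup>n\<close>, which are values of
  forms of degree \<open>d > n\<close>, are independent modulo \<open>t\<^sup>n\<^sup>+\<^sup>1\<close>.  So the conditions are independent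
  (\<open>dual_vectors\<close>), which gives smoothness and the dimension (\<open>smooth_moving\<close>); moreover every
  first-order solution extends to a curve of solutions (\<open>tangent_moving\<close>), so that the tangent
  space is the kernel of the linearised equations.

  The vector fields are constructed in homogeneous coordinates, on pairs of a lifted disc
  \<open>Z(t)\<close> and a form \<open>A\<close>: a polynomial field of the right weight under \<open>Z \<mapsto> \<rho>(t) Z\<close>,
  \<open>A \<mapsto> \<mu> A\<close> descends to a twisted field (\<open>field_section_twisted\<close>).  The horizontal directions are
  \<open>Z\<^sub>i \<mapsto> Z\<^sub>i + \<epsilon> t\<^sup>l Z\<^sub>j\<close>, which move a jet in all directions.  To compensate their effect on the
  equations one has to write \<open>t\<^sup>l Z(t)\<^sup>\<alpha>\<close>, for \<open>\<bar>\<alpha>\<bar> = d\<close>, as the value along the disc of a form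
  of degree \<open>d\<close> whose coefficients are polynomial in the jet.  Only a factor \<open>Z\<^sup>\<beta>\<close> of degree
  \<open>n\<close> is rewritten, which makes the pole order independent of \<open>d\<close>: \<open>t\<^sup>l Z\<^sup>\<beta>\<close> is expanded
  in powers of \<open>\<tau>\<close> by eliminating one order after the other without division
  (\<open>pseudo_division\<close>).  This multiplies it by the power \<open>n(n+1)/2\<close> of \<open>z\<^sub>k'\<close>.  As
  \<open>z\<^sub>k\<^sup>(\<^sup>l\<^sup>)\<close> has a pole of order \<open>l + 1\<close>, the total pole order is
  \<open>n + n(n+1) = n\<^sup>2 + 2n\<close> (\<open>weighted_time_shift\<close>).

  The vertical directions at \<open>(Z, A)\<close> are the forms that vanish along \<open>Z\<close> to order \<open>n\<close>.  The
  same rewriting with \<open>l = 0\<close>, together with the multiples of the power \<open>n + 1\<close> of a linear form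
  vanishing at \<open>Z(0)\<close>, reduces every monomial to the \<open>n + 1\<close> monomials
  \<open>Z\<^sub>k\<^sup>i Z\<^sub>u\<^sup>d\<^sup>-\<^sup>i\<close>, \<open>i \<le> n\<close>, whose values are independent; so the
  differences span all vanishing forms (\<open>vanishing_forms_spanned\<close>).  Hence every tangent vector at
  a point with \<open>z' \<noteq> 0\<close> is the value of a global twisted field (\<open>field_with_value\<close>).  At the points
  with \<open>z' = 0\<close>, singular or not, the factor \<open>z\<^sub>k'\<close> makes all these fields vertical, and they are
  tangent because the equations are linear in \<open>A\<close> (\<open>tangent_vertical\<close>).

  Finally, \<open>{z' = 0}\<close> is closed and does not depend on the chart, and each of its points is a limit
  of such points in the affine chart (\<open>flat_jets_limit\<close>); so it is the closure of its affine part.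
\<close>


section \<open>Power series up to a given order\<close>

definition agree :: "nat \<Rightarrow> complex fps \<Rightarrow> complex fps \<Rightarrow> bool" where
  "agree n F G \<longleftrightarrow> (\<forall>m\<le>n. fps_nth F m = fps_nth G m)"

lemma agree_refl [simp]: "agree n F F"
  by (simp add: agree_def)

lemma agree_sym: "agree n F G \<Longrightarrow> agree n G F"
  by (simp add: agree_def)

lemma agree_trans [trans]: "agree n F G \<Longrightarrow> agree n G H \<Longrightarrow> agree n F H"
  by (simp add: agree_def)

lemma agree_nth: "agree n F G \<Longrightarrow> m \<le> n \<Longrightarrow> fps_nth F m = fps_nth G m"
  by (simp add: agree_def)

lemma agree_add: "agree n F G \<Longrightarrow> agree n F' G' \<Longrightarrow> agree n (F + F') (G + G')"
  by (simp add: agree_def)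

lemma agree_diff: "agree n F G \<Longrightarrow> agree n F' G' \<Longrightarrow> agree n (F - F') (G - G')"
  by (simp add: agree_def)

lemma agree_mult: "agree n F G \<Longrightarrow> agree n F' G' \<Longrightarrow> agree n (F * F') (G * G')"
  by (auto simp: agree_def fps_mult_nth intro!: sum.cong)

lemma agree_power: "agree n F G \<Longrightarrow> agree n (F ^ k) (G ^ k)"
  by (induction k) (auto intro: agree_mult)

lemma agree_sum: "(\<And>i. i \<in> I \<Longrightarrow> agree n (F i) (G i)) \<Longrightarrow> agree n (sum F I) (sum G I)"
  by (induction I rule: infinite_finite_induct) (auto intro: agree_add)

lemma agree_prod: "(\<And>i. i \<in> I \<Longrightarrow> agree n (F i) (G i)) \<Longrightarrow> agree n (prod F I) (prod G I)"
  by (induction I rule: infinite_finite_induct) (auto intro: agree_mult)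

lemma agree_inverse:
  assumes "agree n F G" "fps_nth G 0 \<noteq> 0"
  shows "agree n (inverse F) (inverse G)"
proof -
  have F: "fps_nth F 0 \<noteq> 0" using assms by (auto simp: agree_def)
  have "agree n (inverse F * (G * inverse G)) (inverse F * (F * inverse G))"
    by (rule agree_mult[OF agree_refl agree_mult[OF agree_sym[OF assms(1)] agree_refl]])
  moreover have "inverse F * (G * inverse G) = inverse F"
    using assms(2) by (simp add: inverse_mult_eq_1')
  moreover have "inverse F * (F * inverse G) = inverse G"
    using F by (simp add: mult.assoc[symmetric] inverse_mult_eq_1)
  ultimately show ?thesis by simp
qed


section \<open>Projective spaces and their affine coordinates\<close>

definition point_of :: "'i set \<Rightarrow> ('i \<Rightarrow> complex) \<Rightarrow> ('i \<Rightarrow> complex) set" where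
  "point_of I Z = proj_rel I `` {Z}"

lemma mem_point_of:
  assumes "Z \<in> hom_vecs I"
  shows "W \<in> point_of I Z \<longleftrightarrow> (\<exists>c. c \<noteq> 0 \<and> W = (\<lambda>i. c * Z i))"
  using assms by (auto simp: point_of_def proj_rel_def hom_vecs_def)

lemma point_of_in_proj_space: "Z \<in> hom_vecs I \<Longrightarrow> point_of I Z \<in> proj_space I"
  by (auto simp: point_of_def proj_space_def intro: quotientI)

lemma proj_spaceE:
  assumes "P \<in> proj_space I"
  obtains Z where "Z \<in> hom_vecs I" "P = point_of I Z"
  using assms by (auto simp: point_of_def proj_space_def elim!: quotientE)

lemma point_of_in_std_open:
  assumes "Z \<in> hom_vecs I"
  shows "point_of I Z \<in> std_open I u \<longleftrightarrow> Z u \<noteq> 0"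
proof -
  have "Z \<in> point_of I Z" using mem_point_of[OF assms, of Z] by (auto intro!: exI[of _ 1])
  moreover have "W u \<noteq> 0" if Zu: "Z u \<noteq> 0" and W: "W \<in> point_of I Z" for W
  proof -
    obtain c where "c \<noteq> 0" "W = (\<lambda>i. c * Z i)" using W mem_point_of[OF assms, of W] by auto
    thus ?thesis using Zu by simp
  qed
  ultimately show ?thesis
    using point_of_in_proj_space[OF assms] unfolding std_open_def by blast
qed

lemma aff_coord_point_of:
  assumes "Z \<in> hom_vecs I" "Z u \<noteq> 0"
  shows "aff_coord u (point_of I Z) i = Z i / Z u"
  unfolding aff_coord_def
proof (rule the_equality)
  have "Z \<in> point_of I Z" using mem_point_of[OF assms(1), of Z] by (auto intro!: exI[of _ 1])
  thus "\<exists>Y\<in>point_of I Z. Z i / Z u = Y i / Y u" by blast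
next
  fix c assume "\<exists>Y\<in>point_of I Z. c = Y i / Y u"
  then obtain Y where Y: "Y \<in> point_of I Z" "c = Y i / Y u" by blast
  obtain b where "b \<noteq> 0" "Y = (\<lambda>i. b * Z i)" using Y(1) mem_point_of[OF assms(1), of Y] by auto
  thus "c = Z i / Z u" using Y(2) by simp
qed

lemma std_openE:
  assumes "P \<in> std_open I u"
  obtains Z where "Z \<in> hom_vecs I" "P = point_of I Z" "Z u \<noteq> 0"
  using assms proj_spaceE[of P I] by (metis (lifting) mem_Collect_eq point_of_in_std_open std_open_def)

lemma aff_coord_self: "P \<in> std_open I u \<Longrightarrow> aff_coord u P u = 1"
  by (erule std_openE) (simp add: aff_coord_point_of)

lemma aff_coord_outside: "P \<in> std_open I u \<Longrightarrow> i \<notin> I \<Longrightarrow> aff_coord u P i = 0"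
  by (erule std_openE) (auto simp: aff_coord_point_of hom_vecs_def)

lemma aff_coord_in_hom_vecs: "P \<in> std_open I u \<Longrightarrow> aff_coord u P \<in> hom_vecs I"
  by (erule std_openE) (auto simp: aff_coord_point_of hom_vecs_def)

lemma aff_coord_mem:
  assumes "P \<in> std_open I u" shows "aff_coord u P \<in> P"
proof -
  obtain Z where Z: "Z \<in> hom_vecs I" "P = point_of I Z" "Z u \<noteq> 0"
    using assms by (rule std_openE)
  have eq: "aff_coord u P = (\<lambda>i. inverse (Z u) * Z i)"
    unfolding Z(2) aff_coord_point_of[OF Z(1,3)] by (simp add: divide_inverse mult.commute)
  hence "\<exists>c. c \<noteq> 0 \<and> aff_coord u P = (\<lambda>i. c * Z i)"
    using Z(3) by (intro exI[of _ "inverse (Z u)"]) simp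
  thus ?thesis unfolding mem_point_of[OF Z(1), symmetric] by (simp add: Z(2))
qed

lemma point_of_scale:
  assumes "Z \<in> hom_vecs I" "c \<noteq> 0"
  shows "point_of I (\<lambda>i. c * Z i) = point_of I Z"
proof -
  have Y: "(\<lambda>i. c * Z i) \<in> hom_vecs I" using assms by (auto simp: hom_vecs_def)
  show ?thesis
  proof (rule set_eqI)
    fix W
    have "(\<exists>b. b \<noteq> 0 \<and> W = (\<lambda>i. b * (c * Z i))) \<longleftrightarrow> (\<exists>b. b \<noteq> 0 \<and> W = (\<lambda>i. b * Z i))" (is "?L \<longleftrightarrow> ?R")
    proof
      assume ?L
      then obtain b where "b \<noteq> 0" "W = (\<lambda>i. b * (c * Z i))" by blast
      thus ?R using assms(2) by (intro exI[of _ "b * c"]) (simp add: mult.assoc)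
    next
      assume ?R
      then obtain b where "b \<noteq> 0" "W = (\<lambda>i. b * Z i)" by blast
      thus ?L using assms(2) by (intro exI[of _ "b / c"]) simp
    qed
    thus "W \<in> point_of I (\<lambda>i. c * Z i) \<longleftrightarrow> W \<in> point_of I Z"
      using mem_point_of[OF Y] mem_point_of[OF assms(1)] by simp
  qed
qed

lemma point_of_aff_coord:
  assumes "P \<in> std_open I u" shows "point_of I (aff_coord u P) = P"
proof -
  obtain Z where Z: "Z \<in> hom_vecs I" "P = point_of I Z" "Z u \<noteq> 0"
    using assms by (rule std_openE)
  have eq: "aff_coord u P = (\<lambda>i. inverse (Z u) * Z i)"
    unfolding Z(2) aff_coord_point_of[OF Z(1,3)] by (simp add: divide_inverse mult.commute)
  show ?thesis unfolding eq using Z point_of_scale[OF Z(1), of "inverse (Z u)"] by simp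
qed

lemma std_open_iff_aff_coord:
  assumes "P \<in> std_open I u" shows "P \<in> std_open I v \<longleftrightarrow> aff_coord u P v \<noteq> 0"
  using point_of_in_std_open[OF aff_coord_in_hom_vecs[OF assms], of v] assms
  by (simp add: point_of_aff_coord)

lemma aff_coord_change:
  assumes "P \<in> std_open I u" "P \<in> std_open I v"
  shows "aff_coord v P i = aff_coord u P i / aff_coord u P v"
  using aff_coord_point_of[OF aff_coord_in_hom_vecs[OF assms(1)], of v i] assms
  by (simp add: point_of_aff_coord std_open_iff_aff_coord[OF assms(1)])

lemma proj_space_cover:
  assumes "P \<in> proj_space I" obtains u where "u \<in> I" "P \<in> std_open I u"
  using assms by (elim proj_spaceE) (auto simp: hom_vecs_def point_of_in_std_open)

lemma std_open_proj: "P \<in> std_open I u \<Longrightarrow> P \<in> proj_space I"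
  by (simp add: std_open_def)

lemma std_open_index: "P \<in> std_open I u \<Longrightarrow> u \<in> I"
  by (erule std_openE) (auto simp: hom_vecs_def)

lemma std_open_mem_eq:
  assumes "P \<in> std_open I u" "Z \<in> P"
  shows "\<exists>c. c \<noteq> 0 \<and> Z = (\<lambda>i. c * aff_coord u P i)"
  using mem_point_of[OF aff_coord_in_hom_vecs[OF assms(1)]] assms point_of_aff_coord by metis


section \<open>Jets through their Taylor series\<close>

text \<open>
  In an affine chart a germ is a tuple of convergent power series, and its jet is the tuple of
  truncated series; a change of chart divides the tuple by one of its members.
\<close>

definition germ_series :: "nat \<Rightarrow> (complex \<Rightarrow> (nat \<Rightarrow> complex) set) \<Rightarrow> nat \<Rightarrow> complex fps" where
  "germ_series u g i = fps_expansion (\<lambda>t. aff_coord u (g t) i) 0"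

lemma germ_series_nth: "fps_nth (germ_series u g i) l = germ_deriv u g i l / fact l"
  by (simp add: germ_series_def fps_expansion_def germ_deriv_def)

lemma germ_deriv_nth: "germ_deriv u g i l = fact l * fps_nth (germ_series u g i) l"
  by (simp add: germ_series_nth)

text \<open>
  A germ is required to be analytic in one chart; in any other chart its coordinates are
  quotients of those.
\<close>

lemma hol_germs_std_open:
  assumes g: "g \<in> hol_germs m" and v: "g 0 \<in> std_open {..m} v"
  shows "\<forall>\<^sub>F t in nhds 0. g t \<in> std_open {..m} v"
    and "i \<le> m \<Longrightarrow> (\<lambda>t. aff_coord v (g t) i) analytic_on {0}"
proof -
  obtain u where H: "u \<le> m \<and> (\<forall>\<^sub>F t in nhds 0. g t \<in> std_open {..m} u) \<and>
      (\<forall>i\<le>m. (\<lambda>t. aff_coord u (g t) i) analytic_on {0})"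
    using g unfolding hol_germs_def mem_Collect_eq by (rule exE)
  note u = H[THEN conjunct1] H[THEN conjunct2, THEN conjunct1]
  have an: "(\<lambda>t. aff_coord u (g t) i) analytic_on {0}" if "i \<le> m" for i
    using H that by simp
  have gu: "g 0 \<in> std_open {..m} u" using u(2) by (rule eventually_nhds_x_imp_x)
  have vm: "v \<le> m" using std_open_index[OF v] by simp
  have ne: "aff_coord u (g 0) v \<noteq> 0" using v std_open_iff_aff_coord[OF gu] by simp
  have "isCont (\<lambda>t. aff_coord u (g t) v) 0"
    using an[OF vm] by (rule analytic_at_imp_isCont)
  hence "((\<lambda>t. aff_coord u (g t) v) \<longlongrightarrow> aff_coord u (g 0) v) (nhds 0)"
    using tendsto_at_iff_tendsto_nhds[of "\<lambda>t. aff_coord u (g t) v" 0] by (simp add: isCont_def)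
  hence "\<forall>\<^sub>F t in nhds 0. aff_coord u (g t) v \<noteq> 0"
    using ne by (rule tendsto_imp_eventually_ne)
  with u(2) show ev: "\<forall>\<^sub>F t in nhds 0. g t \<in> std_open {..m} v"
  proof eventually_elim
    case (elim t)
    show ?case using std_open_iff_aff_coord[OF elim(1)] elim(2) by simp
  qed
  have ev2: "\<forall>\<^sub>F t in nhds 0. aff_coord u (g t) i / aff_coord u (g t) v = aff_coord v (g t) i" for i
    using ev u(2)
  proof eventually_elim
    case (elim t)
    show ?case using aff_coord_change[OF elim(2,1)] by simp
  qed
  show "(\<lambda>t. aff_coord v (g t) i) analytic_on {0}" if "i \<le> m"
  proof -
    have "(\<lambda>t. aff_coord u (g t) i / aff_coord u (g t) v) analytic_on {0}"
      by (rule analytic_on_divide[OF an[OF that] an[OF vm]]) (use ne in simp)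
    thus ?thesis using analytic_at_cong[OF ev2 refl, of i] by simp
  qed
qed

lemma has_germ_series:
  assumes "g \<in> hol_germs m" "g 0 \<in> std_open {..m} u" "i \<le> m"
  shows "(\<lambda>t. aff_coord u (g t) i) has_fps_expansion germ_series u g i"
  unfolding germ_series_def
  by (rule analytic_at_imp_has_fps_expansion_0) (rule hol_germs_std_open(2)[OF assms])

lemma has_fps_expansion_unique:
  fixes f :: "complex \<Rightarrow> complex"
  assumes "f has_fps_expansion F" "g has_fps_expansion G" "\<forall>\<^sub>F t in nhds 0. f t = g t"
  shows "F = G"
proof (rule fps_ext)
  fix l
  have "fps_nth F l = (deriv ^^ l) f 0 / fact l" using assms(1) by (rule fps_nth_fps_expansion)
  also have "(deriv ^^ l) f 0 = (deriv ^^ l) g 0" using assms(3) by (rule higher_deriv_cong_ev) simp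
  also have "(deriv ^^ l) g 0 / fact l = fps_nth G l" using fps_nth_fps_expansion[OF assms(2)] by simp
  finally show "fps_nth F l = fps_nth G l" .
qed

lemma germ_series_nth_0:
  assumes "g \<in> hol_germs m" "g 0 \<in> std_open {..m} u" "i \<le> m"
  shows "fps_nth (germ_series u g i) 0 = aff_coord u (g 0) i"
  by (simp add: germ_series_nth germ_deriv_def)

lemma germ_series_self:
  assumes "g \<in> hol_germs m" "g 0 \<in> std_open {..m} u"
  shows "germ_series u g u = 1"
proof (rule has_fps_expansion_unique)
  show "(\<lambda>t. aff_coord u (g t) u) has_fps_expansion germ_series u g u"
    by (rule has_germ_series[OF assms]) (use std_open_index[OF assms(2)] in simp)
  show "(\<lambda>_. 1) has_fps_expansion (1 :: complex fps)" by simp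
  show "\<forall>\<^sub>F t in nhds 0. aff_coord u (g t) u = 1"
    using hol_germs_std_open(1)[OF assms] by eventually_elim (simp add: aff_coord_self)
qed

lemma germ_series_change:
  assumes "g \<in> hol_germs m" "g 0 \<in> std_open {..m} u" "g 0 \<in> std_open {..m} v" "i \<le> m"
  shows "germ_series v g i = inverse (germ_series u g v) * germ_series u g i"
proof (rule has_fps_expansion_unique)
  have v: "v \<le> m" using std_open_index[OF assms(3)] by simp
  show "(\<lambda>t. aff_coord v (g t) i) has_fps_expansion germ_series v g i"
    using has_germ_series assms by blast
  have "fps_nth (germ_series u g v) 0 \<noteq> 0"
    using germ_series_nth_0[OF assms(1,2) v] std_open_iff_aff_coord[OF assms(2)] assms(3) by simp
  thus "(\<lambda>t. inverse (aff_coord u (g t) v) * aff_coord u (g t) i) has_fps_expansion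
      inverse (germ_series u g v) * germ_series u g i"
    using has_germ_series[OF assms(1,2)] v assms(4)
    by (intro has_fps_expansion_mult has_fps_expansion_inverse) auto
  show "\<forall>\<^sub>F t in nhds 0. aff_coord v (g t) i = inverse (aff_coord u (g t) v) * aff_coord u (g t) i"
    using hol_germs_std_open(1)[OF assms(1,2)] hol_germs_std_open(1)[OF assms(1,3)]
  proof eventually_elim
    case (elim t)
    show ?case using aff_coord_change[OF elim, of i] by (simp add: field_simps)
  qed
qed

lemma equiv_jet_rel: "equiv (hol_germs m) (jet_rel m n)"
proof (rule equivI)
  show "jet_rel m n \<subseteq> hol_germs m \<times> hol_germs m" by (auto simp: jet_rel_def)
  show "refl_on (hol_germs m) (jet_rel m n)" by (auto simp: jet_rel_def refl_on_def)
  show "sym (jet_rel m n)" unfolding sym_def jet_rel_def by simp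
  show "trans (jet_rel m n)"
    unfolding trans_def
  proof (intro allI impI)
    fix f g h assume "(f, g) \<in> jet_rel m n" "(g, h) \<in> jet_rel m n"
    thus "(f, h) \<in> jet_rel m n" unfolding jet_rel_def by simp
  qed
qed

text \<open>
  One chart is enough: the series in another chart are quotients of the given ones.
\<close>

lemma jet_relI:
  assumes g: "g \<in> hol_germs m" "g 0 \<in> std_open {..m} u"
    and h: "h \<in> hol_germs m" "h 0 \<in> std_open {..m} u"
    and eq: "\<And>i. i \<le> m \<Longrightarrow> agree n (germ_series u g i) (germ_series u h i)"
  shows "(g, h) \<in> jet_rel m n"
proof -
  have "aff_coord u (g 0) i = aff_coord u (h 0) i" for i
  proof (cases "i \<le> m")
    case True
    thus ?thesis using agree_nth[OF eq[OF True], of 0] germ_series_nth_0[OF g True] germ_series_nth_0[OF h True] by simp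
  next
    case False
    thus ?thesis using aff_coord_outside[OF g(2), of i] aff_coord_outside[OF h(2), of i] by simp
  qed
  hence "aff_coord u (g 0) = aff_coord u (h 0)" by (rule ext)
  hence "point_of {..m} (aff_coord u (g 0)) = point_of {..m} (aff_coord u (h 0))" by (rule arg_cong)
  hence gh: "g 0 = h 0" unfolding point_of_aff_coord[OF g(2)] point_of_aff_coord[OF h(2)] .
  have "germ_deriv v g i l = germ_deriv v h i l"
    if v: "v \<le> m" "g 0 \<in> std_open {..m} v" and i: "i \<le> m" and l: "l \<le> n" for v i l
  proof -
    have hv: "h 0 \<in> std_open {..m} v" using v(2) gh by simp
    have "aff_coord u (h 0) v \<noteq> 0" using std_open_iff_aff_coord[OF h(2)] hv by blast
    hence nz: "fps_nth (germ_series u h v) 0 \<noteq> 0"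
      unfolding germ_series_nth_0[OF h v(1)] .
    have "agree n (germ_series v g i) (germ_series v h i)"
      unfolding germ_series_change[OF g v(2) i] germ_series_change[OF h hv i]
      by (rule agree_mult[OF agree_inverse[OF eq[OF v(1)] nz] eq[OF i]])
    thus ?thesis using l by (simp add: germ_deriv_nth agree_nth)
  qed
  thus ?thesis using g(1) h(1) gh unfolding jet_rel_def by simp
qed

lemma jet_relD:
  assumes "(g, h) \<in> jet_rel m n" "g 0 \<in> std_open {..m} u" "i \<le> m"
  shows "agree n (germ_series u g i) (germ_series u h i)"
  using assms std_open_index[OF assms(2)] by (auto simp: jet_rel_def agree_def germ_series_nth)


section \<open>Points of the charts\<close>

text \<open>
  The coordinates of an arbitrary point are read as derivatives of a lifted disc, and those with
  \<open>Coef\<close> as the coefficients of a form.  Lifts that are not normalised are admitted, which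
  amounts to using homogeneous coordinates.
\<close>

definition jet_series :: "(coord \<Rightarrow> complex) \<Rightarrow> nat \<Rightarrow> complex fps" where
  "jet_series x k = Abs_fps (\<lambda>l. x (Jet k l) / fact l)"

definition form_series ::
    "nat \<Rightarrow> nat \<Rightarrow> ((nat \<Rightarrow> nat) \<Rightarrow> complex) \<Rightarrow> (nat \<Rightarrow> complex fps) \<Rightarrow> complex fps" where
  "form_series n d A \<zeta> = (\<Sum>\<alpha>\<in>mindices (n+1) d. fps_const (A \<alpha>) * (\<Prod>i\<le>n+1. \<zeta> i ^ \<alpha> i))"

definition coefs :: "(coord \<Rightarrow> complex) \<Rightarrow> (nat \<Rightarrow> nat) \<Rightarrow> complex" where
  "coefs x \<alpha> = x (Coef \<alpha>)"

text \<open>The equations of vertical jets in homogeneous coordinates.\<close>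

definition in_cone :: "nat \<Rightarrow> nat \<Rightarrow> (coord \<Rightarrow> complex) \<Rightarrow> bool" where
  "in_cone n d x \<longleftrightarrow> agree n (form_series n d (coefs x) (jet_series x)) 0"

lemma jet_series_nth: "fps_nth (jet_series x k) l = x (Jet k l) / fact l"
  by (simp add: jet_series_def)

lemma finite_mindices: "finite (mindices m d)"
proof (rule finite_subset)
  show "mindices m d \<subseteq> {\<alpha>. \<forall>i. (i \<in> {..m} \<longrightarrow> \<alpha> i \<in> {..d}) \<and> (i \<notin> {..m} \<longrightarrow> \<alpha> i = 0)}"
  proof
    fix \<alpha> assume a: "\<alpha> \<in> mindices m d"
    have "\<alpha> i \<le> d" if "i \<le> m" for i
      using member_le_sum[of i "{..m}" \<alpha>] that a by (simp add: mindices_def)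
    thus "\<alpha> \<in> {\<alpha>. \<forall>i. (i \<in> {..m} \<longrightarrow> \<alpha> i \<in> {..d}) \<and> (i \<notin> {..m} \<longrightarrow> \<alpha> i = 0)}"
      using a by (auto simp: mindices_def)
  qed
  show "finite {\<alpha>. \<forall>i. (i \<in> {..m} \<longrightarrow> \<alpha> i \<in> {..d}) \<and> (i \<notin> {..m} \<longrightarrow> \<alpha> i = (0::nat))}"
    by (rule finite_set_of_finite_funs) auto
qed

lemma form_series_agree:
  assumes "\<And>k. k \<le> n + 1 \<Longrightarrow> agree m (\<zeta> k) (\<xi> k)"
  shows "agree m (form_series n d A \<zeta>) (form_series n d A \<xi>)"
  unfolding form_series_def
  by (intro agree_sum agree_mult agree_prod agree_power agree_refl) (use assms in simp)

lemma form_series_cong: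
  assumes "\<And>\<alpha>. \<alpha> \<in> mindices (n+1) d \<Longrightarrow> A \<alpha> = B \<alpha>" and "\<And>k. k \<le> n + 1 \<Longrightarrow> \<zeta> k = \<xi> k"
  shows "form_series n d A \<zeta> = form_series n d B \<xi>"
  unfolding form_series_def using assms by (intro sum.cong refl arg_cong2[of _ _ _ _ "(*)"] prod.cong) auto

text \<open>
  A change of lift multiplies the equation by a unit, so it does not change the conditions up to
  any given order.
\<close>

lemma form_series_homogeneous:
  "form_series n d (\<lambda>\<alpha>. \<mu> * A \<alpha>) (\<lambda>k. \<rho> * \<zeta> k) = fps_const \<mu> * \<rho> ^ d * form_series n d A \<zeta>"
proof -
  have "(\<Prod>i\<le>n+1. (\<rho> * \<zeta> i) ^ \<alpha> i) = \<rho> ^ d * (\<Prod>i\<le>n+1. \<zeta> i ^ \<alpha> i)" if "\<alpha> \<in> mindices (n+1) d" for \<alpha>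
  proof -
    have "(\<Sum>i\<le>n+1. \<alpha> i) = d" using that by (simp add: mindices_def)
    hence "(\<Prod>i\<le>n+1. \<rho> ^ \<alpha> i) = \<rho> ^ d" by (metis power_sum)
    thus ?thesis by (simp only: power_mult_distrib prod.distrib)
  qed
  thus ?thesis
    unfolding form_series_def sum_distrib_left
    by (intro sum.cong refl) (simp add: fps_const_mult[symmetric] mult_ac del: fps_const_mult)
qed

lemma form_series_linear:
  "form_series n d (\<lambda>\<alpha>. A \<alpha> + B \<alpha>) \<zeta> = form_series n d A \<zeta> + form_series n d B \<zeta>"
  "form_series n d (\<lambda>\<alpha>. c * A \<alpha>) \<zeta> = fps_const c * form_series n d A \<zeta>"
  by (simp_all add: form_series_def sum.distrib sum_distrib_left fps_const_add[symmetric]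
      fps_const_mult[symmetric] distrib_right mult.assoc del: fps_const_add fps_const_mult)

lemma jets_memD:
  assumes "J \<in> jets m n" "g \<in> J"
  shows "g \<in> hol_germs m" and "J = jet_rel m n `` {g}"
proof -
  have "J \<in> hol_germs m // jet_rel m n" using assms(1) by (simp add: jets_def)
  then obtain h where h: "h \<in> hol_germs m" "J = jet_rel m n `` {h}" by (rule quotientE)
  have hg: "(h, g) \<in> jet_rel m n" using assms(2) h(2) by simp
  thus "g \<in> hol_germs m" by (simp add: jet_rel_def)
  show "J = jet_rel m n `` {g}" unfolding h(2) by (rule equiv_class_eq[OF equiv_jet_rel hg])
qed

lemma jets_nonempty:
  assumes "J \<in> jets m n" obtains g where "g \<in> J"
proof -
  have "J \<in> hol_germs m // jet_rel m n" using assms(1) by (simp add: jets_def)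
  then obtain h where h: "h \<in> hol_germs m" "J = jet_rel m n `` {h}" by (rule quotientE)
  show ?thesis by (rule that[of h]) (use equiv_class_self[OF equiv_jet_rel h(1)] h(2) in simp)
qed

lemma chart_domD:
  assumes "(J, P) \<in> chart_dom n d (u, b)"
  shows "J \<in> jets (n+1) n" "P \<in> std_open (mindices (n+1) d) b"
    and "g \<in> J \<Longrightarrow> g \<in> hol_germs (n+1)" "g \<in> J \<Longrightarrow> g 0 \<in> std_open {..n+1} u"
proof -
  show J: "J \<in> jets (n+1) n" and "P \<in> std_open (mindices (n+1) d) b"
    using assms by (auto simp: chart_dom_def vjets_def)
  show "g \<in> J \<Longrightarrow> g \<in> hol_germs (n+1)" using jets_memD(1)[OF J] .
  show "g \<in> J \<Longrightarrow> g 0 \<in> std_open {..n+1} u"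
    using assms by (auto simp: chart_dom_def)
qed

lemma chart_map_Jet:
  assumes dom: "(J, P) \<in> chart_dom n d (u, b)" and g: "g \<in> J" and kl: "k \<le> n+1" "l \<le> n"
  shows "chart_map n d (u, b) (J, P) (Jet k l) = germ_deriv u g k l"
proof -
  have "(THE w. \<exists>h\<in>J. w = germ_deriv u h k l) = germ_deriv u g k l"
  proof (rule the_equality)
    show "\<exists>h\<in>J. germ_deriv u g k l = germ_deriv u h k l" using g by blast
    fix w assume "\<exists>h\<in>J. w = germ_deriv u h k l"
    then obtain h where h: "h \<in> J" "w = germ_deriv u h k l" by blast
    have "(g, h) \<in> jet_rel (n+1) n" using h(1) jets_memD(2)[OF chart_domD(1)[OF dom] g] by simp
    from jet_relD[OF this chart_domD(4)[OF dom g] kl(1)] kl(2)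
    show "w = germ_deriv u g k l" unfolding h(2) germ_deriv_nth by (simp add: agree_nth)
  qed
  thus ?thesis using kl by (simp add: chart_map_def)
qed

lemma chart_map_Coef:
  assumes "(J, P) \<in> chart_dom n d (u, b)"
  shows "chart_map n d (u, b) (J, P) (Coef \<alpha>) = aff_coord b P \<alpha>"
proof (cases "\<alpha> \<in> mindices (n+1) d")
  case False
  thus ?thesis using aff_coord_outside[OF chart_domD(2)[OF assms] False] by (simp add: chart_map_def)
qed (simp add: chart_map_def)

lemma chart_map_series:
  assumes "(J, P) \<in> chart_dom n d (u, b)" "g \<in> J" "k \<le> n+1"
  shows "agree n (jet_series (chart_map n d (u, b) (J, P)) k) (germ_series u g k)"
  unfolding agree_def jet_series_nth germ_series_nth
  using chart_map_Jet[OF assms] by simp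

lemma chart_spaceI:
  assumes "x (Jet u 0) = 1" "x (Coef b) = 1" "b \<in> mindices (n+1) d"
    and "\<And>k l. k > n + 1 \<or> l > n \<Longrightarrow> x (Jet k l) = 0"
    and "\<And>l. 0 < l \<Longrightarrow> l \<le> n \<Longrightarrow> x (Jet u l) = 0"
    and "\<And>\<alpha>. \<alpha> \<notin> mindices (n+1) d \<Longrightarrow> x (Coef \<alpha>) = 0"
  shows "x \<in> chart_space n d (u, b)"
proof -
  have "x i = 0" if i: "i \<notin> free_coords n d (u, b) \<union> {Jet u 0, Coef b}" for i
  proof (cases i)
    case (Jet k l)
    consider "k > n + 1 \<or> l > n" | "k = u" "0 < l" "l \<le> n"
      using i Jet by (fastforce simp: free_coords_def)
    thus ?thesis using assms(4,5) Jet by cases auto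
  next
    case (Coef \<alpha>)
    hence "\<alpha> \<notin> mindices (n+1) d" using i by (auto simp: free_coords_def)
    thus ?thesis using assms(6) Coef by simp
  qed
  thus ?thesis using assms(1,2) by (simp add: chart_space_def)
qed

lemma chart_spaceD:
  assumes "x \<in> chart_space n d (u, b)"
  shows "x (Jet u 0) = 1" "x (Coef b) = 1"
    and "k > n + 1 \<or> l > n \<Longrightarrow> u \<le> n + 1 \<Longrightarrow> x (Jet k l) = 0"
    and "0 < l \<Longrightarrow> x (Jet u l) = 0"
    and "\<alpha> \<notin> mindices (n+1) d \<Longrightarrow> b \<in> mindices (n+1) d \<Longrightarrow> x (Coef \<alpha>) = 0"
    and "i \<notin> free_coords n d (u, b) \<union> {Jet u 0, Coef b} \<Longrightarrow> x i = 0"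
proof -
  show 1: "x (Jet u 0) = 1" "x (Coef b) = 1" using assms by (simp_all add: chart_space_def)
  show 2: "x i = 0" if "i \<notin> free_coords n d (u, b) \<union> {Jet u 0, Coef b}" for i
    using assms that by (simp add: chart_space_def)
  show "x (Jet k l) = 0" if "k > n + 1 \<or> l > n" "u \<le> n + 1"
  proof (cases "k = u \<and> l = 0")
    case False
    thus ?thesis using that by (intro 2) (auto simp: free_coords_def)
  qed (use that in auto)
  show "x (Jet u l) = 0" if "0 < l"
    using that by (intro 2) (auto simp: free_coords_def)
  show "x (Coef \<alpha>) = 0" if "\<alpha> \<notin> mindices (n+1) d" "b \<in> mindices (n+1) d"
    using that by (intro 2) (auto simp: free_coords_def)
qed

lemma jet_series_chart_space:
  assumes "x \<in> chart_space n d (u, b)" shows "jet_series x u = 1"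
proof (rule fps_ext)
  fix l show "fps_nth (jet_series x u) l = fps_nth 1 l"
    using chart_spaceD(1,4)[OF assms] by (cases l) (simp_all add: jet_series_nth)
qed

lemma chart_map_in_space:
  assumes c: "(u, b) \<in> charts n d" and p: "p \<in> chart_dom n d (u, b)"
  shows "chart_map n d (u, b) p \<in> chart_space n d (u, b)"
proof -
  obtain J P where JP: "p = (J, P)" by (cases p)
  note dom = p[unfolded JP]
  obtain g where g: "g \<in> J" using jets_nonempty[OF chart_domD(1)[OF dom]] .
  have u: "u \<le> n + 1" and b: "b \<in> mindices (n+1) d" using c by (auto simp: charts_def)
  have self: "germ_series u g u = 1"
    using germ_series_self[OF chart_domD(3)[OF dom g] chart_domD(4)[OF dom g]] .
  have J: "chart_map n d (u, b) p (Jet u l) = fact l * fps_nth 1 l" if "l \<le> n" for l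
    unfolding JP chart_map_Jet[OF dom g u that] germ_deriv_nth self ..
  show ?thesis
  proof (rule chart_spaceI)
    show "chart_map n d (u, b) p (Jet u 0) = 1" using J[of 0] by simp
    show "chart_map n d (u, b) p (Coef b) = 1"
      unfolding JP chart_map_Coef[OF dom] by (rule aff_coord_self[OF chart_domD(2)[OF dom]])
    show "b \<in> mindices (n+1) d" by (rule b)
    show "chart_map n d (u, b) p (Jet k l) = 0" if "k > n + 1 \<or> l > n" for k l
      using that by (auto simp: chart_map_def JP)
    show "chart_map n d (u, b) p (Jet u l) = 0" if "0 < l" "l \<le> n" for l
      using J[OF that(2)] that(1) by simp
    show "chart_map n d (u, b) p (Coef \<alpha>) = 0" if "\<alpha> \<notin> mindices (n+1) d" for \<alpha>
      using that by (simp add: chart_map_def JP)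
  qed
qed

lemma chart_map_inj:
  assumes c: "(u, b) \<in> charts n d"
    and p: "p \<in> chart_dom n d (u, b)" and q: "q \<in> chart_dom n d (u, b)"
    and eq: "chart_map n d (u, b) p = chart_map n d (u, b) q"
  shows "p = q"
proof -
  obtain J P where JP: "p = (J, P)" by (cases p)
  obtain K Q where KQ: "q = (K, Q)" by (cases q)
  note p = p[unfolded JP] and q = q[unfolded KQ]
  obtain g where g: "g \<in> J" using jets_nonempty[OF chart_domD(1)[OF p]] .
  obtain h where h: "h \<in> K" using jets_nonempty[OF chart_domD(1)[OF q]] .
  have "agree n (germ_series u g k) (germ_series u h k)" if k: "k \<le> n+1" for k
    using agree_trans[OF agree_sym[OF chart_map_series[OF p g k]]
      chart_map_series[OF q h k, folded KQ, folded eq, unfolded JP]] .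
  hence "(g, h) \<in> jet_rel (n+1) n"
    using jet_relI[OF chart_domD(3,4)[OF p g] chart_domD(3,4)[OF q h]] by blast
  hence "J = K"
    unfolding jets_memD(2)[OF chart_domD(1)[OF p] g] jets_memD(2)[OF chart_domD(1)[OF q] h]
    by (rule equiv_class_eq[OF equiv_jet_rel])
  moreover have "aff_coord b P = aff_coord b Q"
  proof
    fix \<alpha> show "aff_coord b P \<alpha> = aff_coord b Q \<alpha>"
      using fun_cong[OF eq, of "Coef \<alpha>"] unfolding JP KQ chart_map_Coef[OF p] chart_map_Coef[OF q] .
  qed
  hence "point_of (mindices (n+1) d) (aff_coord b P) = point_of (mindices (n+1) d) (aff_coord b Q)"
    by (rule arg_cong)
  hence "P = Q"
    unfolding point_of_aff_coord[OF chart_domD(2)[OF p]] point_of_aff_coord[OF chart_domD(2)[OF q]] .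
  ultimately show ?thesis unfolding JP KQ by simp
qed

text \<open>The Taylor polynomials with the prescribed coefficients define a disc.\<close>

lemma chart_map_surj:
  assumes c: "(u, b) \<in> charts n d" and x: "x \<in> chart_space n d (u, b)"
  obtains p where "p \<in> chart_dom n d (u, b)" "chart_map n d (u, b) p = x"
proof -
  have u: "u \<le> n + 1" and b: "b \<in> mindices (n+1) d" using c by (auto simp: charts_def)
  define Z where "Z t k = (\<Sum>l\<le>n. x (Jet k l) / fact l * t ^ l)" for t :: complex and k
  define S where "S k = (\<Sum>l\<le>n. fps_const (x (Jet k l) / fact l) * fps_X ^ l)" for k
  have ZS: "(\<lambda>t. Z t k) has_fps_expansion S k" for k
    unfolding Z_def S_def
    by (intro has_fps_expansion_sum has_fps_expansion_mult has_fps_expansion_const has_fps_expansion_fps_X_power)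
  have S_nth: "fps_nth (S k) l = x (Jet k l) / fact l" if "l \<le> n" for k l
  proof -
    have "fps_nth (S k) l = (\<Sum>m\<le>n. if m = l then x (Jet k m) / fact m else 0)"
      unfolding S_def fps_sum_nth by (intro sum.cong refl) (auto simp: fps_X_power_nth)
    thus ?thesis using that by simp
  qed
  have Zu: "Z t u = 1" for t
  proof -
    have "Z t u = (\<Sum>l\<le>n. if l = 0 then 1 else 0)"
      unfolding Z_def using chart_spaceD(1,4)[OF x] by (intro sum.cong refl) auto
    thus ?thesis by simp
  qed
  have Z0: "Z t k = 0" if "k > n+1" for t k
    unfolding Z_def using chart_spaceD(3)[OF x _ u] that by (intro sum.neutral) auto
  have Zh: "Z t \<in> hom_vecs {..n+1}" for t
    using Z0 Zu u by (auto simp: hom_vecs_def intro!: bexI[of _ u])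
  define g where "g t = point_of {..n+1} (Z t)" for t
  have gu: "g t \<in> std_open {..n+1} u" for t
    unfolding g_def using point_of_in_std_open[OF Zh] Zu by simp
  have ga: "aff_coord u (g t) k = Z t k" for t k
    unfolding g_def using aff_coord_point_of[OF Zh[of t], of u k] Zu by simp
  have gh: "g \<in> hol_germs (n+1)"
    unfolding hol_germs_def mem_Collect_eq
  proof (intro exI conjI allI impI)
    show "u \<le> n + 1" by (rule u)
    show "\<forall>\<^sub>F t in nhds 0. g t \<in> std_open {..n+1} u" using gu by simp
    show "(\<lambda>t. aff_coord u (g t) i) analytic_on {0}" for i
      unfolding ga Z_def by (intro analytic_intros)
  qed
  have gser: "germ_series u g k = S k" if k: "k \<le> n + 1" for k
    by (rule has_fps_expansion_unique[OF has_germ_series[OF gh gu k] ZS]) (simp add: ga)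
  define A where "A \<alpha> = x (Coef \<alpha>)" for \<alpha>
  have Ah: "A \<in> hom_vecs (mindices (n+1) d)"
    using chart_spaceD(2)[OF x] chart_spaceD(5)[OF x _ b] b unfolding hom_vecs_def A_def
    by (auto intro!: bexI[of _ b])
  have Ab: "A b = 1" unfolding A_def by (rule chart_spaceD(2)[OF x])
  define J where "J = jet_rel (n+1) n `` {g}"
  define P where "P = point_of (mindices (n+1) d) A"
  have Jj: "J \<in> jets (n+1) n" unfolding J_def jets_def using gh by (rule quotientI)
  have gJ: "g \<in> J" unfolding J_def by (rule equiv_class_self[OF equiv_jet_rel gh])
  have "h 0 = g 0" if "h \<in> J" for h using that unfolding J_def jet_rel_def by simp
  hence "h 0 \<in> std_open {..n+1} u" if "h \<in> J" for h using gu[of 0] that by simp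
  moreover have Pb: "P \<in> std_open (mindices (n+1) d) b"
    unfolding P_def using point_of_in_std_open[OF Ah] Ab by simp
  ultimately have dom: "(J, P) \<in> chart_dom n d (u, b)"
    using Jj std_open_proj[OF Pb] by (simp add: chart_dom_def vjets_def)
  have "chart_map n d (u, b) (J, P) i = x i" for i
  proof (cases i)
    case (Jet k l)
    show ?thesis
    proof (cases "k \<le> n+1 \<and> l \<le> n")
      case True
      thus ?thesis unfolding Jet using chart_map_Jet[OF dom gJ, of k l] gser[of k] S_nth[of l k]
        by (simp add: germ_deriv_nth)
    next
      case False
      hence "x (Jet k l) = 0" using chart_spaceD(3)[OF x _ u, of k l] by auto
      thus ?thesis unfolding Jet using False by (auto simp: chart_map_def)
    qed
  next
    case (Coef \<alpha>)
    show ?thesis unfolding Coef chart_map_Coef[OF dom] unfolding P_def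
      using aff_coord_point_of[OF Ah, of b \<alpha>] Ab by (simp add: A_def)
  qed
  hence "chart_map n d (u, b) (J, P) = x" by (rule ext)
  with dom show ?thesis by (rule that)
qed

lemma in_chart_dom_iff:
  assumes c: "(u, b) \<in> charts n d" and p: "p \<in> chart_dom n d (u, b)" and c': "(v, a) \<in> charts n d"
  shows "p \<in> chart_dom n d (v, a) \<longleftrightarrow>
    chart_map n d (u, b) p (Jet v 0) \<noteq> 0 \<and> chart_map n d (u, b) p (Coef a) \<noteq> 0"
proof -
  obtain J P where JP: "p = (J, P)" by (cases p)
  note dom = p[unfolded JP]
  obtain g where g: "g \<in> J" using jets_nonempty[OF chart_domD(1)[OF dom]] .
  have v: "v \<le> n + 1" using c' by (auto simp: charts_def)
  have h: "h 0 = g 0" if "h \<in> J" for h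
    using that jets_memD(2)[OF chart_domD(1)[OF dom] g] unfolding jet_rel_def by auto
  have all: "(\<forall>h\<in>J. h 0 \<in> S) \<longleftrightarrow> g 0 \<in> S" for S
  proof
    assume "g 0 \<in> S"
    show "\<forall>h\<in>J. h 0 \<in> S"
    proof
      fix f assume "f \<in> J"
      show "f 0 \<in> S" unfolding h[OF \<open>f \<in> J\<close>] by fact
    qed
  qed (use g in blast)
  have "p \<in> chart_dom n d (v, a) \<longleftrightarrow> g 0 \<in> std_open {..n+1} v \<and> P \<in> std_open (mindices (n+1) d) a"
    unfolding JP chart_dom_def prod.case mem_Collect_eq all
    using chart_domD(1)[OF dom] std_open_proj[OF chart_domD(2)[OF dom]] by (simp add: vjets_def)
  also have "g 0 \<in> std_open {..n+1} v \<longleftrightarrow> chart_map n d (u, b) p (Jet v 0) \<noteq> 0"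
    unfolding std_open_iff_aff_coord[OF chart_domD(4)[OF dom g]] JP chart_map_Jet[OF dom g v le0]
    by (simp add: germ_deriv_def)
  also have "P \<in> std_open (mindices (n+1) d) a \<longleftrightarrow> chart_map n d (u, b) p (Coef a) \<noteq> 0"
    unfolding std_open_iff_aff_coord[OF chart_domD(2)[OF dom]] JP chart_map_Coef[OF dom] ..
  finally show ?thesis .
qed

lemma chart_change:
  assumes p: "p \<in> chart_dom n d (u, b)" and p': "p \<in> chart_dom n d (v, a)"
  defines "x \<equiv> chart_map n d (u, b) p" and "y \<equiv> chart_map n d (v, a) p"
  shows "k \<le> n + 1 \<Longrightarrow> agree n (jet_series y k) (inverse (jet_series x v) * jet_series x k)"
    and "coefs y \<alpha> = inverse (coefs x a) * coefs x \<alpha>"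
proof -
  obtain J P where JP: "p = (J, P)" by (cases p)
  note dom = p[unfolded JP] and dom' = p'[unfolded JP]
  obtain g where g: "g \<in> J" using jets_nonempty[OF chart_domD(1)[OF dom]] .
  note gh = chart_domD(3)[OF dom g] and gu = chart_domD(4)[OF dom g] and gv = chart_domD(4)[OF dom' g]
  have v: "v \<le> n + 1" using std_open_index[OF gv] by simp
  show "agree n (jet_series y k) (inverse (jet_series x v) * jet_series x k)" if k: "k \<le> n + 1"
  proof -
    have nz: "fps_nth (germ_series u g v) 0 \<noteq> 0"
      unfolding germ_series_nth_0[OF gh gu v] using std_open_iff_aff_coord[OF gu] gv by blast
    have "agree n (jet_series y k) (inverse (germ_series u g v) * germ_series u g k)"
      unfolding y_def JP germ_series_change[OF gh gu gv k, symmetric]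
      by (rule chart_map_series[OF dom' g k])
    also have "agree n (inverse (germ_series u g v) * germ_series u g k) (inverse (jet_series x v) * jet_series x k)"
      unfolding x_def JP
      by (rule agree_sym) (rule agree_mult[OF agree_inverse[OF chart_map_series[OF dom g v] nz] chart_map_series[OF dom g k]])
    finally show ?thesis .
  qed
  show "coefs y \<alpha> = inverse (coefs x a) * coefs x \<alpha>"
    unfolding coefs_def y_def x_def JP chart_map_Coef[OF dom] chart_map_Coef[OF dom']
      aff_coord_change[OF chart_domD(2)[OF dom] chart_domD(2)[OF dom']] by (simp add: divide_inverse mult.commute)
qed

lemma vjets_cover:
  assumes "p \<in> vjets n d" obtains c where "c \<in> charts n d" "p \<in> chart_dom n d c"
proof -
  obtain J P where JP: "p = (J, P)" by (cases p)
  have J: "J \<in> jets (n+1) n" and P: "P \<in> proj_space (mindices (n+1) d)"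
    using assms by (auto simp: vjets_def JP)
  obtain g where g: "g \<in> J" using jets_nonempty[OF J] .
  obtain b where b: "b \<in> mindices (n+1) d" "P \<in> std_open (mindices (n+1) d) b"
    using proj_space_cover[OF P] .
  obtain u where u: "u \<le> n+1" "\<forall>\<^sub>F t in nhds 0. g t \<in> std_open {..n+1} u"
    using jets_memD(1)[OF J g] unfolding hol_germs_def by blast
  have g0: "g 0 \<in> std_open {..n+1} u" using u(2) by (rule eventually_nhds_x_imp_x)
  have h: "h 0 = g 0" if "h \<in> J" for h
    using that jets_memD(2)[OF J g] unfolding jet_rel_def by auto
  have "h 0 \<in> std_open {..n+1} u" if "h \<in> J" for h unfolding h[OF that] by (rule g0)
  hence "p \<in> chart_dom n d (u, b)"
    unfolding JP chart_dom_def using b J P by (simp add: vjets_def)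
  moreover have "(u, b) \<in> charts n d" using u(1) b(1) by (simp add: charts_def)
  ultimately show ?thesis using that by blast
qed

lemma has_form_series:
  assumes "g \<in> hol_germs (n+1)" "g 0 \<in> std_open {..n+1} v"
  shows "(\<lambda>t. univ_form n d A (aff_coord v (g t))) has_fps_expansion form_series n d A (germ_series v g)"
  unfolding univ_form_def form_series_def
  by (intro has_fps_expansion_sum has_fps_expansion_mult has_fps_expansion_prod
        has_fps_expansion_power has_fps_expansion_const has_germ_series[OF assms]) simp

text \<open>
  The conditions for all charts and all representatives follow from those for one of them, by
  homogeneity.
\<close>

lemma Jvert_iff:
  assumes c: "(u, b) \<in> charts n d" and p: "p \<in> chart_dom n d (u, b)"
  shows "p \<in> Jvert n d \<longleftrightarrow> in_cone n d (chart_map n d (u, b) p)"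
proof -
  obtain J P where JP: "p = (J, P)" by (cases p)
  note dom = p[unfolded JP]
  define x where "x = chart_map n d (u, b) p"
  have u: "u \<le> n + 1" using c by (auto simp: charts_def)
  have pv: "(J, P) \<in> vjets n d" using dom by (auto simp: chart_dom_def)
  have PM: "P \<in> std_open (mindices (n+1) d) b" using chart_domD(2)[OF dom] .
  have der: "(\<forall>\<kappa>\<le>n. (deriv ^^ \<kappa>) (\<lambda>t. univ_form n d A (aff_coord v (g t))) 0 = 0) \<longleftrightarrow>
      agree n (form_series n d A (germ_series v g)) 0"
    if g: "g \<in> J" and v: "g 0 \<in> std_open {..n+1} v" for g A v
    unfolding agree_def fps_nth_fps_expansion[OF has_form_series[OF chart_domD(3)[OF dom g] v]] by simp
  have coefs: "coefs x = aff_coord b P"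
    by (rule ext) (simp only: coefs_def x_def JP chart_map_Coef[OF dom])
  have x: "agree n (form_series n d (coefs x) (germ_series u g)) (form_series n d (coefs x) (jet_series x))"
    if g: "g \<in> J" for g
    unfolding x_def JP by (intro form_series_agree agree_sym[OF chart_map_series[OF dom g]])
  show ?thesis
    unfolding x_def[symmetric]
  proof
    assume "p \<in> Jvert n d"
    obtain g where g: "g \<in> J" using jets_nonempty[OF chart_domD(1)[OF dom]] .
    have "\<forall>\<kappa>\<le>n. (deriv ^^ \<kappa>) (\<lambda>t. univ_form n d (aff_coord b P) (aff_coord u (g t))) 0 = 0"
      using \<open>p \<in> Jvert n d\<close> g aff_coord_mem[OF PM] u chart_domD(4)[OF dom g]
      unfolding JP Jvert_def by blast
    hence "agree n (form_series n d (coefs x) (germ_series u g)) 0"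
      unfolding coefs der[OF g chart_domD(4)[OF dom g]] .
    thus "in_cone n d x" unfolding in_cone_def by (rule agree_trans[OF agree_sym[OF x[OF g]]])
  next
    assume cone: "in_cone n d x"
    have "\<forall>\<kappa>\<le>n. (deriv ^^ \<kappa>) (\<lambda>t. univ_form n d A (aff_coord v (g t))) 0 = 0"
      if g: "g \<in> J" and A: "A \<in> P" and v: "v \<le> n + 1" "g 0 \<in> std_open {..n+1} v" for g A v
    proof -
      obtain r where r: "A = (\<lambda>i. r * aff_coord b P i)" using std_open_mem_eq[OF PM A] by blast
      have "form_series n d A (germ_series v g) =
          form_series n d (\<lambda>i. r * coefs x i) (\<lambda>k. inverse (germ_series u g v) * germ_series u g k)"
        unfolding r coefs
        by (intro form_series_cong refl germ_series_change[OF chart_domD(3)[OF dom g] chart_domD(4)[OF dom g] v(2)]) simp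
      also have "\<dots> = fps_const r * inverse (germ_series u g v) ^ d * form_series n d (coefs x) (germ_series u g)"
        by (rule form_series_homogeneous)
      also have "agree n \<dots> (fps_const r * inverse (germ_series u g v) ^ d * 0)"
        by (rule agree_mult[OF agree_refl agree_trans[OF x[OF g] cone[unfolded in_cone_def]]])
      finally show ?thesis unfolding der[OF g v(2)] by simp
    qed
    thus "p \<in> Jvert n d" using pv unfolding JP Jvert_def by simp
  qed
qed

lemma Jvert_chart_iff:
  assumes c: "(u, b) \<in> charts n d"
  shows "x \<in> Jvert_chart n d (u, b) \<longleftrightarrow> x \<in> chart_space n d (u, b) \<and> in_cone n d x"
proof
  assume "x \<in> Jvert_chart n d (u, b)"
  then obtain p where "p \<in> Jvert n d" "p \<in> chart_dom n d (u, b)" "x = chart_map n d (u, b) p"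
    unfolding Jvert_chart_def by blast
  thus "x \<in> chart_space n d (u, b) \<and> in_cone n d x"
    using chart_map_in_space[OF c] Jvert_iff[OF c] by simp
next
  assume x: "x \<in> chart_space n d (u, b) \<and> in_cone n d x"
  obtain p where p: "p \<in> chart_dom n d (u, b)" "chart_map n d (u, b) p = x"
    using chart_map_surj[OF c, of x] x by blast
  hence "p \<in> Jvert n d" using Jvert_iff[OF c p(1)] x by simp
  thus "x \<in> Jvert_chart n d (u, b)" unfolding Jvert_chart_def using p by blast
qed


section \<open>Polynomial functions along curves\<close>

lemma poly_uminus: "f \<in> poly_funs \<Longrightarrow> (\<lambda>x. - f x) \<in> poly_funs"
  using poly_funs.mult[OF poly_funs.const[of "-1"], of f] by simp

lemma poly_diff: "f \<in> poly_funs \<Longrightarrow> g \<in> poly_funs \<Longrightarrow> (\<lambda>x. f x - g x) \<in> poly_funs"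
  using poly_funs.add[OF _ poly_uminus, of f g] by simp

lemma poly_power: "f \<in> poly_funs \<Longrightarrow> (\<lambda>x. f x ^ k) \<in> poly_funs"
  by (induction k) (auto intro: poly_funs.const poly_funs.mult)

lemma poly_sum: "(\<And>i. i \<in> I \<Longrightarrow> f i \<in> poly_funs) \<Longrightarrow> (\<lambda>x. \<Sum>i\<in>I. f i x) \<in> poly_funs"
  by (induction I rule: infinite_finite_induct) (auto intro: poly_funs.const poly_funs.add)

lemma poly_prod: "(\<And>i. i \<in> I \<Longrightarrow> f i \<in> poly_funs) \<Longrightarrow> (\<lambda>x. \<Prod>i\<in>I. f i x) \<in> poly_funs"
  by (induction I rule: infinite_finite_induct) (auto intro: poly_funs.const poly_funs.mult)

lemma poly_tendsto:
  assumes "f \<in> poly_funs" and "\<And>i. ((\<lambda>s. \<gamma> s i) \<longlongrightarrow> x i) F"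
  shows "((\<lambda>s. f (\<gamma> s)) \<longlongrightarrow> f x) F"
  using assms(1) by induction (auto intro: tendsto_intros assms(2))

lemma poly_coord_differentiable:
  assumes "f \<in> poly_funs" shows "(\<lambda>s. f (x(i := s))) field_differentiable at z"
  using assms
proof induction
  case (coord j)
  show ?case by (cases "i = j") (auto intro: derivative_intros)
qed (auto intro: field_differentiable_add field_differentiable_mult)

lemma pderiv_coord_const [simp]: "pderiv_coord i (\<lambda>_. w) x = 0"
  by (simp add: pderiv_coord_def)

lemma pderiv_coord_coord [simp]: "pderiv_coord i (\<lambda>x. x j) x = (if i = j then 1 else 0)"
  by (auto simp: pderiv_coord_def)

lemma pderiv_coord_add:
  "f \<in> poly_funs \<Longrightarrow> g \<in> poly_funs \<Longrightarrow>
    pderiv_coord i (\<lambda>x. f x + g x) x = pderiv_coord i f x + pderiv_coord i g x"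
  unfolding pderiv_coord_def by (rule deriv_add) (auto intro: poly_coord_differentiable)

lemma pderiv_coord_mult:
  "f \<in> poly_funs \<Longrightarrow> g \<in> poly_funs \<Longrightarrow>
    pderiv_coord i (\<lambda>x. f x * g x) x = f x * pderiv_coord i g x + pderiv_coord i f x * g x"
  unfolding pderiv_coord_def
  by (subst deriv_mult) (auto intro: poly_coord_differentiable)

lemma poly_pderiv_coord: "f \<in> poly_funs \<Longrightarrow> pderiv_coord i f \<in> poly_funs"
proof (induction rule: poly_funs.induct)
  case (const w)
  have "pderiv_coord i (\<lambda>_. w) = (\<lambda>_. 0)" by (rule ext) simp
  thus ?case by (simp add: poly_funs.const)
next
  case (coord j)
  have "pderiv_coord i (\<lambda>x. x j) = (\<lambda>_. if i = j then 1 else 0)" by (rule ext) simp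
  thus ?case by (simp add: poly_funs.const)
next
  case (add f g)
  have "pderiv_coord i (\<lambda>x. f x + g x) = (\<lambda>x. pderiv_coord i f x + pderiv_coord i g x)"
    by (rule ext) (rule pderiv_coord_add[OF add(1,2)])
  thus ?case using add by (simp add: poly_funs.add)
next
  case (mult f g)
  have "pderiv_coord i (\<lambda>x. f x * g x) = (\<lambda>x. f x * pderiv_coord i g x + pderiv_coord i f x * g x)"
    by (rule ext) (rule pderiv_coord_mult[OF mult(1,2)])
  thus ?case using mult by (simp add: poly_funs.add poly_funs.mult)
qed

lemma poly_chain_rule:
  assumes f: "f \<in> poly_funs" and S: "finite S" "\<And>i. i \<notin> S \<Longrightarrow> v i = 0"
    and \<gamma>: "\<And>i. ((\<lambda>s. \<gamma> s i) has_field_derivative v i) (at s0)"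
  shows "((\<lambda>s. f (\<gamma> s)) has_field_derivative (\<Sum>i\<in>S. v i * pderiv_coord i f (\<gamma> s0))) (at s0)"
  using f
proof induction
  case (const w)
  show ?case by simp
next
  case (coord j)
  have "(\<Sum>i\<in>S. v i * pderiv_coord i (\<lambda>x. x j) (\<gamma> s0)) = (\<Sum>i\<in>S. if i = j then v i else 0)"
    by (intro sum.cong) auto
  also have "\<dots> = v j" using S by auto
  finally show ?case using \<gamma>[of j] by simp
next
  case (add f g)
  show ?case
    using DERIV_add[OF add.IH] by (simp add: pderiv_coord_add[OF add.hyps] distrib_left sum.distrib)
next
  case (mult f g)
  show ?case
    using DERIV_mult[OF mult.IH]
    by (simp add: pderiv_coord_mult[OF mult.hyps] distrib_left distrib_right sum.distrib sum_distrib_left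
        sum_distrib_right mult_ac add.commute)
qed

lemma free_coords_finite: "finite (free_coords n d c)"
proof -
  obtain u b where c: "c = (u, b)" by (cases c)
  have "free_coords n d c \<subseteq> case_prod Jet ` ({..n+1} \<times> {..n}) \<union> Coef ` mindices (n+1) d"
    by (auto simp: free_coords_def c)
  thus ?thesis by (rule finite_subset) (auto intro: finite_mindices)
qed

lemma vec_apply_curve:
  assumes "f \<in> poly_funs" "v \<in> chart_vecs n d c"
    and "\<And>i. ((\<lambda>s. \<gamma> s i) has_field_derivative v i) (at s0)"
  shows "((\<lambda>s. f (\<gamma> s)) has_field_derivative vec_apply n d c v (\<gamma> s0) f) (at s0)"
  unfolding vec_apply_def
  by (rule poly_chain_rule[OF assms(1) free_coords_finite _ assms(3)])
     (use assms(2) in \<open>simp add: chart_vecs_def\<close>)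

text \<open>
  At a singular point the ideal of the jet space is not given by the equations at hand.  Curves in
  the jet space produce tangent vectors without any knowledge of the ideal.
\<close>

lemma tangent_spaceI:
  assumes v: "v \<in> chart_vecs n d c"
    and \<gamma>: "\<And>i. ((\<lambda>s. \<gamma> s i) has_field_derivative v i) (at 0)" "\<gamma> 0 = chart_map n d c p"
    and J: "\<forall>\<^sub>F s in nhds 0. \<gamma> s \<in> Jvert_chart n d c"
  shows "v \<in> tangent_space n d c p"
proof -
  have "vec_apply n d c v (chart_map n d c p) f = 0"
    if f: "f \<in> poly_funs" "\<forall>x\<in>Jvert_chart n d c. f x = 0" for f
  proof -
    have "((\<lambda>s. f (\<gamma> s)) has_field_derivative vec_apply n d c v (\<gamma> 0) f) (at 0)"
      by (rule vec_apply_curve[OF f(1) v \<gamma>(1)])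
    moreover have "\<forall>\<^sub>F s in nhds 0. f (\<gamma> s) = 0"
      using J by eventually_elim (use f(2) in blast)
    hence "((\<lambda>s. f (\<gamma> s)) has_field_derivative 0) (at 0)"
      by (subst DERIV_cong_ev[where g = "\<lambda>_. 0"]) auto
    ultimately show ?thesis unfolding \<gamma>(2) by (rule DERIV_unique)
  qed
  thus ?thesis using v by (simp add: tangent_space_def)
qed

definition poly_series :: "((coord \<Rightarrow> complex) \<Rightarrow> complex fps) \<Rightarrow> bool" where
  "poly_series F \<longleftrightarrow> (\<forall>m. (\<lambda>x. fps_nth (F x) m) \<in> poly_funs)"

lemma poly_series_nth: "poly_series F \<Longrightarrow> (\<lambda>x. fps_nth (F x) m) \<in> poly_funs"
  by (simp add: poly_series_def)

lemma poly_series_const: "f \<in> poly_funs \<Longrightarrow> poly_series (\<lambda>x. fps_const (f x))"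
  unfolding poly_series_def
proof
  fix m assume "f \<in> poly_funs"
  thus "(\<lambda>x. fps_nth (fps_const (f x)) m) \<in> poly_funs"
    by (cases m) (simp_all add: poly_funs.const)
qed

lemma poly_series_fixed: "poly_series (\<lambda>x. F)"
  by (simp add: poly_series_def poly_funs.const)

lemma poly_series_add: "poly_series F \<Longrightarrow> poly_series G \<Longrightarrow> poly_series (\<lambda>x. F x + G x)"
  by (simp add: poly_series_def poly_funs.add)

lemma poly_series_diff: "poly_series F \<Longrightarrow> poly_series G \<Longrightarrow> poly_series (\<lambda>x. F x - G x)"
  by (simp add: poly_series_def poly_diff)

lemma poly_series_mult: "poly_series F \<Longrightarrow> poly_series G \<Longrightarrow> poly_series (\<lambda>x. F x * G x)"
  by (simp add: poly_series_def fps_mult_nth poly_sum poly_funs.mult)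

lemma poly_series_power: "poly_series F \<Longrightarrow> poly_series (\<lambda>x. F x ^ k)"
  by (induction k) (auto intro: poly_series_fixed poly_series_mult)

lemma poly_series_sum: "(\<And>i. i \<in> I \<Longrightarrow> poly_series (F i)) \<Longrightarrow> poly_series (\<lambda>x. \<Sum>i\<in>I. F i x)"
  by (induction I rule: infinite_finite_induct) (auto intro: poly_series_fixed poly_series_add)

lemma poly_series_prod: "(\<And>i. i \<in> I \<Longrightarrow> poly_series (F i)) \<Longrightarrow> poly_series (\<lambda>x. \<Prod>i\<in>I. F i x)"
  by (induction I rule: infinite_finite_induct) (auto intro: poly_series_fixed poly_series_mult)

lemma poly_series_jet: "poly_series (\<lambda>x. jet_series x k)"
proof -
  have "(\<lambda>x. x (Jet k m) * (1 / fact m)) \<in> poly_funs" for m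
    by (intro poly_funs.mult poly_funs.coord poly_funs.const)
  thus ?thesis by (simp add: poly_series_def jet_series_nth)
qed

lemma poly_coefs: "(\<lambda>x. coefs x \<alpha>) \<in> poly_funs"
  by (simp add: coefs_def poly_funs.coord)

lemma poly_series_form:
  assumes "\<And>\<alpha>. \<alpha> \<in> mindices (n+1) d \<Longrightarrow> (\<lambda>x. A x \<alpha>) \<in> poly_funs"
    and "\<And>k. k \<le> n+1 \<Longrightarrow> poly_series (\<lambda>x. \<zeta> x k)"
  shows "poly_series (\<lambda>x. form_series n d (A x) (\<zeta> x))"
  unfolding form_series_def
  by (intro poly_series_sum poly_series_mult poly_series_const poly_series_prod poly_series_power)
     (auto intro: assms)


section \<open>Rescaling the coefficients\<close>

text \<open>
  Points of a chart whose form has not been normalised yet.  Curves are first written with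
  such points and then rescaled.
\<close>

definition chart_vector :: "nat \<Rightarrow> nat \<Rightarrow> chart \<Rightarrow> (coord \<Rightarrow> complex) \<Rightarrow> bool" where
  "chart_vector n d c y \<longleftrightarrow>
     (\<forall>i. i \<notin> free_coords n d c \<union> {Coef (snd c)} \<longrightarrow> y i = (if i = Jet (fst c) 0 then 1 else 0))"

definition unit_coef :: "(nat \<Rightarrow> nat) \<Rightarrow> (coord \<Rightarrow> complex) \<Rightarrow> coord \<Rightarrow> complex" where
  "unit_coef b y i = (case i of Jet k l \<Rightarrow> y (Jet k l) | Coef \<alpha> \<Rightarrow> y (Coef \<alpha>) / y (Coef b))"

lemma chart_vector_chart_space: "x \<in> chart_space n d c \<Longrightarrow> chart_vector n d c x"
  by (cases c) (auto simp: chart_vector_def chart_space_def)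

lemma unit_coef_chart_space:
  assumes "chart_vector n d (u, b) y" "y (Coef b) \<noteq> 0"
  shows "unit_coef b y \<in> chart_space n d (u, b)"
proof -
  have y: "y i = (if i = Jet u 0 then 1 else 0)" if "i \<notin> free_coords n d (u, b) \<union> {Coef b}" for i
    using assms(1) that by (simp add: chart_vector_def)
  have "unit_coef b y i = 0" if "i \<notin> free_coords n d (u, b) \<union> {Jet u 0, Coef b}" for i
    using y[of i] that by (cases i) (auto simp: unit_coef_def)
  moreover have "unit_coef b y (Jet u 0) = 1"
    using y[of "Jet u 0"] by (simp add: unit_coef_def free_coords_def)
  moreover have "unit_coef b y (Coef b) = 1" using assms(2) by (simp add: unit_coef_def)
  ultimately show ?thesis by (simp add: chart_space_def)
qed

lemma jet_series_unit_coef: "jet_series (unit_coef b y) = jet_series y"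
  by (rule ext) (simp add: jet_series_def unit_coef_def)

lemma coefs_unit_coef: "coefs (unit_coef b y) \<alpha> = inverse (y (Coef b)) * coefs y \<alpha>"
  by (simp add: coefs_def unit_coef_def divide_inverse mult.commute)

lemma in_cone_unit_coef:
  assumes "in_cone n d y" shows "in_cone n d (unit_coef b y)"
proof -
  have "form_series n d (coefs (unit_coef b y)) (jet_series (unit_coef b y)) =
      fps_const (inverse (y (Coef b))) * form_series n d (coefs y) (jet_series y)"
    unfolding jet_series_unit_coef form_series_linear(2)[symmetric]
    by (intro form_series_cong) (simp_all add: coefs_unit_coef)
  also have "agree n \<dots> (fps_const (inverse (y (Coef b))) * 0)"
    by (intro agree_mult agree_refl assms[unfolded in_cone_def])
  finally show ?thesis by (simp add: in_cone_def)
qed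

lemma unit_coef_Jvert_chart:
  assumes "(u, b) \<in> charts n d" "chart_vector n d (u, b) y" "y (Coef b) \<noteq> 0" "in_cone n d y"
  shows "unit_coef b y \<in> Jvert_chart n d (u, b)"
  using Jvert_chart_iff[OF assms(1)] unit_coef_chart_space[OF assms(2,3)] in_cone_unit_coef[OF assms(4)]
  by blast

lemma unit_coef_self: "x (Coef b) = 1 \<Longrightarrow> unit_coef b x = x"
  by (rule ext) (simp add: unit_coef_def split: coord.split)


section \<open>Monomials\<close>

definition monomial :: "(nat \<Rightarrow> nat) \<Rightarrow> (nat \<Rightarrow> nat) \<Rightarrow> complex" where
  "monomial \<beta> \<alpha> = (if \<alpha> = \<beta> then 1 else 0)"

definition power_index :: "nat \<Rightarrow> nat \<Rightarrow> nat \<Rightarrow> nat" where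
  "power_index k i = (\<lambda>m. if m = k then i else 0)"

definition series_monomial :: "nat \<Rightarrow> (nat \<Rightarrow> complex fps) \<Rightarrow> (nat \<Rightarrow> nat) \<Rightarrow> complex fps" where
  "series_monomial n \<zeta> \<alpha> = (\<Prod>i\<le>n+1. \<zeta> i ^ \<alpha> i)"

lemma form_series_alt:
  "form_series n d A \<zeta> = (\<Sum>\<alpha>\<in>mindices (n+1) d. fps_const (A \<alpha>) * series_monomial n \<zeta> \<alpha>)"
  by (simp add: form_series_def series_monomial_def)

lemma form_series_monomial:
  assumes "\<beta> \<in> mindices (n+1) d"
  shows "form_series n d (monomial \<beta>) \<zeta> = series_monomial n \<zeta> \<beta>"
proof -
  have "form_series n d (monomial \<beta>) \<zeta> = (\<Sum>\<alpha>\<in>mindices (n+1) d. if \<alpha> = \<beta> then series_monomial n \<zeta> \<alpha> else 0)"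
    unfolding form_series_alt monomial_def by (intro sum.cong) auto
  thus ?thesis using assms finite_mindices by simp
qed

lemma form_series_sum:
  assumes "finite I"
  shows "form_series n d (\<lambda>\<alpha>. \<Sum>i\<in>I. c i * A i \<alpha>) \<zeta> = (\<Sum>i\<in>I. fps_const (c i) * form_series n d (A i) \<zeta>)"
  using assms
proof induction
  case empty
  show ?case by (simp add: form_series_def)
next
  case (insert i I)
  thus ?case by (simp add: form_series_linear)
qed

lemma mindices_add: "\<beta> \<in> mindices m p \<Longrightarrow> \<gamma> \<in> mindices m q \<Longrightarrow> (\<lambda>i. \<beta> i + \<gamma> i) \<in> mindices m (p + q)"
  by (simp add: mindices_def sum.distrib)

lemma power_index_mindices: "k \<le> m \<Longrightarrow> power_index k i \<in> mindices m i"
  by (simp add: mindices_def power_index_def)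

lemma series_monomial_add:
  "series_monomial n \<zeta> (\<lambda>i. \<beta> i + \<gamma> i) = series_monomial n \<zeta> \<beta> * series_monomial n \<zeta> \<gamma>"
  by (simp add: series_monomial_def power_add prod.distrib)

lemma series_monomial_power_index:
  assumes "k \<le> n + 1" shows "series_monomial n \<zeta> (power_index k i) = \<zeta> k ^ i"
proof -
  have "series_monomial n \<zeta> (power_index k i) = (\<Prod>m\<le>n+1. if m = k then \<zeta> m ^ i else 1)"
    unfolding series_monomial_def power_index_def by (intro prod.cong) auto
  thus ?thesis using assms by simp
qed

definition binary_index :: "nat \<Rightarrow> nat \<Rightarrow> nat \<Rightarrow> nat \<Rightarrow> nat \<Rightarrow> nat" where
  "binary_index k i u j = (\<lambda>m. power_index k i m + power_index u j m)"

lemma binary_index_mindices: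
  "k \<le> m \<Longrightarrow> u \<le> m \<Longrightarrow> i + j = p \<Longrightarrow> binary_index k i u j \<in> mindices m p"
  unfolding binary_index_def using mindices_add power_index_mindices by blast

lemma series_monomial_binary_index:
  assumes "k \<le> n + 1" "u \<le> n + 1"
  shows "series_monomial n \<zeta> (binary_index k i u j) = \<zeta> k ^ i * \<zeta> u ^ j"
  unfolding binary_index_def series_monomial_add using assms by (simp add: series_monomial_power_index)


section \<open>Total differentiation\<close>

text \<open>
  Translation in time of the polynomial disc with the given jet; total differentiation is its
  infinitesimal generator.
\<close>

definition jet_flow :: "nat \<Rightarrow> (coord \<Rightarrow> complex) \<Rightarrow> complex \<Rightarrow> coord \<Rightarrow> complex" where
  "jet_flow n x s i = (case i of
     Jet k l \<Rightarrow> if k \<in> {1..n+1} then \<Sum>j\<le>n. x (Jet k (l + j)) / fact j * s ^ j else x i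
   | Coef \<alpha> \<Rightarrow> x i)"

lemma jet_flow_deriv:
  assumes x: "\<And>k l. l > n \<Longrightarrow> x (Jet k l) = 0" and k: "k \<in> {1..n+1}"
  shows "((\<lambda>s. jet_flow n x s (Jet k l)) has_field_derivative jet_flow n x s (Jet k (Suc l))) (at s)"
proof -
  have "((\<lambda>s. \<Sum>j\<le>n. x (Jet k (l + j)) / fact j * s ^ j) has_field_derivative
      (\<Sum>j\<le>n. x (Jet k (l + j)) / fact j * (of_nat j * s ^ (j - 1)))) (at s)"
    by (auto intro!: derivative_eq_intros sum.cong)
  also have "(\<Sum>j\<le>n. x (Jet k (l + j)) / fact j * (of_nat j * s ^ (j - 1))) =
      (\<Sum>j<n. x (Jet k (l + Suc j)) / fact (Suc j) * (of_nat (Suc j) * s ^ j))"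
    by (simp only: lessThan_Suc_atMost[symmetric] sum.lessThan_Suc_shift) simp
  also have "\<dots> = (\<Sum>j<n. x (Jet k (Suc l + j)) / fact j * s ^ j)"
    by (intro sum.cong refl) (simp add: field_simps del: of_nat_Suc)
  also have "\<dots> = (\<Sum>j\<le>n. x (Jet k (Suc l + j)) / fact j * s ^ j)"
    using x[of "Suc l + n" k] by (simp add: lessThan_Suc_atMost[symmetric])
  finally show ?thesis using k by (simp add: jet_flow_def)
qed

lemma jet_flow_const:
  "(\<And>k l. i = Jet k l \<Longrightarrow> k \<notin> {1..n+1}) \<Longrightarrow> jet_flow n x s i = x i"
  by (cases i) (auto simp: jet_flow_def)

lemma jet_flow_0: "jet_flow n x 0 = x"
proof
  fix i
  have "(\<Sum>j\<le>n. x (Jet k (l + j)) / fact j * 0 ^ j) = x (Jet k l)" for k l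
  proof -
    have "(\<Sum>j\<le>n. x (Jet k (l + j)) / fact j * 0 ^ j) = (\<Sum>j\<le>n. if j = 0 then x (Jet k l) else 0)"
      by (intro sum.cong) auto
    thus ?thesis by simp
  qed
  thus "jet_flow n x 0 i = x i" by (simp add: jet_flow_def split: coord.split)
qed

lemma jet_flow_zero:
  assumes "\<And>k l. l > n \<Longrightarrow> x (Jet k l) = 0" "l > n"
  shows "jet_flow n x s (Jet k l) = 0"
  using assms(1)[of _ k] assms(2) by (simp add: jet_flow_def)

lemma total_diff_flow:
  assumes f: "f \<in> poly_funs" and x: "\<And>k l. l > n \<Longrightarrow> x (Jet k l) = 0"
  shows "((\<lambda>s. f (jet_flow n x s)) has_field_derivative total_diff n f (jet_flow n x s)) (at s)"
proof -
  define y where "y = jet_flow n x s"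
  define v where "v i = (case i of Jet k l \<Rightarrow> if k \<in> {1..n+1} then y (Jet k (Suc l)) else 0 | Coef \<alpha> \<Rightarrow> 0)" for i
  have y0: "y (Jet k l) = 0" if "l > n" for k l
    unfolding y_def by (rule jet_flow_zero) (use x that in auto)
  have d: "((\<lambda>s. jet_flow n x s i) has_field_derivative v i) (at s)" for i
  proof (cases "\<exists>k l. i = Jet k l \<and> k \<in> {1..n+1}")
    case True
    thus ?thesis using jet_flow_deriv[of n x, OF x] by (auto simp: v_def y_def)
  next
    case False
    hence "jet_flow n x s i = x i" for s by (intro jet_flow_const) auto
    moreover have "v i = 0" using False by (auto simp: v_def split: coord.split)
    ultimately show ?thesis by simp
  qed
  define S where "S = case_prod Jet ` ({1..n+1} \<times> {..n})"
  have vS: "v i = 0" if "i \<notin> S" for i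
  proof (cases i)
    case (Jet k l)
    have "\<not> (k \<in> {1..n+1} \<and> l \<le> n)"
    proof
      assume "k \<in> {1..n+1} \<and> l \<le> n"
      hence "case_prod Jet (k, l) \<in> S" unfolding S_def by (intro imageI) simp
      thus False using that Jet by simp
    qed
    thus ?thesis using y0[of "Suc l" k] Jet by (auto simp: v_def)
  qed (simp add: v_def)
  have "((\<lambda>s. f (jet_flow n x s)) has_field_derivative (\<Sum>i\<in>S. v i * pderiv_coord i f y)) (at s)"
    unfolding y_def by (rule poly_chain_rule[OF f _ vS d]) (simp_all add: S_def)
  also have "(\<Sum>i\<in>S. v i * pderiv_coord i f y) =
      (\<Sum>(k, l)\<in>{1..n+1} \<times> {..n}. v (Jet k l) * pderiv_coord (Jet k l) f y)"
    unfolding S_def by (subst sum.reindex) (auto simp: inj_on_def case_prod_beta)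
  also have "\<dots> = (\<Sum>k\<in>{1..n+1}. \<Sum>l\<le>n. v (Jet k l) * pderiv_coord (Jet k l) f y)"
    by (subst sum.cartesian_product) simp
  also have "\<dots> = (\<Sum>l\<le>n. \<Sum>k\<in>{1..n+1}. pderiv_coord (Jet k l) f y * y (Jet k (Suc l)))"
    by (subst sum.swap) (intro sum.cong refl, simp add: v_def mult.commute)
  also have "\<dots> = total_diff n f y"
    unfolding total_diff_def
    by (rule Sum_any.expand_superset[symmetric])
       (use y0 in \<open>auto intro: sum.neutral intro!: leI simp: not_le[symmetric]\<close>)
  finally show ?thesis by (simp add: y_def)
qed

text \<open>
  This makes the sum in the total differentiation operator finite, uniformly in the point, so
  that the operator preserves polynomials.
\<close>

lemma poly_funs_bounded_order:
  assumes "f \<in> poly_funs" shows "\<exists>L. \<forall>l\<ge>L. \<forall>k x. pderiv_coord (Jet k l) f x = 0"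
  using assms
proof induction
  case (const w)
  show ?case by simp
next
  case (coord j)
  show ?case
  proof (cases j)
    case (Jet k l)
    thus ?thesis by (intro exI[of _ "Suc l"]) auto
  qed auto
next
  case (add f g)
  then obtain L M where "\<forall>l\<ge>L. \<forall>k x. pderiv_coord (Jet k l) f x = 0"
    "\<forall>l\<ge>M. \<forall>k x. pderiv_coord (Jet k l) g x = 0" by blast
  thus ?case by (intro exI[of _ "max L M"]) (simp add: pderiv_coord_add[OF add.hyps])
next
  case (mult f g)
  then obtain L M where "\<forall>l\<ge>L. \<forall>k x. pderiv_coord (Jet k l) f x = 0"
    "\<forall>l\<ge>M. \<forall>k x. pderiv_coord (Jet k l) g x = 0" by blast
  thus ?case by (intro exI[of _ "max L M"]) (simp add: pderiv_coord_mult[OF mult.hyps])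
qed

lemma poly_total_diff:
  assumes "f \<in> poly_funs" shows "total_diff n f \<in> poly_funs"
proof -
  obtain L where L: "\<And>l k x. l \<ge> L \<Longrightarrow> pderiv_coord (Jet k l) f x = 0"
    using poly_funs_bounded_order[OF assms] by blast
  have "total_diff n f = (\<lambda>x. \<Sum>l<L. \<Sum>k\<in>{1..n+1}. pderiv_coord (Jet k l) f x * x (Jet k (Suc l)))"
    unfolding total_diff_def
  proof (rule ext, rule Sum_any.expand_superset)
    fix x
    show "{l. (\<Sum>k\<in>{1..n+1}. pderiv_coord (Jet k l) f x * x (Jet k (Suc l))) \<noteq> 0} \<subseteq> {..<L}"
    proof
      fix l assume "l \<in> {l. (\<Sum>k\<in>{1..n+1}. pderiv_coord (Jet k l) f x * x (Jet k (Suc l))) \<noteq> 0}"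
      moreover have "(\<Sum>k\<in>{1..n+1}. pderiv_coord (Jet k l) f x * x (Jet k (Suc l))) = 0" if "L \<le> l"
        using L[OF that] by simp
      ultimately show "l \<in> {..<L}" by (meson lessThan_iff mem_Collect_eq not_le)
    qed
  qed simp
  also have "\<dots> \<in> poly_funs"
    by (intro poly_sum poly_funs.mult poly_funs.coord poly_pderiv_coord assms)
  finally show ?thesis .
qed

lemma total_diff_iterate_flow:
  assumes f: "f \<in> poly_funs" and x: "\<And>k l. l > n \<Longrightarrow> x (Jet k l) = 0"
  shows "(deriv ^^ m) (\<lambda>s. f (jet_flow n x s)) = (\<lambda>s. (total_diff n ^^ m) f (jet_flow n x s))"
proof (induction m)
  case (Suc m)
  have p: "(total_diff n ^^ m) f \<in> poly_funs"
    by (induction m) (simp_all add: f poly_total_diff)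
  show ?case
    using DERIV_imp_deriv[OF total_diff_flow[of _ n x, OF p x]] by (simp add: Suc.IH)
qed simp

lemma jet_series_expansion:
  assumes "\<And>l. l > n \<Longrightarrow> x (Jet k l) = 0"
  shows "(\<lambda>t. \<Sum>l\<le>n. x (Jet k l) / fact l * t ^ l) has_fps_expansion jet_series x k"
proof -
  have eq: "jet_series x k = (\<Sum>l\<le>n. fps_const (x (Jet k l) / fact l) * fps_X ^ l)"
  proof (rule fps_ext)
    fix m
    have "fps_nth (\<Sum>l\<le>n. fps_const (x (Jet k l) / fact l) * fps_X ^ l) m =
        (\<Sum>l\<le>n. if l = m then x (Jet k l) / fact l else 0)"
      unfolding fps_sum_nth by (intro sum.cong refl) (auto simp: fps_X_power_nth)
    also have "\<dots> = x (Jet k m) / fact m" using assms[of m] by simp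
    finally show "fps_nth (jet_series x k) m = fps_nth (\<Sum>l\<le>n. fps_const (x (Jet k l) / fact l) * fps_X ^ l) m"
      by (simp add: jet_series_nth)
  qed
  show ?thesis unfolding eq
    by (intro has_fps_expansion_sum has_fps_expansion_mult has_fps_expansion_const has_fps_expansion_fps_X_power)
qed

lemma pivot_power_index: "pivot d = power_index 1 d"
  by (simp add: pivot_def power_index_def)

lemma pivot_mindices: "pivot d \<in> mindices (n+1) d"
  unfolding pivot_power_index by (rule power_index_mindices) simp

lemma pivot_chart: "(0, pivot d) \<in> charts n d"
  using pivot_mindices[of d n] by (simp add: charts_def)

text \<open>
  Along the flow the iterated total derivatives become the Taylor coefficients of the equation.
\<close>

lemma Jvert_aff_if_in_cone:
  assumes x: "x \<in> chart_space n d (0, pivot d)" and cone: "in_cone n d x"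
  shows "x \<in> Jvert_aff n d"
proof -
  have x0: "x (Jet k l) = 0" if "l > n" for k l
    using chart_spaceD(3)[OF x, of k l] that by simp
  have "aff_form n d = (\<lambda>x. \<Sum>\<alpha>\<in>mindices (n+1) d. x (Coef \<alpha>) * (\<Prod>k\<in>{1..n+1}. x (Jet k 0) ^ \<alpha> k))"
    by (rule ext) (simp add: aff_form_def)
  also have "\<dots> \<in> poly_funs"
    by (intro poly_sum poly_funs.mult poly_funs.coord poly_prod poly_power)
  finally have p: "aff_form n d \<in> poly_funs" .
  have J0: "jet_series x 0 = 1" by (rule jet_series_chart_space[OF x])
  have "(\<lambda>s. aff_form n d (jet_flow n x s)) has_fps_expansion
      (\<Sum>\<alpha>\<in>mindices (n+1) d. fps_const (x (Coef \<alpha>)) * (\<Prod>k\<in>{1..n+1}. jet_series x k ^ \<alpha> k))"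
    unfolding aff_form_def
  proof (intro has_fps_expansion_sum has_fps_expansion_mult has_fps_expansion_prod has_fps_expansion_power)
    fix \<alpha> show "(\<lambda>s. jet_flow n x s (Coef \<alpha>)) has_fps_expansion fps_const (x (Coef \<alpha>))"
      by (simp add: jet_flow_def)
  next
    fix k assume "k \<in> {1..n+1}"
    hence "jet_flow n x s (Jet k 0) = (\<Sum>l\<le>n. x (Jet k l) / fact l * s ^ l)" for s
      by (simp add: jet_flow_def)
    thus "(\<lambda>s. jet_flow n x s (Jet k 0)) has_fps_expansion jet_series x k"
      using jet_series_expansion[of n x k, OF x0] by simp
  qed
  also have "(\<Sum>\<alpha>\<in>mindices (n+1) d. fps_const (x (Coef \<alpha>)) * (\<Prod>k\<in>{1..n+1}. jet_series x k ^ \<alpha> k)) =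
      form_series n d (coefs x) (jet_series x)"
  proof -
    have "{..n+1} = insert 0 {1..n+1}" by auto
    hence "(\<Prod>k\<le>n+1. jet_series x k ^ \<alpha> k) = (\<Prod>k\<in>{1..n+1}. jet_series x k ^ \<alpha> k)" for \<alpha>
      using J0 by simp
    thus ?thesis unfolding form_series_def coefs_def by (simp only:)
  qed
  finally have ex: "(\<lambda>s. aff_form n d (jet_flow n x s)) has_fps_expansion form_series n d (coefs x) (jet_series x)" .
  have "(total_diff n ^^ \<kappa>) (aff_form n d) x = 0" if "\<kappa> \<le> n" for \<kappa>
  proof -
    have "(total_diff n ^^ \<kappa>) (aff_form n d) x = (deriv ^^ \<kappa>) (\<lambda>s. aff_form n d (jet_flow n x s)) 0"
      using fun_cong[OF total_diff_iterate_flow[of "aff_form n d" n x \<kappa>, OF p x0], of 0]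
      by (simp add: jet_flow_0)
    also have "\<dots> = fact \<kappa> * fps_nth (form_series n d (coefs x) (jet_series x)) \<kappa>"
      unfolding fps_nth_fps_expansion[OF ex] by simp
    also have "\<dots> = 0" using cone that by (simp add: in_cone_def agree_def)
    finally show ?thesis .
  qed
  thus ?thesis using x by (simp add: Jvert_aff_def)
qed


section \<open>The exceptional locus\<close>

text \<open>The candidate for the closure of the affine exceptional locus.\<close>

definition flat_jets :: "nat \<Rightarrow> nat \<Rightarrow> vjet set" where
  "flat_jets n d = {p \<in> Jvert n d. \<forall>u b. (u, b) \<in> charts n d \<longrightarrow> p \<in> chart_dom n d (u, b) \<longrightarrow>
     (\<forall>k\<le>n+1. chart_map n d (u, b) p (Jet k 1) = 0)}"

lemma Jet_pivot_deriv:
  assumes "(u, b) \<in> charts n d" "p \<in> chart_dom n d (u, b)"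
  shows "chart_map n d (u, b) p (Jet u 1) = 0"
  by (rule chart_spaceD(4)[OF chart_map_in_space[OF assms]]) simp

text \<open>The quotient of two series without linear term has no linear term.\<close>

lemma flat_change:
  assumes n: "n \<ge> 1" and p: "(u, b) \<in> charts n d" "p \<in> chart_dom n d (u, b)"
    and q: "(v, a) \<in> charts n d" "p \<in> chart_dom n d (v, a)"
    and flat: "\<And>k. k \<le> n+1 \<Longrightarrow> chart_map n d (u, b) p (Jet k 1) = 0" and k: "k \<le> n+1"
  shows "chart_map n d (v, a) p (Jet k 1) = 0"
proof -
  define F G where "F = jet_series (chart_map n d (u, b) p) v" and "G = jet_series (chart_map n d (u, b) p) k"
  have v: "v \<le> n + 1" using q by (auto simp: charts_def)
  have F1: "fps_nth F 1 = 0" and G1: "fps_nth G 1 = 0"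
    using flat[OF v] flat[OF k] by (simp_all add: F_def G_def jet_series_nth)
  have F0: "fps_nth F 0 \<noteq> 0"
    using in_chart_dom_iff[OF p q(1)] q(2) by (simp add: F_def jet_series_nth)
  have "fps_nth (F * inverse F) 1 = 0" using F0 by (simp add: inverse_mult_eq_1')
  hence "fps_nth (inverse F) 1 = 0" using F0 F1 by (simp add: fps_mult_nth)
  hence "fps_nth (inverse F * G) 1 = 0" using G1 by (simp add: fps_mult_nth)
  thus ?thesis
    using agree_nth[OF chart_change(1)[OF p(2) q(2) k] n] by (simp add: F_def G_def jet_series_nth)
qed

lemma flat_jets_iff:
  assumes n: "n \<ge> 1" and c: "(u, b) \<in> charts n d" and p: "p \<in> Jvert n d \<inter> chart_dom n d (u, b)"
  shows "p \<in> flat_jets n d \<longleftrightarrow> (\<forall>k\<in>{..n+1} - {u}. chart_map n d (u, b) p (Jet k 1) = 0)"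
proof
  assume "p \<in> flat_jets n d"
  thus "\<forall>k\<in>{..n+1} - {u}. chart_map n d (u, b) p (Jet k 1) = 0"
    using c p unfolding flat_jets_def by auto
next
  assume H: "\<forall>k\<in>{..n+1} - {u}. chart_map n d (u, b) p (Jet k 1) = 0"
  have "chart_map n d (u, b) p (Jet k 1) = 0" if "k \<le> n+1" for k
    using H Jet_pivot_deriv[OF c] p that by (cases "k = u") auto
  thus "p \<in> flat_jets n d"
    unfolding flat_jets_def using flat_change[OF n c _ _ _ ] p by blast
qed

lemma flat_jets_closed:
  assumes n: "n \<ge> 1" shows "zariski_closed n d (flat_jets n d)"
  unfolding zariski_closed_def
proof (intro conjI ballI)
  show "flat_jets n d \<subseteq> Jvert n d" by (auto simp: flat_jets_def)
  fix c assume c: "c \<in> charts n d"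
  obtain u b where cub: "c = (u, b)" by (cases c)
  let ?F = "(\<lambda>k x. x (Jet k 1)) ` ({..n+1} - {u})"
  have "?F \<subseteq> poly_funs" by (auto intro: poly_funs.coord)
  moreover have "flat_jets n d \<inter> chart_dom n d c =
      {p \<in> Jvert n d \<inter> chart_dom n d c. \<forall>f\<in>?F. f (chart_map n d c p) = 0}" (is "?L = ?R")
  proof (rule set_eqI)
    fix p
    show "p \<in> ?L \<longleftrightarrow> p \<in> ?R"
    proof (cases "p \<in> Jvert n d \<inter> chart_dom n d c")
      case True
      thus ?thesis using flat_jets_iff[OF n c[unfolded cub], of p] unfolding cub by simp
    next
      case False
      thus ?thesis by (auto simp: flat_jets_def)
    qed
  qed
  ultimately show "\<exists>F\<subseteq>poly_funs. flat_jets n d \<inter> chart_dom n d c =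
      {p \<in> Jvert n d \<inter> chart_dom n d c. \<forall>f\<in>F. f (chart_map n d c p) = 0}" by blast
qed

text \<open>
  Polynomial functions are continuous, so a Zariski closed set contains the limits along
  punctured curves.
\<close>

lemma zariski_closed_limit:
  assumes C: "zariski_closed n d C" and c: "(u, b) \<in> charts n d"
    and p: "p \<in> Jvert n d \<inter> chart_dom n d (u, b)"
    and vec: "\<And>s. chart_vector n d (u, b) (y s)" and cone: "\<And>s. in_cone n d (y s)"
    and lim: "\<And>i. ((\<lambda>s. y s i) \<longlongrightarrow> chart_map n d (u, b) p i) (at (0::complex))"
    and mem: "\<And>s q. s \<noteq> 0 \<Longrightarrow> y s (Coef b) \<noteq> 0 \<Longrightarrow> q \<in> Jvert n d \<inter> chart_dom n d (u, b) \<Longrightarrow>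
       chart_map n d (u, b) q = unit_coef b (y s) \<Longrightarrow> q \<in> C"
  shows "p \<in> C"
proof -
  define x where "x = chart_map n d (u, b) p"
  have xb: "x (Coef b) = 1"
    using chart_spaceD(2)[OF chart_map_in_space[OF c]] p by (simp add: x_def)
  have lim: "((\<lambda>s. y s i) \<longlongrightarrow> x i) (at 0)" for i using lim by (simp add: x_def)
  have nz: "\<forall>\<^sub>F s in at 0. y s (Coef b) \<noteq> 0"
    using lim[of "Coef b"] by (rule tendsto_imp_eventually_ne) (simp add: xb)
  obtain F where F: "F \<subseteq> poly_funs" and CF: "C \<inter> chart_dom n d (u, b) =
      {q \<in> Jvert n d \<inter> chart_dom n d (u, b). \<forall>f\<in>F. f (chart_map n d (u, b) q) = 0}"
    using C c unfolding zariski_closed_def by blast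
  have ul: "((\<lambda>s. unit_coef b (y s) i) \<longlongrightarrow> x i) (at 0)" for i
  proof (cases i)
    case (Jet k l)
    thus ?thesis using lim[of i] by (simp add: unit_coef_def)
  next
    case (Coef \<alpha>)
    have "((\<lambda>s. y s (Coef \<alpha>) / y s (Coef b)) \<longlongrightarrow> x (Coef \<alpha>) / x (Coef b)) (at 0)"
      by (intro tendsto_divide lim) (simp add: xb)
    thus ?thesis using Coef xb by (simp add: unit_coef_def)
  qed
  have "f x = 0" if f: "f \<in> F" for f
  proof -
    have "\<forall>\<^sub>F s in at 0. s \<noteq> (0::complex)" by (simp add: eventually_at_filter)
    with nz have "\<forall>\<^sub>F s in at 0. f (unit_coef b (y s)) = 0"
    proof eventually_elim
      case (elim s)
      have "unit_coef b (y s) \<in> Jvert_chart n d (u, b)"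
        by (rule unit_coef_Jvert_chart[OF c vec elim(1) cone])
      then obtain q where q: "q \<in> Jvert n d \<inter> chart_dom n d (u, b)"
        "chart_map n d (u, b) q = unit_coef b (y s)"
        unfolding Jvert_chart_def by auto
      have "q \<in> C \<inter> chart_dom n d (u, b)" using mem[OF elim(2,1) q] q(1) by simp
      hence "f (chart_map n d (u, b) q) = 0" using f unfolding CF by simp
      thus ?case unfolding q(2) .
    qed
    hence l0: "((\<lambda>s. f (unit_coef b (y s))) \<longlongrightarrow> 0) (at 0)" by (rule tendsto_eventually)
    have lx: "((\<lambda>s. f (unit_coef b (y s))) \<longlongrightarrow> f x) (at 0)"
      by (rule poly_tendsto[OF _ ul]) (use f F in blast)
    show ?thesis by (rule tendsto_unique[OF _ lx l0]) simp
  qed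
  hence "p \<in> C \<inter> chart_dom n d (u, b)" unfolding CF using p by (simp add: x_def)
  thus ?thesis by simp
qed

text \<open>
  The coefficients of the form \<open>Z\<^sup>\<gamma> (a Z\<^sub>k + b Z\<^sub>u)\<^sup>r\<close>.
\<close>

definition line_power ::
    "nat \<Rightarrow> nat \<Rightarrow> nat \<Rightarrow> complex \<Rightarrow> complex \<Rightarrow> (nat \<Rightarrow> nat) \<Rightarrow> (nat \<Rightarrow> nat) \<Rightarrow> complex" where
  "line_power r k u a b \<gamma> \<alpha> = (\<Sum>i\<le>r. (of_nat (r choose i) * a ^ i * b ^ (r - i)) *
     monomial (\<lambda>m. \<gamma> m + binary_index k i u (r - i) m) \<alpha>)"

lemma line_power_form:
  assumes "k \<le> n + 1" "u \<le> n + 1" and \<gamma>: "\<gamma> \<in> mindices (n+1) q" and d: "q + r = d"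
  shows "form_series n d (line_power r k u a b \<gamma>) \<zeta> =
    series_monomial n \<zeta> \<gamma> * (fps_const a * \<zeta> k + fps_const b * \<zeta> u) ^ r"
proof -
  have "form_series n d (line_power r k u a b \<gamma>) \<zeta> =
      form_series n d (\<lambda>\<alpha>. \<Sum>i\<le>r. (of_nat (r choose i) * a ^ i * b ^ (r - i)) *
        monomial (\<lambda>m. \<gamma> m + binary_index k i u (r - i) m) \<alpha>) \<zeta>"
    by (intro form_series_cong refl) (simp add: line_power_def)
  also have "\<dots> = (\<Sum>i\<le>r. fps_const (of_nat (r choose i) * a ^ i * b ^ (r - i)) *
      form_series n d (monomial (\<lambda>m. \<gamma> m + binary_index k i u (r - i) m)) \<zeta>)"
    by (rule form_series_sum) simp
  also have "\<dots> = (\<Sum>i\<le>r. fps_const (of_nat (r choose i) * a ^ i * b ^ (r - i)) *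
      (series_monomial n \<zeta> \<gamma> * (\<zeta> k ^ i * \<zeta> u ^ (r - i))))"
  proof (intro sum.cong refl arg_cong2[of _ _ _ _ "(*)"])
    fix i assume "i \<in> {..r}"
    hence "binary_index k i u (r - i) \<in> mindices (n+1) r"
      using assms(1,2) by (intro binary_index_mindices) auto
    from mindices_add[OF \<gamma> this]
    have "(\<lambda>m. \<gamma> m + binary_index k i u (r - i) m) \<in> mindices (n+1) d" by (simp only: d)
    thus "form_series n d (monomial (\<lambda>m. \<gamma> m + binary_index k i u (r - i) m)) \<zeta> =
        series_monomial n \<zeta> \<gamma> * (\<zeta> k ^ i * \<zeta> u ^ (r - i))"
      by (simp only: form_series_monomial series_monomial_add series_monomial_binary_index[OF assms(1,2)])
  qed
  also have "\<dots> = series_monomial n \<zeta> \<gamma> *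
      (\<Sum>i\<le>r. of_nat (r choose i) * (fps_const a * \<zeta> k) ^ i * (fps_const b * \<zeta> u) ^ (r - i))"
    unfolding sum_distrib_left
    by (intro sum.cong refl)
       (simp add: power_mult_distrib fps_of_nat fps_const_power[symmetric] fps_const_mult[symmetric] mult_ac
         del: fps_const_power fps_const_mult)
  also have "\<dots> = series_monomial n \<zeta> \<gamma> * (fps_const a * \<zeta> k + fps_const b * \<zeta> u) ^ r"
    by (simp only: binomial_ring)
  finally show ?thesis .
qed

lemma line_power_outside:
  assumes "k \<le> n + 1" "u \<le> n + 1" "\<gamma> \<in> mindices (n+1) q" "q + r = d" "\<alpha> \<notin> mindices (n+1) d"
  shows "line_power r k u a b \<gamma> \<alpha> = 0"
  unfolding line_power_def
proof (rule sum.neutral, rule ballI)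
  fix i assume "i \<in> {..r}"
  hence "binary_index k i u (r - i) \<in> mindices (n+1) r"
    using assms(1,2) by (intro binary_index_mindices) auto
  from mindices_add[OF assms(3) this]
  have "\<alpha> \<noteq> (\<lambda>m. \<gamma> m + binary_index k i u (r - i) m)" using assms(4,5) by auto
  thus "(of_nat (r choose i) * a ^ i * b ^ (r - i)) * monomial (\<lambda>m. \<gamma> m + binary_index k i u (r - i) m) \<alpha> = 0"
    by (simp add: monomial_def)
qed

lemma agree_power_zero:
  assumes "fps_nth F 0 = 0" "d > n" shows "agree n (F ^ d) 0"
  using startsby_zero_power_prefix[OF assms(1)] assms(2) by (simp add: agree_def)

context
  fixes n d :: nat
  assumes n1: "n \<ge> 1" and dn: "d > n"
begin

definition flat_start :: "vjet set" where
  "flat_start = {p \<in> Jvert n d \<inter> chart_dom n d (0, pivot d). chart_map n d (0, pivot d) p \<in> Sigma0 n d}"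

lemma flat_start_iff:
  assumes "p \<in> Jvert n d \<inter> chart_dom n d (0, pivot d)"
  shows "p \<in> flat_start \<longleftrightarrow> p \<in> flat_jets n d"
proof -
  have "chart_map n d (0, pivot d) p \<in> Jvert_aff n d"
    using Jvert_aff_if_in_cone[OF chart_map_in_space[OF pivot_chart]] Jvert_iff[OF pivot_chart] assms by blast
  hence "p \<in> flat_start \<longleftrightarrow> (\<forall>k\<in>{1..n+1}. chart_map n d (0, pivot d) p (Jet k 1) = 0)"
    using assms by (simp add: flat_start_def Sigma0_def)
  also have "{1..n+1} = {..n+1} - {0}" by auto
  finally show ?thesis using flat_jets_iff[OF n1 pivot_chart assms] by simp
qed

text \<open>
  The \<open>d\<close>-th power of \<open>Z\<^sub>1 - z\<^sub>1(0) Z\<^sub>0\<close> vanishes along the disc to order \<open>d > n\<close>.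
  Adding a small multiple of it to the form stays in the jet space, and the coefficient of
  \<open>Z\<^sub>1\<^sup>d\<close> becomes nonzero.
\<close>

lemma flat_jets_limit_in_affine_chart:
  assumes C: "zariski_closed n d C" "flat_start \<subseteq> C"
    and c: "(0, b) \<in> charts n d" and p: "p \<in> flat_jets n d" "p \<in> chart_dom n d (0, b)"
  shows "p \<in> C"
proof -
  define x where "x = chart_map n d (0, b) p"
  have pJ: "p \<in> Jvert n d" using p by (simp add: flat_jets_def)
  have xs: "x \<in> chart_space n d (0, b)" unfolding x_def by (rule chart_map_in_space[OF c p(2)])
  have cone: "in_cone n d x" using Jvert_iff[OF c p(2)] pJ by (simp add: x_def)
  have b: "b \<in> mindices (n+1) d" using c by (simp add: charts_def)
  have z: "(\<lambda>_. 0) \<in> mindices (n+1) 0" by (simp add: mindices_def)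
  show ?thesis
  proof (cases "x (Coef (pivot d)) = 0")
    case False
    hence "p \<in> chart_dom n d (0, pivot d)"
      using in_chart_dom_iff[OF c p(2) pivot_chart] chart_spaceD(1)[OF xs] by (simp add: x_def)
    thus ?thesis using flat_start_iff[of p] pJ p C(2) by blast
  next
    case True
    define B where "B = line_power d 1 0 1 (- x (Jet 1 0)) (\<lambda>_. 0)"
    define y where "y s i = (case i of Jet k l \<Rightarrow> x (Jet k l) | Coef \<alpha> \<Rightarrow> x (Coef \<alpha>) + s * B \<alpha>)" for s i
    have jy: "jet_series (y s) = jet_series x" for s
      by (rule ext) (simp add: jet_series_def y_def)
    have x0: "jet_series x 0 = 1" by (rule jet_series_chart_space[OF xs])
    have "form_series n d B (jet_series x) = (jet_series x 1 + fps_const (- x (Jet 1 0)))  ^ d"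
      unfolding B_def using line_power_form[OF _ _ z, of 1 0 d d 1 "- x (Jet 1 0)" "jet_series x"] x0
      by (simp add: series_monomial_def)
    moreover have "agree n ((jet_series x 1 + fps_const (- x (Jet 1 0))) ^ d) 0"
      by (rule agree_power_zero[OF _ dn]) (simp add: jet_series_nth)
    ultimately have Bz: "agree n (form_series n d B (jet_series x)) 0" by simp
    have Bp: "B (pivot d) = 1"
    proof -
      have "(pivot d = (\<lambda>m. 0 + binary_index 1 i 0 (d - i) m)) \<longleftrightarrow> i = d" if "i \<le> d" for i
      proof
        assume "pivot d = (\<lambda>m. 0 + binary_index 1 i 0 (d - i) m)"
        from fun_cong[OF this, of 1] show "i = d"
          by (simp add: pivot_def binary_index_def power_index_def)
      qed (auto simp: pivot_def binary_index_def power_index_def)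
      hence "B (pivot d) = (\<Sum>i\<le>d. if i = d then 1 else 0)"
        unfolding B_def line_power_def by (intro sum.cong refl) (auto simp: monomial_def)
      thus ?thesis by simp
    qed
    have B0: "B \<alpha> = 0" if "\<alpha> \<notin> mindices (n+1) d" for \<alpha>
      unfolding B_def by (rule line_power_outside[OF _ _ z _ that]) auto
    show ?thesis
    proof (rule zariski_closed_limit[OF C(1) c, of p y])
      show "p \<in> Jvert n d \<inter> chart_dom n d (0, b)" using pJ p(2) by simp
      show "chart_vector n d (0, b) (y s)" for s
        unfolding chart_vector_def fst_conv snd_conv
      proof (intro allI impI)
        fix i assume i: "i \<notin> free_coords n d (0, b) \<union> {Coef b}"
        have "x i = (if i = Jet 0 0 then 1 else 0)"
          by (rule chart_vector_chart_space[OF xs, unfolded chart_vector_def fst_conv snd_conv, rule_format, OF i])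
        moreover have "y s i = x i"
        proof (cases i)
          case (Coef \<alpha>)
          hence "\<alpha> \<notin> mindices (n+1) d" using i by (auto simp: free_coords_def)
          thus ?thesis using Coef B0 by (simp add: y_def)
        qed (simp add: y_def)
        ultimately show "y s i = (if i = Jet 0 0 then 1 else 0)" by simp
      qed
      show "in_cone n d (y s)" for s
      proof -
        have "form_series n d (coefs (y s)) (jet_series (y s)) =
            form_series n d (coefs x) (jet_series x) + fps_const s * form_series n d B (jet_series x)"
          unfolding jy form_series_linear[symmetric]
          by (intro form_series_cong refl) (simp add: coefs_def y_def)
        also have "agree n \<dots> (0 + fps_const s * 0)"
          by (intro agree_add agree_mult agree_refl Bz cone[unfolded in_cone_def])
        finally show ?thesis by (simp add: in_cone_def)
      qed
      show "((\<lambda>s. y s i) \<longlongrightarrow> chart_map n d (0, b) p i) (at 0)" for i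
      proof (cases i)
        case (Coef \<alpha>)
        have "((\<lambda>s. x (Coef \<alpha>) + s * B \<alpha>) \<longlongrightarrow> x (Coef \<alpha>) + 0 * B \<alpha>) (at 0)"
          by (intro tendsto_intros)
        thus ?thesis using Coef by (simp add: y_def x_def)
      qed (simp add: y_def x_def)
      fix s q assume s: "s \<noteq> 0" "y s (Coef b) \<noteq> 0" and q: "q \<in> Jvert n d \<inter> chart_dom n d (0, b)"
        "chart_map n d (0, b) q = unit_coef b (y s)"
      have "chart_map n d (0, b) q (Jet k l) = x (Jet k l)" for k l
        unfolding q(2) by (simp add: unit_coef_def y_def)
      moreover have "\<forall>k\<in>{..n+1} - {0}. x (Jet k 1) = 0"
        using flat_jets_iff[OF n1 c, of p] p pJ unfolding x_def by blast
      ultimately have "q \<in> flat_jets n d" using flat_jets_iff[OF n1 c q(1)] by simp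
      moreover have "q \<in> chart_dom n d (0, pivot d)"
      proof -
        have "chart_map n d (0, b) q (Coef (pivot d)) = s / y s (Coef b)"
          unfolding q(2) using True Bp by (simp add: unit_coef_def y_def)
        moreover have "chart_map n d (0, b) q (Jet 0 0) = 1"
          using chart_spaceD(1)[OF chart_map_in_space[OF c]] q(1) by simp
        ultimately show ?thesis using in_chart_dom_iff[OF c _ pivot_chart, of q] q(1) s by simp
      qed
      ultimately show "q \<in> C" using flat_start_iff[of q] q(1) C(2) by blast
    qed
  qed
qed

text \<open>
  The shear \<open>Z\<^sub>0 \<mapsto> Z\<^sub>0 + s Z\<^sub>u\<close>, applied to the disc and inversely to the form, preserves the
  equations and moves the centre of the disc off the hyperplane \<open>Z\<^sub>0 = 0\<close>.
\<close>

lemma flat_jets_limit: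
  assumes C: "zariski_closed n d C" "flat_start \<subseteq> C" and p: "p \<in> flat_jets n d"
  shows "p \<in> C"
proof -
  have pJ: "p \<in> Jvert n d" using p by (simp add: flat_jets_def)
  hence "p \<in> vjets n d" by (auto simp: Jvert_def)
  then obtain c0 where c0: "c0 \<in> charts n d" "p \<in> chart_dom n d c0" by (rule vjets_cover)
  obtain u b where ub: "c0 = (u, b)" by (cases c0)
  note c = c0(1)[unfolded ub] and pd = c0(2)[unfolded ub]
  define x where "x = chart_map n d (u, b) p"
  have xs: "x \<in> chart_space n d (u, b)" unfolding x_def by (rule chart_map_in_space[OF c pd])
  have cone: "in_cone n d x" using Jvert_iff[OF c pd] pJ by (simp add: x_def)
  have b: "b \<in> mindices (n+1) d" and u: "u \<le> n+1" using c by (auto simp: charts_def)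
  have c': "(0, b) \<in> charts n d" using b by (simp add: charts_def)
  have xb: "x (Coef b) = 1" by (rule chart_spaceD(2)[OF xs])
  show ?thesis
  proof (cases "x (Jet 0 0) = 0")
    case False
    hence "p \<in> chart_dom n d (0, b)" using in_chart_dom_iff[OF c pd c'] xb by (simp add: x_def)
    thus ?thesis by (rule flat_jets_limit_in_affine_chart[OF C c' p])
  next
    case True
    have u0: "u \<noteq> 0" using True chart_spaceD(1)[OF xs] by (metis zero_neq_one)
    have xu: "jet_series x u = 1" by (rule jet_series_chart_space[OF xs])
    define A where "A s \<alpha> = (\<Sum>\<beta>\<in>mindices (n+1) d. x (Coef \<beta>) * line_power (\<beta> 0) 0 u 1 (- s) (\<beta>(0 := 0)) \<alpha>)" for s \<alpha>
    define y where "y s i = (case i of Jet k l \<Rightarrow> (if k = 0 \<and> l = 0 then s else x (Jet k l)) | Coef \<alpha> \<Rightarrow> A s \<alpha>)" for s i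
    have split: "\<beta>(0 := 0) \<in> mindices (n+1) (d - \<beta> 0)" "d - \<beta> 0 + \<beta> 0 = d" if "\<beta> \<in> mindices (n+1) d" for \<beta>
    proof -
      have "(\<Sum>i\<le>n+1. \<beta> i) = \<beta> 0 + (\<Sum>i\<in>{..n+1} - {0}. \<beta> i)" by (rule sum.remove) auto
      moreover have "(\<Sum>i\<le>n+1. (\<beta>(0 := 0)) i) = (\<beta>(0 := 0)) 0 + (\<Sum>i\<in>{..n+1} - {0}. (\<beta>(0 := 0)) i)"
        by (rule sum.remove) auto
      moreover have "(\<Sum>i\<in>{..n+1} - {0}. (\<beta>(0 := 0)) i) = (\<Sum>i\<in>{..n+1} - {0}. \<beta> i)"
        by (rule sum.cong) auto
      moreover have "(\<Sum>i\<le>n+1. \<beta> i) = d" "\<forall>i>n+1. \<beta> i = 0" using that by (simp_all add: mindices_def)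
      ultimately show "\<beta>(0 := 0) \<in> mindices (n+1) (d - \<beta> 0)" "d - \<beta> 0 + \<beta> 0 = d"
        by (simp_all add: mindices_def)
    qed
    have j0: "jet_series (y s) 0 = jet_series x 0 + fps_const s" for s
    proof (rule fps_ext)
      fix l show "fps_nth (jet_series (y s) 0) l = fps_nth (jet_series x 0 + fps_const s) l"
        using True by (cases l) (simp_all add: jet_series_nth y_def)
    qed
    have jk: "jet_series (y s) k = jet_series x k" if "k \<noteq> 0" for s k
      using that by (simp add: jet_series_def y_def)
    have A0: "A s \<alpha> = 0" if "\<alpha> \<notin> mindices (n+1) d" for s \<alpha>
      unfolding A_def
    proof (rule sum.neutral, rule ballI)
      fix \<beta> assume \<beta>: "\<beta> \<in> mindices (n+1) d"
      show "x (Coef \<beta>) * line_power (\<beta> 0) 0 u 1 (- s) (\<beta>(0 := 0)) \<alpha> = 0"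
        using line_power_outside[OF le0 u split[OF \<beta>] that] by simp
    qed
    have form: "form_series n d (A s) (jet_series (y s)) = form_series n d (coefs x) (jet_series x)" for s
    proof -
      have "form_series n d (A s) (jet_series (y s)) = form_series n d (\<lambda>\<alpha>. \<Sum>\<beta>\<in>mindices (n+1) d.
          x (Coef \<beta>) * line_power (\<beta> 0) 0 u 1 (- s) (\<beta>(0 := 0)) \<alpha>) (jet_series (y s))"
        by (intro form_series_cong refl) (simp add: A_def)
      also have "\<dots> = (\<Sum>\<beta>\<in>mindices (n+1) d. fps_const (x (Coef \<beta>)) *
          form_series n d (line_power (\<beta> 0) 0 u 1 (- s) (\<beta>(0 := 0))) (jet_series (y s)))"
        by (rule form_series_sum[OF finite_mindices])
      also have "\<dots> = (\<Sum>\<beta>\<in>mindices (n+1) d. fps_const (x (Coef \<beta>)) * series_monomial n (jet_series x) \<beta>)"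
      proof (intro sum.cong refl arg_cong2[of _ _ _ _ "(*)"])
        fix \<beta> assume \<beta>: "\<beta> \<in> mindices (n+1) d"
        have "form_series n d (line_power (\<beta> 0) 0 u 1 (- s) (\<beta>(0 := 0))) (jet_series (y s)) =
            series_monomial n (jet_series (y s)) (\<beta>(0 := 0)) *
            (fps_const 1 * jet_series (y s) 0 + fps_const (- s) * jet_series (y s) u) ^ \<beta> 0"
          by (rule line_power_form[OF le0 u split[OF \<beta>]])
        also have "fps_const 1 * jet_series (y s) 0 + fps_const (- s) * jet_series (y s) u = jet_series x 0"
          unfolding j0 jk[OF u0] xu by (simp flip: fps_const_add add: fps_const_neg[symmetric] del: fps_const_neg)
        also have "series_monomial n (jet_series (y s)) (\<beta>(0 := 0)) = (\<Prod>i\<in>{..n+1} - {0}. jet_series x i ^ \<beta> i)"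
        proof -
          have "series_monomial n (jet_series (y s)) (\<beta>(0 := 0)) =
              jet_series (y s) 0 ^ (\<beta>(0 := 0)) 0 * (\<Prod>i\<in>{..n+1} - {0}. jet_series (y s) i ^ (\<beta>(0 := 0)) i)"
            unfolding series_monomial_def by (rule prod.remove) auto
          also have "(\<Prod>i\<in>{..n+1} - {0}. jet_series (y s) i ^ (\<beta>(0 := 0)) i) = (\<Prod>i\<in>{..n+1} - {0}. jet_series x i ^ \<beta> i)"
            by (rule prod.cong) (auto simp: jk)
          finally show ?thesis by (simp only: fun_upd_same power_0 mult_1_left)
        qed
        also have "(\<Prod>i\<in>{..n+1} - {0}. jet_series x i ^ \<beta> i) * jet_series x 0 ^ \<beta> 0 = series_monomial n (jet_series x) \<beta>"
          unfolding series_monomial_def by (subst prod.remove[of "{..n+1}" 0]) (auto simp: mult.commute)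
        finally show "form_series n d (line_power (\<beta> 0) 0 u 1 (- s) (\<beta>(0 := 0))) (jet_series (y s)) =
          series_monomial n (jet_series x) \<beta>" .
      qed
      finally show ?thesis by (simp add: form_series_alt coefs_def)
    qed
    have lim: "((\<lambda>s. A s \<alpha>) \<longlongrightarrow> x (Coef \<alpha>)) (at 0)" for \<alpha>
    proof -
      have "((\<lambda>s. A s \<alpha>) \<longlongrightarrow> A 0 \<alpha>) (at 0)"
        unfolding A_def line_power_def by (intro tendsto_eq_intros refl) simp_all
      also have "A 0 \<alpha> = (\<Sum>\<beta>\<in>mindices (n+1) d. if \<beta> = \<alpha> then x (Coef \<beta>) else 0)"
        unfolding A_def
      proof (intro sum.cong refl)
        fix \<beta> :: "nat \<Rightarrow> nat"
        have idx: "(\<lambda>m. (\<beta>(0 := 0)) m + binary_index 0 (\<beta> 0) u 0 m) = \<beta>"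
          by (auto simp: binary_index_def power_index_def)
        have "line_power (\<beta> 0) 0 u 1 (- 0) (\<beta>(0 := 0)) \<alpha> =
            (\<Sum>i\<le>\<beta> 0. if i = \<beta> 0 then monomial (\<lambda>m. (\<beta>(0 := 0)) m + binary_index 0 (\<beta> 0) u 0 m) \<alpha> else 0)"
          unfolding line_power_def by (intro sum.cong refl) auto
        also have "\<dots> = monomial \<beta> \<alpha>" unfolding idx by simp
        finally show "x (Coef \<beta>) * line_power (\<beta> 0) 0 u 1 (- 0) (\<beta>(0 := 0)) \<alpha> =
            (if \<beta> = \<alpha> then x (Coef \<beta>) else 0)" by (simp add: monomial_def)
      qed
      also have "\<dots> = x (Coef \<alpha>)"
        using finite_mindices[of "n+1" d] chart_spaceD(5)[OF xs _ b, of \<alpha>] by simp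
      finally show ?thesis .
    qed
    show ?thesis
    proof (rule zariski_closed_limit[OF C(1) c, of p y])
      show "p \<in> Jvert n d \<inter> chart_dom n d (u, b)" using pJ pd by simp
      show "chart_vector n d (u, b) (y s)" for s
        unfolding chart_vector_def fst_conv snd_conv
      proof (intro allI impI)
        fix i assume i: "i \<notin> free_coords n d (u, b) \<union> {Coef b}"
        have xi: "x i = (if i = Jet u 0 then 1 else 0)"
          by (rule chart_vector_chart_space[OF xs, unfolded chart_vector_def fst_conv snd_conv, rule_format, OF i])
        show "y s i = (if i = Jet u 0 then 1 else 0)"
        proof (cases i)
          case (Coef \<alpha>)
          hence "\<alpha> \<notin> mindices (n+1) d" using i by (auto simp: free_coords_def)
          thus ?thesis using Coef A0 by (simp add: y_def)
        next
          case (Jet k l)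
          hence "\<not> (k = 0 \<and> l = 0)" using i u0 by (auto simp: free_coords_def)
          thus ?thesis using Jet xi by (auto simp: y_def)
        qed
      qed
      show "in_cone n d (y s)" for s
      proof -
        have "form_series n d (coefs (y s)) (jet_series (y s)) = form_series n d (A s) (jet_series (y s))"
          by (intro form_series_cong refl) (simp add: coefs_def y_def)
        thus ?thesis using cone unfolding in_cone_def form by simp
      qed
      show "((\<lambda>s. y s i) \<longlongrightarrow> chart_map n d (u, b) p i) (at 0)" for i
      proof (cases i)
        case (Coef \<alpha>)
        thus ?thesis using lim by (simp add: y_def x_def)
      next
        case (Jet k l)
        show ?thesis
        proof (cases "k = 0 \<and> l = 0")
          case True0: True
          have "((\<lambda>s. s) \<longlongrightarrow> (0::complex)) (at 0)" by (rule tendsto_ident_at)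
          thus ?thesis using Jet True0 True by (simp add: y_def x_def)
        next
          case False
          hence "y s i = x i" for s using Jet by (auto simp: y_def)
          thus ?thesis by (simp add: x_def)
        qed
      qed
      fix s q assume s: "s \<noteq> 0" "y s (Coef b) \<noteq> 0" and q: "q \<in> Jvert n d \<inter> chart_dom n d (u, b)"
        "chart_map n d (u, b) q = unit_coef b (y s)"
      have "chart_map n d (u, b) q (Jet k 1) = x (Jet k 1)" for k
        unfolding q(2) by (simp add: unit_coef_def y_def)
      moreover have "\<forall>k\<in>{..n+1} - {u}. x (Jet k 1) = 0"
        using flat_jets_iff[OF n1 c, of p] p pJ pd unfolding x_def by blast
      ultimately have qf: "q \<in> flat_jets n d" using flat_jets_iff[OF n1 c q(1)] by simp
      have "chart_map n d (u, b) q (Jet 0 0) = s" unfolding q(2) by (simp add: unit_coef_def y_def)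
      moreover have "chart_map n d (u, b) q (Coef b) = 1"
        using chart_spaceD(2)[OF chart_map_in_space[OF c]] q(1) by simp
      ultimately have "q \<in> chart_dom n d (0, b)" using in_chart_dom_iff[OF c _ c', of q] q(1) s by simp
      thus "q \<in> C" by (rule flat_jets_limit_in_affine_chart[OF C c' qf])
    qed
  qed
qed

lemma Sigma_tilde_eq: "Sigma_tilde n d = flat_jets n d"
proof
  have "flat_start \<subseteq> flat_jets n d" using flat_start_iff by (auto simp: flat_start_def)
  thus "Sigma_tilde n d \<subseteq> flat_jets n d"
    using flat_jets_closed[OF n1] unfolding Sigma_tilde_def zariski_closure_def flat_start_def by blast
  show "flat_jets n d \<subseteq> Sigma_tilde n d"
    unfolding Sigma_tilde_def zariski_closure_def flat_start_def[symmetric]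
    using flat_jets_limit by blast
qed

end


section \<open>Weights\<close>

text \<open>
  The indeterminacy of a lift: a unit power series for the disc, of which only the jet
  matters, and a constant for the form.
\<close>

definition rescaled ::
    "nat \<Rightarrow> complex fps \<Rightarrow> complex \<Rightarrow> (coord \<Rightarrow> complex) \<Rightarrow> (coord \<Rightarrow> complex) \<Rightarrow> bool" where
  "rescaled n \<rho> \<mu> x y \<longleftrightarrow> fps_nth \<rho> 0 \<noteq> 0 \<and>
     (\<forall>k\<le>n+1. agree n (jet_series y k) (\<rho> * jet_series x k)) \<and> (\<forall>\<alpha>. coefs y \<alpha> = \<mu> * coefs x \<alpha>)"

text \<open>
  The polynomials that define sections of \<open>\<O>(q)\<close> on the jets of \<open>\<P>\<^sup>n\<^sup>+\<^sup>1\<close>, twisted by \<open>\<O>(e)\<close> on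
  the space of forms.
\<close>

definition weighted :: "nat \<Rightarrow> nat \<Rightarrow> nat \<Rightarrow> ((coord \<Rightarrow> complex) \<Rightarrow> complex) \<Rightarrow> bool" where
  "weighted n q e f \<longleftrightarrow> f \<in> poly_funs \<and>
     (\<forall>\<rho> \<mu> x y. rescaled n \<rho> \<mu> x y \<longrightarrow> f y = fps_nth \<rho> 0 ^ q * \<mu> ^ e * f x)"

lemma weightedD:
  "weighted n q e f \<Longrightarrow> rescaled n \<rho> \<mu> x y \<Longrightarrow> f y = fps_nth \<rho> 0 ^ q * \<mu> ^ e * f x"
  by (simp add: weighted_def)

lemma weighted_poly: "weighted n q e f \<Longrightarrow> f \<in> poly_funs"
  by (simp add: weighted_def)

lemma weighted_0: "weighted n q e (\<lambda>_. 0)"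
  by (simp add: weighted_def poly_funs.const)

lemma weighted_const: "weighted n 0 0 (\<lambda>_. w)"
  by (simp add: weighted_def poly_funs.const)

lemma weighted_add: "weighted n q e f \<Longrightarrow> weighted n q e g \<Longrightarrow> weighted n q e (\<lambda>x. f x + g x)"
  unfolding weighted_def by (auto simp: poly_funs.add distrib_left)

lemma weighted_mult:
  assumes "weighted n q e f" "weighted n q' e' g"
  shows "weighted n (q + q') (e + e') (\<lambda>x. f x * g x)"
  unfolding weighted_def
proof (intro conjI allI impI)
  show "(\<lambda>x. f x * g x) \<in> poly_funs"
    using assms by (intro poly_funs.mult weighted_poly)
  fix \<rho> \<mu> x y assume r: "rescaled n \<rho> \<mu> x y"
  show "f y * g y = fps_nth \<rho> 0 ^ (q + q') * \<mu> ^ (e + e') * (f x * g x)"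
    unfolding weightedD[OF assms(1) r] weightedD[OF assms(2) r] by (simp add: power_add mult_ac)
qed

lemma weighted_uminus: "weighted n q e f \<Longrightarrow> weighted n q e (\<lambda>x. - f x)"
  using weighted_mult[OF weighted_const[of n "-1"], of q e f] by simp

lemma weighted_diff: "weighted n q e f \<Longrightarrow> weighted n q e g \<Longrightarrow> weighted n q e (\<lambda>x. f x - g x)"
  using weighted_add[OF _ weighted_uminus, of n q e f g] by simp

lemma weighted_cmult: "weighted n q e f \<Longrightarrow> weighted n q e (\<lambda>x. w * f x)"
  using weighted_mult[OF weighted_const[of n w], of q e f] by simp

lemma weighted_sum: "(\<And>i. i \<in> I \<Longrightarrow> weighted n q e (f i)) \<Longrightarrow> weighted n q e (\<lambda>x. \<Sum>i\<in>I. f i x)"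
  by (induction I rule: infinite_finite_induct) (auto intro: weighted_0 weighted_add)

lemma weighted_power: "weighted n q e f \<Longrightarrow> weighted n (r * q) (r * e) (\<lambda>x. f x ^ r)"
proof (induction r)
  case 0
  show ?case using weighted_const[of n 1] by simp
next
  case (Suc r)
  thus ?case using weighted_mult[OF Suc.prems Suc.IH] by simp
qed

lemma weighted_jet_0: "k \<le> n + 1 \<Longrightarrow> weighted n 1 0 (\<lambda>x. x (Jet k 0))"
  unfolding weighted_def
proof (intro conjI allI impI poly_funs.coord)
  fix \<rho> \<mu> x y assume k: "k \<le> n + 1" and "rescaled n \<rho> \<mu> x y"
  hence "agree n (jet_series y k) (\<rho> * jet_series x k)" by (simp add: rescaled_def)
  from agree_nth[OF this le0] show "y (Jet k 0) = fps_nth \<rho> 0 ^ 1 * \<mu> ^ 0 * x (Jet k 0)"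
    by (simp add: jet_series_nth)
qed

lemma weighted_coef: "weighted n 0 1 (\<lambda>x. x (Coef \<alpha>))"
  by (auto simp: weighted_def rescaled_def coefs_def poly_funs.coord)

text \<open>
  The order of a Taylor coefficient counts as weight, as it does for the coordinates
  \<open>z\<^sub>k\<^sup>(\<^sup>l\<^sup>)\<close>, which have poles of order \<open>l + 1\<close> at infinity.
\<close>

definition weighted_series :: "nat \<Rightarrow> nat \<Rightarrow> ((coord \<Rightarrow> complex) \<Rightarrow> complex fps) \<Rightarrow> bool" where
  "weighted_series n a F \<longleftrightarrow> (\<forall>m\<le>n. weighted n (m + a) 0 (\<lambda>x. fps_nth (F x) m))"

lemma weighted_series_nth: "weighted_series n a F \<Longrightarrow> m \<le> n \<Longrightarrow> weighted n (m + a) 0 (\<lambda>x. fps_nth (F x) m)"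
  by (simp add: weighted_series_def)

lemma weighted_series_const:
  assumes "weighted n a 0 f" shows "weighted_series n a (\<lambda>x. fps_const (f x))"
  unfolding weighted_series_def
proof (intro allI impI)
  fix m show "weighted n (m + a) 0 (\<lambda>x. fps_nth (fps_const (f x)) m)"
    using assms weighted_0 by (cases m) simp_all
qed

lemma weighted_series_diff:
  "weighted_series n a F \<Longrightarrow> weighted_series n a G \<Longrightarrow> weighted_series n a (\<lambda>x. F x - G x)"
  by (simp add: weighted_series_def weighted_diff)

lemma weighted_series_mult:
  assumes "weighted_series n a F" "weighted_series n b G"
  shows "weighted_series n (a + b) (\<lambda>x. F x * G x)"
  unfolding weighted_series_def fps_mult_nth
proof (intro allI impI weighted_sum)
  fix m i assume m: "m \<le> n" and "i \<in> {0..m}"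
  hence i: "i \<le> m" by simp
  have "weighted n ((i + a) + ((m - i) + b)) (0 + 0) (\<lambda>x. fps_nth (F x) i * fps_nth (G x) (m - i))"
    using i m by (intro weighted_mult weighted_series_nth[OF assms(1)] weighted_series_nth[OF assms(2)]) auto
  thus "weighted n (m + (a + b)) 0 (\<lambda>x. fps_nth (F x) i * fps_nth (G x) (m - i))"
    using i by (simp add: algebra_simps)
qed

lemma weighted_series_power: "weighted_series n a F \<Longrightarrow> weighted_series n (r * a) (\<lambda>x. F x ^ r)"
proof (induction r)
  case 0
  show ?case using weighted_series_const[OF weighted_const[of n 1]] by simp
next
  case (Suc r)
  thus ?case using weighted_series_mult[OF Suc.prems Suc.IH] by simp
qed

lemma weighted_series_prod:
  "(\<And>i. i \<in> I \<Longrightarrow> weighted_series n (a i) (F i)) \<Longrightarrow> weighted_series n (\<Sum>i\<in>I. a i) (\<lambda>x. \<Prod>i\<in>I. F i x)"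
proof (induction I rule: infinite_finite_induct)
  case (insert i I)
  have "weighted_series n (a i + (\<Sum>j\<in>I. a j)) (\<lambda>x. F i x * (\<Prod>j\<in>I. F j x))"
    using insert by (intro weighted_series_mult) auto
  thus ?case using insert.hyps by simp
qed (use weighted_series_const[OF weighted_const[of n 1]] in simp_all)


section \<open>Clearing the pole at infinity\<close>

text \<open>The substitution \<open>t \<mapsto> c t\<close>.\<close>

definition dilate :: "complex \<Rightarrow> complex fps \<Rightarrow> complex fps" where
  "dilate c F = fps_compose F (fps_const c * fps_X)"

lemma dilate_nth: "fps_nth (dilate c F) m = c ^ m * fps_nth F m"
  by (simp add: dilate_def fps_compose_linear)

lemma dilate_mult: "dilate c (F * G) = dilate c F * dilate c G"
  unfolding dilate_def by (rule fps_compose_mult_distrib) simp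

lemma dilate_diff: "dilate c (F - G) = dilate c F - dilate c G"
  by (rule fps_ext) (simp add: dilate_nth algebra_simps)

lemma dilate_const: "dilate c (fps_const a) = fps_const a"
  by (rule fps_ext) (simp add: dilate_nth)

lemma dilate_power: "dilate c (F ^ r) = dilate c F ^ r"
  by (induction r) (simp_all add: dilate_mult dilate_const[of c 1, simplified])

lemma dilate_X: "dilate c fps_X = fps_const c * fps_X"
  by (rule fps_ext) (auto simp: dilate_nth le_Suc_eq)

lemma dilate_sum: "dilate c (\<Sum>i\<in>I. F i) = (\<Sum>i\<in>I. dilate c (F i))"
  by (rule fps_ext) (simp add: dilate_nth fps_sum_nth sum_distrib_left)

lemma dilate_prod: "dilate c (\<Prod>i\<in>I. F i) = (\<Prod>i\<in>I. dilate c (F i))"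
  by (induction I rule: infinite_finite_induct) (simp_all add: dilate_mult dilate_const[of c 1, simplified])

lemma dilate_inverse:
  assumes "fps_nth F 0 \<noteq> 0" shows "dilate c (inverse F) = inverse (dilate c F)"
proof -
  have "dilate c (inverse F) * dilate c F = 1"
    using assms by (simp add: dilate_mult[symmetric] inverse_mult_eq_1 dilate_const[of c 1, simplified])
  thus ?thesis by (metis fps_inverse_unique inverse_mult_eq_1 mult.commute)
qed

text \<open>
  The series \<open>Z\<^sub>u(Z\<^sub>u(0) t) / Z\<^sub>u(0)\<close>.  It is polynomial in the jet and has constant term \<open>1\<close>, so that
  dividing by it creates no denominators, even where \<open>Z\<^sub>u(0) = 0\<close>.
\<close>

definition cleared_denominator :: "(coord \<Rightarrow> complex) \<Rightarrow> nat \<Rightarrow> complex fps" where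
  "cleared_denominator x u =
     Abs_fps (\<lambda>m. if m = 0 then 1 else x (Jet u 0) ^ (m - 1) * fps_nth (jet_series x u) m)"

text \<open>
  A polynomial version of the affine coordinate \<open>z\<^sub>k = Z\<^sub>k / Z\<^sub>u\<close>: for \<open>Z\<^sub>u(0) \<noteq> 0\<close> it is
  \<open>Z\<^sub>u(0) z\<^sub>k(Z\<^sub>u(0) t)\<close>, with coefficients \<open>Z\<^sub>u(0)\<^sup>l\<^sup>+\<^sup>1 z\<^sub>k\<^sup>(\<^sup>l\<^sup>)(0) / l!\<close>.
\<close>

definition cleared_series :: "(coord \<Rightarrow> complex) \<Rightarrow> nat \<Rightarrow> nat \<Rightarrow> complex fps" where
  "cleared_series x u k = dilate (x (Jet u 0)) (jet_series x k) * inverse (cleared_denominator x u)"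

lemma cleared_series_generic:
  assumes "x (Jet u 0) \<noteq> 0"
  shows "cleared_series x u k =
    fps_const (x (Jet u 0)) * dilate (x (Jet u 0)) (jet_series x k * inverse (jet_series x u))"
proof -
  let ?c = "x (Jet u 0)"
  have j0: "fps_nth (jet_series x u) 0 \<noteq> 0" using assms by (simp add: jet_series_nth)
  have eq: "fps_const ?c * cleared_denominator x u = dilate ?c (jet_series x u)"
  proof (rule fps_ext)
    fix m show "fps_nth (fps_const ?c * cleared_denominator x u) m = fps_nth (dilate ?c (jet_series x u)) m"
      by (cases m) (simp_all add: cleared_denominator_def dilate_nth jet_series_nth)
  qed
  have c1: "fps_const ?c * inverse (fps_const ?c) = (1 :: complex fps)"
    using assms by (intro inverse_mult_eq_1') simp
  have "inverse (dilate ?c (jet_series x u)) = inverse (fps_const ?c) * inverse (cleared_denominator x u)"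
    unfolding eq[symmetric] by (rule fps_inverse_mult)
  hence "fps_const ?c * inverse (dilate ?c (jet_series x u)) = inverse (cleared_denominator x u)"
    using c1 by (simp add: mult.assoc[symmetric])
  thus ?thesis
    unfolding cleared_series_def dilate_mult dilate_inverse[OF j0] by (metis mult.left_commute)
qed

lemma poly_series_inverse:
  assumes F: "poly_series F" and F0: "\<And>x. fps_nth (F x) 0 = 1"
  shows "poly_series (\<lambda>x. inverse (F x))"
proof -
  have "(\<lambda>x. fps_nth (inverse (F x)) m) \<in> poly_funs" for m
  proof (induction m rule: less_induct)
    case (less m)
    show ?case
    proof (cases m)
      case 0
      thus ?thesis using F0 by (simp add: poly_funs.const)
    next
      case (Suc r)
      have "fps_nth (inverse (F x)) m = - (\<Sum>i<m. fps_nth (inverse (F x)) i * fps_nth (F x) (m - i))" for x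
      proof -
        have "inverse (F x) * F x = 1" using F0[of x] by (intro inverse_mult_eq_1) simp
        hence "fps_nth (inverse (F x) * F x) m = 0" using Suc by simp
        hence "(\<Sum>i\<le>m. fps_nth (inverse (F x)) i * fps_nth (F x) (m - i)) = 0"
          by (simp add: fps_mult_nth atLeast0AtMost)
        hence "(\<Sum>i<m. fps_nth (inverse (F x)) i * fps_nth (F x) (m - i)) + fps_nth (inverse (F x)) m = 0"
          using F0[of x] by (simp add: lessThan_Suc_atMost[symmetric])
        thus ?thesis by (simp add: add_eq_0_iff)
      qed
      moreover have "(\<lambda>x. - (\<Sum>i<m. fps_nth (inverse (F x)) i * fps_nth (F x) (m - i))) \<in> poly_funs"
        by (intro poly_uminus poly_sum poly_funs.mult less poly_series_nth[OF F]) simp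
      ultimately show ?thesis by simp
    qed
  qed
  thus ?thesis by (simp add: poly_series_def)
qed

lemma poly_series_cleared: "poly_series (\<lambda>x. cleared_series x u k)"
proof -
  have "(\<lambda>x. x (Jet u 0) ^ m * fps_nth (jet_series x k) m) \<in> poly_funs" for m
    by (intro poly_funs.mult poly_power poly_funs.coord poly_series_nth[OF poly_series_jet])
  hence 1: "poly_series (\<lambda>x. dilate (x (Jet u 0)) (jet_series x k))"
    by (simp add: poly_series_def dilate_nth)
  have "(\<lambda>x. if m = 0 then 1 else x (Jet u 0) ^ (m - 1) * fps_nth (jet_series x u) m) \<in> poly_funs" for m
    by (cases "m = 0") (simp_all add: poly_funs.const poly_funs.mult poly_power poly_funs.coord poly_series_nth[OF poly_series_jet])
  hence 2: "poly_series (\<lambda>x. cleared_denominator x u)"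
    by (simp add: poly_series_def cleared_denominator_def)
  show ?thesis unfolding cleared_series_def
    by (intro poly_series_mult 1 poly_series_inverse 2) (simp add: cleared_denominator_def)
qed

text \<open>
  Where \<open>Z\<^sub>u(0) \<noteq> 0\<close> this holds because \<open>z\<^sub>k\<close> does not depend on the lift.  Where \<open>Z\<^sub>u(0) = 0\<close> the series
  degenerates to \<open>Z\<^sub>k(0) / (1 + Z\<^sub>u'(0) t)\<close>, on which a rescaling acts by \<open>Z\<^sub>k(0) \<mapsto> \<rho>(0) Z\<^sub>k(0)\<close> and
  \<open>Z\<^sub>u'(0) \<mapsto> \<rho>(0) Z\<^sub>u'(0)\<close>.
\<close>

lemma weighted_series_cleared:
  assumes u: "u \<le> n + 1" and k: "k \<le> n + 1" and n: "n \<ge> 1"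
  shows "weighted_series n 1 (\<lambda>x. cleared_series x u k)"
  unfolding weighted_series_def weighted_def
proof (intro allI impI conjI)
  fix m assume m: "m \<le> n"
  show "(\<lambda>x. fps_nth (cleared_series x u k) m) \<in> poly_funs"
    by (rule poly_series_nth[OF poly_series_cleared])
  fix \<rho> \<mu> x y assume r: "rescaled n \<rho> \<mu> x y"
  define c where "c = fps_nth \<rho> 0"
  have c: "c \<noteq> 0" using r by (simp add: c_def rescaled_def)
  have ag: "agree n (jet_series y i) (\<rho> * jet_series x i)" if "i \<le> n + 1" for i
    using r that by (simp add: rescaled_def)
  have zero: "y (Jet i 0) = c * x (Jet i 0)" if "i \<le> n + 1" for i
    using agree_nth[OF ag[OF that] le0] by (simp add: jet_series_nth c_def)
  show "fps_nth (cleared_series y u k) m = fps_nth \<rho> 0 ^ (m + 1) * \<mu> ^ 0 * fps_nth (cleared_series x u k) m"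
  proof (cases "x (Jet u 0) = 0")
    case False
    hence yu: "y (Jet u 0) \<noteq> 0" using zero[OF u] c by simp
    have "agree n (jet_series y k * inverse (jet_series y u)) ((\<rho> * jet_series x k) * inverse (\<rho> * jet_series x u))"
      using False c by (intro agree_mult ag k agree_inverse ag u) (simp add: c_def[symmetric] jet_series_nth)
    also have "(\<rho> * jet_series x k) * inverse (\<rho> * jet_series x u) = (\<rho> * inverse \<rho>) * (jet_series x k * inverse (jet_series x u))"
      unfolding fps_inverse_mult by (simp only: mult_ac)
    also have "\<rho> * inverse \<rho> = 1" using c by (intro inverse_mult_eq_1') (simp add: c_def)
    finally have "fps_nth (jet_series y k * inverse (jet_series y u)) m = fps_nth (jet_series x k * inverse (jet_series x u)) m"
      using m by (simp add: agree_nth)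
    thus ?thesis
      unfolding cleared_series_generic[of y, OF yu] cleared_series_generic[of x, OF False]
      by (simp add: dilate_nth zero[OF u] c_def power_mult_distrib)
  next
    case True
    hence yu: "y (Jet u 0) = 0" using zero[OF u] by simp
    have y1: "fps_nth (jet_series y u) 1 = c * fps_nth (jet_series x u) 1"
      using agree_nth[OF ag[OF u] n] True by (simp add: fps_mult_nth c_def jet_series_nth)
    have d: "cleared_denominator y u = dilate c (cleared_denominator x u)"
    proof (rule fps_ext)
      fix i show "fps_nth (cleared_denominator y u) i = fps_nth (dilate c (cleared_denominator x u)) i"
        using y1 True yu by (cases "i \<le> 1") (auto simp: cleared_denominator_def dilate_nth le_Suc_eq)
    qed
    have e: "dilate (y (Jet u 0)) (jet_series y k) = fps_const c * dilate c (dilate (x (Jet u 0)) (jet_series x k))"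
    proof (rule fps_ext)
      fix i show "fps_nth (dilate (y (Jet u 0)) (jet_series y k)) i =
          fps_nth (fps_const c * dilate c (dilate (x (Jet u 0)) (jet_series x k))) i"
        using zero[OF k] True yu by (cases i) (simp_all add: dilate_nth jet_series_nth)
    qed
    have "cleared_series y u k = fps_const c * dilate c (cleared_series x u k)"
      unfolding cleared_series_def d e dilate_mult
      by (subst dilate_inverse) (simp_all add: cleared_denominator_def mult.assoc)
    thus ?thesis by (simp add: dilate_nth c_def)
  qed
qed


section \<open>Division by powers of a local parameter\<close>

text \<open>
  Expansion of \<open>G\<close> in powers of the local parameter \<open>T\<close>, one order at a time: if the remainder
  \<open>R\<close> starts with \<open>r t\<^sup>m\<close>, the next one is \<open>T\<^sub>1\<^sup>m R - r T\<^sup>m\<close>.  Since \<open>T\<^sub>1\<close> has weight \<open>2\<close>,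
  step \<open>m\<close> adds \<open>2m\<close> to the weights.
\<close>

lemma pseudo_division:
  assumes n: "n \<ge> 1" and G: "weighted_series n a G" and T: "weighted_series n 1 T" and T0: "\<And>x. fps_nth (T x) 0 = 0"
  shows "m \<le> n + 1 \<Longrightarrow> \<exists>q R. weighted_series n (a + m * (m - 1)) R \<and>
    (\<forall>j<m. \<exists>w. w + j = a + m * (m - 1) \<and> weighted n w 0 (q j)) \<and>
    (\<forall>x. fps_const (fps_nth (T x) 1 ^ (m * (m - 1) div 2)) * G x =
       (\<Sum>j<m. fps_const (q j x) * T x ^ j) + R x \<and> (\<forall>i<m. fps_nth (R x) i = 0))"
proof (induction m)
  case 0
  show ?case
    by (rule exI[of _ "\<lambda>_ _. 0"], rule exI[of _ G]) (use G in simp)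
next
  case (Suc m)
  hence m: "m \<le> n" by simp
  have "m \<le> n + 1" using m by simp
  from Suc.IH[OF this] obtain q R where qR: "weighted_series n (a + m * (m - 1)) R \<and>
    (\<forall>j<m. \<exists>w. w + j = a + m * (m - 1) \<and> weighted n w 0 (q j)) \<and>
    (\<forall>x. fps_const (fps_nth (T x) 1 ^ (m * (m - 1) div 2)) * G x =
       (\<Sum>j<m. fps_const (q j x) * T x ^ j) + R x \<and> (\<forall>i<m. fps_nth (R x) i = 0))"
    by (elim exE)
  note R = conjunct1[OF qR]
  have q: "\<exists>w. w + j = a + m * (m - 1) \<and> weighted n w 0 (q j)" if "j < m" for j
    using conjunct1[OF conjunct2[OF qR]] that by blast
  have eq: "fps_const (fps_nth (T x) 1 ^ (m * (m - 1) div 2)) * G x =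
       (\<Sum>j<m. fps_const (q j x) * T x ^ j) + R x" for x
    using conjunct2[OF conjunct2[OF qR]] by blast
  have R0: "fps_nth (R x) i = 0" if "i < m" for x i
    using conjunct2[OF conjunct2[OF qR]] that by blast
  define q' where "q' j x = (if j < m then fps_nth (T x) 1 ^ m * q j x else fps_nth (R x) m)" for j x
  define R' where "R' x = fps_const (fps_nth (T x) 1 ^ m) * R x - fps_const (fps_nth (R x) m) * T x ^ m" for x
  have ar: "m * (m - 1) + 2 * m = Suc m * (Suc m - 1)" by (cases m) auto
  hence ar2: "m + m * (m - 1) div 2 = Suc m * (Suc m - 1) div 2" by linarith
  have T1: "weighted n (m * 2) 0 (\<lambda>x. fps_nth (T x) 1 ^ m)"
    using weighted_power[OF weighted_series_nth[OF T n], of m] by (simp add: numeral_2_eq_2)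
  have Rm: "weighted n (m + (a + m * (m - 1))) 0 (\<lambda>x. fps_nth (R x) m)"
    by (rule weighted_series_nth[OF R m])
  have A: "weighted_series n (m * 2 + (a + m * (m - 1))) (\<lambda>x. fps_const (fps_nth (T x) 1 ^ m) * R x)"
    by (intro weighted_series_mult weighted_series_const T1 R)
  have B: "weighted_series n ((m + (a + m * (m - 1))) + m * 1) (\<lambda>x. fps_const (fps_nth (R x) m) * T x ^ m)"
    by (intro weighted_series_mult weighted_series_const weighted_series_power Rm T)
  have e: "m * 2 + (a + m * (m - 1)) = a + Suc m * (Suc m - 1)"
    "(m + (a + m * (m - 1))) + m * 1 = a + Suc m * (Suc m - 1)" using ar by linarith+
  have wR: "weighted_series n (a + Suc m * (Suc m - 1)) R'"
    unfolding R'_def by (rule weighted_series_diff[OF A[unfolded e(1)] B[unfolded e(2)]])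
  have wq: "\<exists>w. w + j = a + Suc m * (Suc m - 1) \<and> weighted n w 0 (q' j)" if j: "j < Suc m" for j
  proof (cases "j < m")
    case True
    then obtain w where w: "w + j = a + m * (m - 1)" "weighted n w 0 (q j)" using q by blast
    have "weighted n (m * 2 + w) (0 + 0) (\<lambda>x. fps_nth (T x) 1 ^ m * q j x)"
      by (rule weighted_mult[OF T1 w(2)])
    moreover have "q' j = (\<lambda>x. fps_nth (T x) 1 ^ m * q j x)" using True by (auto simp: q'_def)
    ultimately have "weighted n (m * 2 + w) 0 (q' j)" by (simp only: add_0_left)
    moreover have "(m * 2 + w) + j = a + Suc m * (Suc m - 1)" using w(1) ar by linarith
    ultimately show ?thesis by blast
  next
    case False
    hence jm: "j = m" using j by simp
    have "q' j = (\<lambda>x. fps_nth (R x) m)" using False by (auto simp: q'_def)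
    hence "weighted n (m + (a + m * (m - 1))) 0 (q' j)" using Rm by (simp only:)
    moreover have "(m + (a + m * (m - 1))) + j = a + Suc m * (Suc m - 1)" using ar jm by linarith
    ultimately show ?thesis by blast
  qed
  have "fps_const (fps_nth (T x) 1 ^ (Suc m * (Suc m - 1) div 2)) * G x =
      (\<Sum>j<Suc m. fps_const (q' j x) * T x ^ j) + R' x" for x
  proof -
    have "fps_const (fps_nth (T x) 1 ^ (Suc m * (Suc m - 1) div 2)) * G x =
        fps_const (fps_nth (T x) 1 ^ m) * (fps_const (fps_nth (T x) 1 ^ (m * (m - 1) div 2)) * G x)"
      unfolding ar2[symmetric] power_add by (simp add: fps_const_mult[symmetric] mult.assoc del: fps_const_mult)
    also have "\<dots> = (\<Sum>j<m. fps_const (q' j x) * T x ^ j) + fps_const (fps_nth (T x) 1 ^ m) * R x"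
      unfolding eq distrib_left sum_distrib_left
      by (intro arg_cong2[of _ _ _ _ "(+)"] sum.cong refl)
         (simp add: q'_def fps_const_mult[symmetric] mult.assoc del: fps_const_mult)
    finally show ?thesis by (simp add: R'_def q'_def)
  qed
  moreover have "fps_nth (R' x) i = 0" if i: "i < Suc m" for x i
  proof (cases "i < m")
    case True
    thus ?thesis using R0[OF True] startsby_zero_power_prefix[OF T0] by (simp add: R'_def)
  next
    case False
    hence "i = m" using i by simp
    thus ?thesis using startsby_zero_power_nth_same[OF T0, of x m] by (simp add: R'_def)
  qed
  ultimately show ?case using wR wq by blast
qed

text \<open>
  The derivative \<open>z\<^sub>k'(0)\<close> of the affine coordinate, multiplied by \<open>Z\<^sub>u(0)\<^sup>2\<close>.
\<close>

definition bend :: "nat \<Rightarrow> nat \<Rightarrow> (coord \<Rightarrow> complex) \<Rightarrow> complex" where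
  "bend u k x = x (Jet u 0) * x (Jet k 1) - x (Jet k 0) * x (Jet u 1)"

text \<open>
  The factor that elimination up to order \<open>n\<close> costs; the power of \<open>Z\<^sub>u(0)\<close> is the price for passing
  from affine to homogeneous coordinates in degree \<open>n\<close>.
\<close>

definition bend_factor :: "nat \<Rightarrow> nat \<Rightarrow> nat \<Rightarrow> (coord \<Rightarrow> complex) \<Rightarrow> complex" where
  "bend_factor n u k x = bend u k x ^ ((n + 1) * n div 2) * x (Jet u 0) ^ n"

lemma cleared_series_1: "fps_nth (cleared_series x u k) 1 = bend u k x"
proof -
  let ?V = "cleared_denominator x u"
  have V0: "fps_nth ?V 0 = 1" by (simp add: cleared_denominator_def)
  have "fps_nth (?V * inverse ?V) 1 = 0" using V0 by (subst inverse_mult_eq_1') simp_all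
  hence "fps_nth (inverse ?V) 1 = - fps_nth ?V 1" using V0 by (simp add: fps_mult_nth add_eq_0_iff)
  thus ?thesis using V0
    by (simp add: cleared_series_def fps_mult_nth dilate_nth bend_def jet_series_nth cleared_denominator_def)
qed

lemma weighted_bend_factor:
  assumes "n \<ge> 1" "u \<le> n + 1" "k \<le> n + 1"
  shows "weighted n (n\<^sup>2 + 2 * n) 0 (bend_factor n u k)"
proof -
  have A: "weighted n (((n + 1) * n div 2) * (1 + 1) + n * 1) (((n + 1) * n div 2) * 0 + n * 0)
     (\<lambda>x. fps_nth (cleared_series x u k) 1 ^ ((n + 1) * n div 2) * x (Jet u 0) ^ n)"
    by (intro weighted_mult weighted_power weighted_series_nth[OF weighted_series_cleared] weighted_jet_0 assms)
  have e: "((n + 1) * n div 2) * (1 + 1) + n * 1 = n\<^sup>2 + 2 * n"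
  proof -
    have "even ((n + 1) * n)" by simp
    hence D: "((n + 1) * n div 2) * 2 = (n + 1) * n" by (rule dvd_div_mult_self)
    define D where "D = (n + 1) * n div 2"
    have "D * 2 = (n + 1) * n" using D unfolding D_def .
    hence "D * (1 + 1) + n * 1 = n\<^sup>2 + 2 * n" by (simp add: power2_eq_square)
    thus ?thesis unfolding D_def .
  qed
  have eq: "bend_factor n u k = (\<lambda>x. fps_nth (cleared_series x u k) 1 ^ ((n + 1) * n div 2) * x (Jet u 0) ^ n)"
    unfolding cleared_series_1 by (rule ext) (rule bend_factor_def)
  show ?thesis using A[unfolded e] unfolding eq by simp
qed

lemma poly_zero_by_perturbation:
  assumes f: "f \<in> poly_funs" and "\<And>x. x i \<noteq> 0 \<Longrightarrow> f x = 0"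
  shows "f x = 0"
proof (cases "x i = 0")
  case True
  have "((\<lambda>s. f (x(i := s))) \<longlongrightarrow> f x) (at 0)"
  proof (rule poly_tendsto[OF f])
    fix j
    have "((\<lambda>s. s) \<longlongrightarrow> (0::complex)) (at 0)" by (rule tendsto_ident_at)
    thus "((\<lambda>s. (x(i := s)) j) \<longlongrightarrow> x j) (at 0)" using True by (cases "j = i") auto
  qed
  moreover have "((\<lambda>s. f (x(i := s))) \<longlongrightarrow> 0) (at 0)"
    by (rule tendsto_eventually) (auto simp: eventually_at_filter assms(2))
  ultimately show ?thesis by (metis tendsto_unique trivial_limit_at)
qed (use assms in simp)

text \<open>
  The central count.  In the affine coordinates of the chart \<open>Z\<^sub>u \<noteq> 0\<close>, elimination expresses
  \<open>t\<^sup>l z\<^sup>\<beta>\<close> through the powers of \<open>z\<^sub>k - z\<^sub>k(0)\<close>, and homogenising these gives forms of degree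
  \<open>n\<close> in \<open>Z\<^sub>k\<close> and \<open>Z\<^sub>u\<close>.  The degree \<open>n\<close> of \<open>\<beta>\<close> and the \<open>n + 1\<close> elimination steps add up to the
  weight \<open>n + n(n+1)\<close>, whatever \<open>l\<close> is.  All terms are polynomial in the jet, so the identity
  extends to \<open>Z\<^sub>u(0) = 0\<close>.
\<close>

lemma weighted_time_shift:
  assumes n: "n \<ge> 1" and u: "u \<le> n + 1" and k: "k \<le> n + 1" and \<beta>: "\<beta> \<in> mindices (n+1) n"
  shows "\<exists>w. (\<forall>i\<le>n. weighted n (n\<^sup>2 + 2 * n) 0 (w i)) \<and>
    (\<forall>x. agree n (\<Sum>i\<le>n. fps_const (w i x) * (jet_series x k ^ i * jet_series x u ^ (n - i)))
       (fps_const (bend_factor n u k x) * fps_X ^ l * series_monomial n (jet_series x) \<beta>))"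
proof -
  define T where "T x = cleared_series x u k - fps_const (fps_nth (cleared_series x u k) 0)" for x
  define G where "G x = fps_const (x (Jet u 0) ^ l) * fps_X ^ l * (\<Prod>i\<le>n+1. cleared_series x u i ^ \<beta> i)" for x
  have sumb: "(\<Sum>i\<le>n+1. \<beta> i) = n" using \<beta> by (simp add: mindices_def)
  have wT: "weighted_series n 1 T"
    unfolding T_def
    by (intro weighted_series_diff weighted_series_const weighted_series_cleared u k n)
       (use weighted_series_nth[OF weighted_series_cleared[OF u k n] le0] in simp)
  have T0: "fps_nth (T x) 0 = 0" for x by (simp add: T_def)
  have T1: "fps_nth (T x) 1 = bend u k x" for x by (simp add: T_def cleared_series_1[simplified])
  have "weighted_series n 0 (\<lambda>x. fps_const (x (Jet u 0) ^ l) * fps_X ^ l)"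
    unfolding weighted_series_def
  proof (intro allI impI)
    fix m
    show "weighted n (m + 0) 0 (\<lambda>x. fps_nth (fps_const (x (Jet u 0) ^ l) * fps_X ^ l) m)"
      using weighted_power[OF weighted_jet_0[OF u], of l] weighted_0 by (cases "m = l") (simp_all add: fps_X_power_nth)
  qed
  hence "weighted_series n (0 + (\<Sum>i\<le>n+1. \<beta> i * 1)) G"
    unfolding G_def by (intro weighted_series_mult weighted_series_prod weighted_series_power weighted_series_cleared u n) auto
  hence wG: "weighted_series n n G" using sumb by simp
  from pseudo_division[OF n wG wT T0 order_refl]
  obtain q R where qR: "weighted_series n (n + (n + 1) * (n + 1 - 1)) R \<and>
    (\<forall>j<n + 1. \<exists>w. w + j = n + (n + 1) * (n + 1 - 1) \<and> weighted n w 0 (q j)) \<and>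
    (\<forall>x. fps_const (fps_nth (T x) 1 ^ ((n + 1) * (n + 1 - 1) div 2)) * G x =
       (\<Sum>j<n + 1. fps_const (q j x) * T x ^ j) + R x \<and> (\<forall>i<n + 1. fps_nth (R x) i = 0))"
    by (elim exE)
  have q: "\<exists>w. w + j = n + (n + 1) * (n + 1 - 1) \<and> weighted n w 0 (q j)" if "j < n + 1" for j
    using conjunct1[OF conjunct2[OF qR]] that by blast
  have eq: "fps_const (fps_nth (T x) 1 ^ ((n + 1) * (n + 1 - 1) div 2)) * G x =
       (\<Sum>j<n + 1. fps_const (q j x) * T x ^ j) + R x" for x
    using conjunct2[OF conjunct2[OF qR]] by blast
  have R0: "fps_nth (R x) i = 0" if "i < n + 1" for x i
    using conjunct2[OF conjunct2[OF qR]] that by blast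
  define w where "w i x = (\<Sum>j\<le>n. of_nat (j choose i) * (x (Jet u 0) ^ i * (- x (Jet k 0)) ^ (j - i)) * q j x)" for i x
  have ar: "n + (n + 1) * (n + 1 - 1) = n\<^sup>2 + 2 * n" by (simp add: power2_eq_square)
  have ww: "weighted n (n\<^sup>2 + 2 * n) 0 (w i)" for i
  proof -
    have "weighted n (n\<^sup>2 + 2 * n) 0 (\<lambda>x. of_nat (j choose i) * (x (Jet u 0) ^ i * (- x (Jet k 0)) ^ (j - i)) * q j x)"
      if j: "j \<le> n" for j
    proof (cases "i \<le> j")
      case False
      hence z: "j choose i = 0" by (intro binomial_eq_0) simp
      show ?thesis unfolding z using weighted_0 by simp
    next
      case True
      have "j < n + 1" using j by simp
      from q[OF this, unfolded ar] obtain v where v: "v + j = n\<^sup>2 + 2 * n" "weighted n v 0 (q j)" by blast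
      have "weighted n ((i * 1 + (j - i) * 1) + v) ((i * 0 + (j - i) * 0) + 0)
          (\<lambda>x. of_nat (j choose i) * (x (Jet u 0) ^ i * (- x (Jet k 0)) ^ (j - i)) * q j x)"
        by (intro weighted_mult weighted_cmult weighted_power weighted_uminus weighted_jet_0 u k v(2))
      moreover have "(i * 1 + (j - i) * 1) + v = n\<^sup>2 + 2 * n" using v(1) True by simp
      ultimately show ?thesis by simp
    qed
    thus ?thesis unfolding w_def by (intro weighted_sum) auto
  qed
  define D where "D x = (\<Sum>i\<le>n. fps_const (w i x) * (jet_series x k ^ i * jet_series x u ^ (n - i))) -
      fps_const (bend_factor n u k x) * fps_X ^ l * series_monomial n (jet_series x) \<beta>" for x
  \<comment> \<open>Off \<open>Z\<^sub>u(0) = 0\<close> everything is pulled back from the affine series by the dilatation \<open>t \<mapsto> Z\<^sub>u(0) t\<close>.\<close>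
  have generic: "fps_nth (D x) m = 0" if xu: "x (Jet u 0) \<noteq> 0" and m: "m \<le> n" for x m
  proof -
    define c where "c = x (Jet u 0)"
    define U where "U = jet_series x u"
    define L where "L = fps_const c * jet_series x k + fps_const (- x (Jet k 0)) * U"
    define Q where "Q i = jet_series x i * inverse U" for i
    have c0: "c \<noteq> 0" using xu by (simp add: c_def)
    have U0: "fps_nth U 0 \<noteq> 0" using c0 by (simp add: U_def jet_series_nth c_def)
    have UU: "U * inverse U = 1" using U0 by (rule inverse_mult_eq_1')
    have cs: "cleared_series x u i = fps_const c * dilate c (Q i)" for i
      using cleared_series_generic[of x, OF xu] by (simp add: c_def Q_def U_def)
    have "L * inverse U = fps_const c * Q k - fps_const (x (Jet k 0))"
    proof -
      have "L * inverse U = fps_const c * Q k + fps_const (- x (Jet k 0)) * (U * inverse U)"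
        by (simp add: L_def Q_def algebra_simps)
      thus ?thesis by (simp add: UU fps_const_neg[symmetric] del: fps_const_neg)
    qed
    moreover have "fps_nth (cleared_series x u k) 0 = x (Jet k 0)"
      by (simp add: cleared_series_def dilate_nth jet_series_nth cleared_denominator_def)
    ultimately have TL: "T x = dilate c (L * inverse U)"
      by (simp add: T_def cs dilate_diff dilate_mult dilate_const)
    have GQ: "G x = dilate c (fps_X ^ l * (fps_const (c ^ n) * (\<Prod>i\<le>n+1. Q i ^ \<beta> i)))"
    proof -
      have "(\<Prod>i\<le>n+1. cleared_series x u i ^ \<beta> i) = fps_const (c ^ n) * (\<Prod>i\<le>n+1. dilate c (Q i) ^ \<beta> i)"
      proof -
        have "(\<Prod>i\<le>n+1. fps_const c ^ \<beta> i) = fps_const c ^ n" by (metis power_sum sumb)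
        thus ?thesis unfolding cs by (simp only: power_mult_distrib prod.distrib fps_const_power)
      qed
      thus ?thesis
        unfolding G_def dilate_mult dilate_power dilate_X dilate_prod dilate_const c_def[symmetric]
        by (simp only: power_mult_distrib fps_const_power mult.assoc)
    qed
    have "dilate c (fps_const (bend u k x ^ ((n + 1) * n div 2)) * (fps_X ^ l * (fps_const (c ^ n) * (\<Prod>i\<le>n+1. Q i ^ \<beta> i)))) =
        dilate c (\<Sum>j\<le>n. fps_const (q j x) * (L * inverse U) ^ j) + R x"
    proof -
      have "{..<n + 1} = {..n}" by auto
      thus ?thesis
        using eq[of x, unfolded T1] unfolding TL GQ dilate_sum dilate_mult dilate_power dilate_const by simp
    qed
    hence cc: "fps_nth (dilate c (fps_const (bend u k x ^ ((n + 1) * n div 2)) * (fps_X ^ l * (fps_const (c ^ n) * (\<Prod>i\<le>n+1. Q i ^ \<beta> i))))) i =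
        fps_nth (dilate c (\<Sum>j\<le>n. fps_const (q j x) * (L * inverse U) ^ j)) i" if "i \<le> n" for i
      using R0[of i x] that by (simp only: fps_add_nth) simp
    have "fps_nth (fps_const (bend u k x ^ ((n + 1) * n div 2)) * (fps_X ^ l * (fps_const (c ^ n) * (\<Prod>i\<le>n+1. Q i ^ \<beta> i)))) i =
        fps_nth (\<Sum>j\<le>n. fps_const (q j x) * (L * inverse U) ^ j) i" if "i \<le> n" for i
      using cc[OF that] c0 unfolding dilate_nth by simp
    hence ag: "agree n (U ^ n * (fps_const (bend u k x ^ ((n + 1) * n div 2)) * (fps_X ^ l * (fps_const (c ^ n) * (\<Prod>i\<le>n+1. Q i ^ \<beta> i)))))
        (U ^ n * (\<Sum>j\<le>n. fps_const (q j x) * (L * inverse U) ^ j))"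
      by (intro agree_mult agree_refl) (simp add: agree_def)
    have "U ^ n * (\<Prod>i\<le>n+1. Q i ^ \<beta> i) = series_monomial n (jet_series x) \<beta>"
    proof -
      have "U ^ n = (\<Prod>i\<le>n+1. U ^ \<beta> i)" by (metis power_sum sumb)
      hence "U ^ n * (\<Prod>i\<le>n+1. Q i ^ \<beta> i) = (\<Prod>i\<le>n+1. (U * Q i) ^ \<beta> i)"
        by (simp only: prod.distrib power_mult_distrib)
      moreover have "U * Q i = jet_series x i" for i
        unfolding Q_def using UU by (metis mult.left_commute mult.right_neutral)
      ultimately show ?thesis by (simp only: series_monomial_def)
    qed
    moreover have "U ^ n * (B * (X * (C * P))) = (B * C) * X * (U ^ n * P)" for B X C P :: "complex fps"
      by (simp only: mult_ac)
    ultimately have lhs: "U ^ n * (fps_const (bend u k x ^ ((n + 1) * n div 2)) * (fps_X ^ l * (fps_const (c ^ n) * (\<Prod>i\<le>n+1. Q i ^ \<beta> i)))) =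
        fps_const (bend_factor n u k x) * fps_X ^ l * series_monomial n (jet_series x) \<beta>"
      unfolding bend_factor_def c_def[symmetric] fps_const_mult[symmetric] by (simp only:)
    have Lj: "U ^ n * (L * inverse U) ^ j = L ^ j * U ^ (n - j)" if "j \<le> n" for j
    proof -
      have "U ^ n = U ^ (n - j) * U ^ j" using that by (simp add: power_add[symmetric])
      hence "U ^ n * (L * inverse U) ^ j = U ^ (n - j) * (U * (L * inverse U)) ^ j"
        by (simp only: power_mult_distrib mult.assoc)
      also have "U * (L * inverse U) = L" using UU by (metis mult.left_commute mult.right_neutral)
      finally show ?thesis by (simp add: mult.commute)
    qed
    have "U ^ n * (\<Sum>j\<le>n. fps_const (q j x) * (L * inverse U) ^ j) =
        (\<Sum>j\<le>n. fps_const (q j x) * (L ^ j * U ^ (n - j)))"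
      unfolding sum_distrib_left
    proof (intro sum.cong refl)
      fix j assume "j \<in> {..n}"
      hence j: "j \<le> n" by simp
      show "U ^ n * (fps_const (q j x) * (L * inverse U) ^ j) = fps_const (q j x) * (L ^ j * U ^ (n - j))"
        unfolding Lj[OF j, symmetric] by (rule mult.left_commute)
    qed
    also have "\<dots> = (\<Sum>j\<le>n. \<Sum>i\<le>n. fps_const (of_nat (j choose i) * (c ^ i * (- x (Jet k 0)) ^ (j - i)) * q j x) *
        (jet_series x k ^ i * U ^ (n - i)))"
    proof (intro sum.cong refl)
      fix j assume "j \<in> {..n}"
      hence j: "j \<le> n" by simp
      have "L ^ j = (\<Sum>i\<le>j. of_nat (j choose i) * (fps_const c * jet_series x k) ^ i * (fps_const (- x (Jet k 0)) * U) ^ (j - i))"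
        unfolding L_def by (rule binomial_ring)
      hence "fps_const (q j x) * (L ^ j * U ^ (n - j)) = (\<Sum>i\<le>j. fps_const (q j x) *
          (of_nat (j choose i) * (fps_const c * jet_series x k) ^ i * (fps_const (- x (Jet k 0)) * U) ^ (j - i) * U ^ (n - j)))"
        by (simp only: sum_distrib_left sum_distrib_right)
      also have "\<dots> = (\<Sum>i\<le>j. fps_const (of_nat (j choose i) * (c ^ i * (- x (Jet k 0)) ^ (j - i)) * q j x) *
          (jet_series x k ^ i * U ^ (n - i)))"
      proof (intro sum.cong refl)
        fix i assume "i \<in> {..j}"
        hence "U ^ (n - i) = U ^ (j - i) * U ^ (n - j)" using j by (simp add: power_add[symmetric])
        thus "fps_const (q j x) * (of_nat (j choose i) * (fps_const c * jet_series x k) ^ i *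
              (fps_const (- x (Jet k 0)) * U) ^ (j - i) * U ^ (n - j)) =
            fps_const (of_nat (j choose i) * (c ^ i * (- x (Jet k 0)) ^ (j - i)) * q j x) * (jet_series x k ^ i * U ^ (n - i))"
          by (simp only: power_mult_distrib fps_of_nat[symmetric] fps_const_power fps_const_mult[symmetric] mult_ac)
      qed
      also have "\<dots> = (\<Sum>i\<le>n. fps_const (of_nat (j choose i) * (c ^ i * (- x (Jet k 0)) ^ (j - i)) * q j x) *
          (jet_series x k ^ i * U ^ (n - i)))"
        by (rule sum.mono_neutral_left) (use j in auto)
      finally show "fps_const (q j x) * (L ^ j * U ^ (n - j)) = \<dots>" .
    qed
    also have "\<dots> = (\<Sum>i\<le>n. \<Sum>j\<le>n. fps_const (of_nat (j choose i) * (c ^ i * (- x (Jet k 0)) ^ (j - i)) * q j x) *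
        (jet_series x k ^ i * U ^ (n - i)))" by (rule sum.swap)
    also have "\<dots> = (\<Sum>i\<le>n. fps_const (w i x) * (jet_series x k ^ i * U ^ (n - i)))"
    proof (intro sum.cong refl)
      fix i
      have "fps_const (w i x) = (\<Sum>j\<le>n. fps_const (of_nat (j choose i) * (c ^ i * (- x (Jet k 0)) ^ (j - i)) * q j x))"
        unfolding w_def c_def by (rule fps_ext) (simp add: fps_sum_nth)
      thus "(\<Sum>j\<le>n. fps_const (of_nat (j choose i) * (c ^ i * (- x (Jet k 0)) ^ (j - i)) * q j x) *
          (jet_series x k ^ i * U ^ (n - i))) = fps_const (w i x) * (jet_series x k ^ i * U ^ (n - i))"
        by (simp only: sum_distrib_right)
    qed
    finally have rhs: "U ^ n * (\<Sum>j\<le>n. fps_const (q j x) * (L * inverse U) ^ j) =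
        (\<Sum>i\<le>n. fps_const (w i x) * (jet_series x k ^ i * U ^ (n - i)))" .
    show ?thesis using agree_nth[OF ag m, unfolded lhs rhs] unfolding D_def U_def by simp
  qed
  have pD: "poly_series D"
    unfolding D_def series_monomial_def
    by (intro poly_series_diff poly_series_sum poly_series_mult poly_series_prod poly_series_power
        poly_series_const poly_series_jet poly_series_fixed weighted_poly[OF ww] weighted_poly[OF weighted_bend_factor[OF n u k]])
  have "fps_nth (D x) m = 0" if m: "m \<le> n" for x m
    by (rule poly_zero_by_perturbation[OF poly_series_nth[OF pD]]) (rule generic[OF _ m])
  hence "agree n (\<Sum>i\<le>n. fps_const (w i x) * (jet_series x k ^ i * jet_series x u ^ (n - i)))
       (fps_const (bend_factor n u k x) * fps_X ^ l * series_monomial n (jet_series x) \<beta>)" for x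
    by (simp add: agree_def D_def)
  thus ?thesis using ww by blast
qed


section \<open>Linearised equations\<close>

definition series_deriv :: "(complex \<Rightarrow> complex fps) \<Rightarrow> complex fps \<Rightarrow> complex \<Rightarrow> bool" where
  "series_deriv F F' s0 \<longleftrightarrow>
     (\<forall>m. ((\<lambda>s. fps_nth (F s) m) has_field_derivative fps_nth F' m) (at s0))"

lemma series_deriv_nth:
  "series_deriv F F' s0 \<Longrightarrow> ((\<lambda>s. fps_nth (F s) m) has_field_derivative fps_nth F' m) (at s0)"
  by (simp add: series_deriv_def)

lemma series_deriv_unique: "series_deriv F F' s0 \<Longrightarrow> series_deriv F F'' s0 \<Longrightarrow> F' = F''"
  by (rule fps_ext) (meson DERIV_unique series_deriv_nth)

lemma series_deriv_fixed: "series_deriv (\<lambda>_. F) 0 s0"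
  by (simp add: series_deriv_def)

lemma series_deriv_const:
  assumes "(f has_field_derivative f') (at s0)"
  shows "series_deriv (\<lambda>s. fps_const (f s)) (fps_const f') s0"
  unfolding series_deriv_def
proof
  fix m show "((\<lambda>s. fps_nth (fps_const (f s)) m) has_field_derivative fps_nth (fps_const f') m) (at s0)"
    using assms by (cases m) simp_all
qed

lemma series_deriv_add:
  "series_deriv F F' s0 \<Longrightarrow> series_deriv G G' s0 \<Longrightarrow> series_deriv (\<lambda>s. F s + G s) (F' + G') s0"
  unfolding series_deriv_def fps_add_nth by (auto intro: DERIV_add)

lemma series_deriv_mult:
  assumes "series_deriv F F' s0" "series_deriv G G' s0"
  shows "series_deriv (\<lambda>s. F s * G s) (F' * G s0 + F s0 * G') s0"
  unfolding series_deriv_def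
proof
  fix m
  have "((\<lambda>s. \<Sum>i=0..m. fps_nth (F s) i * fps_nth (G s) (m - i)) has_field_derivative
     (\<Sum>i=0..m. fps_nth F' i * fps_nth (G s0) (m - i) + fps_nth G' (m - i) * fps_nth (F s0) i)) (at s0)"
    by (intro DERIV_sum DERIV_mult series_deriv_nth assms)
  thus "((\<lambda>s. fps_nth (F s * G s) m) has_field_derivative fps_nth (F' * G s0 + F s0 * G') m) (at s0)"
    by (simp add: fps_mult_nth sum.distrib mult.commute[of "fps_nth G' _"])
qed

lemma series_deriv_power:
  assumes "series_deriv F F' s0"
  shows "series_deriv (\<lambda>s. F s ^ r) (of_nat r * F' * F s0 ^ (r - 1)) s0"
proof (induction r)
  case 0
  show ?case using series_deriv_fixed[of 1] by simp
next
  case (Suc r)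
  have "F s0 * F s0 ^ (r - Suc 0) = F s0 ^ r" if "r > 0" using that by (metis Suc_pred power_Suc)
  hence "F' * F s0 ^ r + F s0 * (of_nat r * F' * F s0 ^ (r - 1)) = of_nat (Suc r) * F' * F s0 ^ (Suc r - 1)"
    by (cases "r = 0") (simp_all add: algebra_simps)
  thus ?case using series_deriv_mult[OF assms Suc.IH] by simp
qed

lemma series_deriv_sum:
  "(\<And>i. i \<in> I \<Longrightarrow> series_deriv (F i) (F' i) s0) \<Longrightarrow> series_deriv (\<lambda>s. \<Sum>i\<in>I. F i s) (\<Sum>i\<in>I. F' i) s0"
  by (induction I rule: infinite_finite_induct) (auto intro: series_deriv_add series_deriv_fixed)

lemma series_deriv_prod:
  "finite I \<Longrightarrow> (\<And>i. i \<in> I \<Longrightarrow> series_deriv (F i) (F' i) s0) \<Longrightarrow>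
    series_deriv (\<lambda>s. \<Prod>i\<in>I. F i s) (\<Sum>i\<in>I. F' i * (\<Prod>j\<in>I - {i}. F j s0)) s0"
proof (induction I rule: finite_induct)
  case empty
  show ?case using series_deriv_fixed[of 1] by simp
next
  case (insert a I)
  have "series_deriv (\<lambda>s. F a s * (\<Prod>i\<in>I. F i s))
      (F' a * (\<Prod>i\<in>I. F i s0) + F a s0 * (\<Sum>i\<in>I. F' i * (\<Prod>j\<in>I - {i}. F j s0))) s0"
    using insert by (intro series_deriv_mult) auto
  moreover have "F a s0 * (\<Sum>i\<in>I. F' i * (\<Prod>j\<in>I - {i}. F j s0)) = (\<Sum>i\<in>I. F' i * (\<Prod>j\<in>insert a I - {i}. F j s0))"
    unfolding sum_distrib_left
  proof (intro sum.cong refl)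
    fix i assume i: "i \<in> I"
    hence "insert a I - {i} = insert a (I - {i})" using insert.hyps by auto
    moreover have "a \<notin> I - {i}" "finite (I - {i})" using insert.hyps by auto
    ultimately show "F a s0 * (F' i * (\<Prod>j\<in>I - {i}. F j s0)) = F' i * (\<Prod>j\<in>insert a I - {i}. F j s0)"
      by (simp add: mult.left_commute)
  qed
  moreover have "insert a I - {a} = I" using insert.hyps by auto
  ultimately show ?case using insert.hyps by simp
qed

text \<open>
  The derivative of the equation when the lifted disc moves in the direction \<open>\<eta>\<close>.
\<close>

definition form_variation ::
    "nat \<Rightarrow> nat \<Rightarrow> ((nat \<Rightarrow> nat) \<Rightarrow> complex) \<Rightarrow> (nat \<Rightarrow> complex fps) \<Rightarrow> (nat \<Rightarrow> complex fps) \<Rightarrow> complex fps" where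
  "form_variation n d A \<zeta> \<eta> = (\<Sum>\<alpha>\<in>mindices (n+1) d. fps_const (A \<alpha>) *
     (\<Sum>i\<le>n+1. of_nat (\<alpha> i) * \<eta> i * \<zeta> i ^ (\<alpha> i - 1) * (\<Prod>j\<in>{..n+1} - {i}. \<zeta> j ^ \<alpha> j)))"

lemma series_deriv_form:
  assumes A: "\<And>\<alpha>. ((\<lambda>s. A s \<alpha>) has_field_derivative A' \<alpha>) (at s0)"
    and \<zeta>: "\<And>k. series_deriv (\<lambda>s. \<zeta> s k) (\<eta> k) s0"
  shows "series_deriv (\<lambda>s. form_series n d (A s) (\<zeta> s))
    (form_series n d A' (\<zeta> s0) + form_variation n d (A s0) (\<zeta> s0) \<eta>) s0"
proof -
  have "series_deriv (\<lambda>s. form_series n d (A s) (\<zeta> s))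
    (\<Sum>\<alpha>\<in>mindices (n+1) d. fps_const (A' \<alpha>) * (\<Prod>i\<le>n+1. \<zeta> s0 i ^ \<alpha> i) + fps_const (A s0 \<alpha>) *
     (\<Sum>i\<le>n+1. (of_nat (\<alpha> i) * \<eta> i * \<zeta> s0 i ^ (\<alpha> i - 1)) * (\<Prod>j\<in>{..n+1} - {i}. \<zeta> s0 j ^ \<alpha> j))) s0"
    unfolding form_series_def
    by (intro series_deriv_sum series_deriv_mult series_deriv_const A series_deriv_prod series_deriv_power \<zeta>) simp
  thus ?thesis by (simp only: form_series_def form_variation_def sum.distrib)
qed

lemma form_variation_agree:
  assumes "\<And>k. k \<le> n + 1 \<Longrightarrow> agree m (\<eta> k) (\<xi> k)"
  shows "agree m (form_variation n d A \<zeta> \<eta>) (form_variation n d A \<zeta> \<xi>)"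
  unfolding form_variation_def
  by (intro agree_sum agree_mult agree_refl assms) simp

lemma form_variation_diff:
  "form_variation n d A \<zeta> (\<lambda>k. \<eta> k - \<xi> k) = form_variation n d A \<zeta> \<eta> - form_variation n d A \<zeta> \<xi>"
  unfolding form_variation_def
  by (simp only: right_diff_distrib left_diff_distrib sum_subtractf)

text \<open>
  Euler's identity: moving the lift by an infinitesimal rescaling multiplies the equation by a series,
  so it preserves the conditions.
\<close>

lemma form_variation_euler:
  "form_variation n d A \<zeta> (\<lambda>k. \<zeta> k * g) = of_nat d * g * form_series n d A \<zeta>"
proof -
  have key: "(\<Sum>i\<le>n+1. of_nat (\<alpha> i) * (\<zeta> i * g) * \<zeta> i ^ (\<alpha> i - 1) * (\<Prod>j\<in>{..n+1} - {i}. \<zeta> j ^ \<alpha> j)) =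
      of_nat d * g * (\<Prod>j\<le>n+1. \<zeta> j ^ \<alpha> j)" if "\<alpha> \<in> mindices (n+1) d" for \<alpha>
  proof -
    have "of_nat (\<alpha> i) * (\<zeta> i * g) * \<zeta> i ^ (\<alpha> i - 1) * (\<Prod>j\<in>{..n+1} - {i}. \<zeta> j ^ \<alpha> j) =
        of_nat (\<alpha> i) * (g * (\<Prod>j\<le>n+1. \<zeta> j ^ \<alpha> j))" if i: "i \<in> {..n+1}" for i
    proof (cases "\<alpha> i = 0")
      case False
      have "\<zeta> i * \<zeta> i ^ (\<alpha> i - 1) = \<zeta> i ^ \<alpha> i" using False by (metis Suc_pred' gr0I power_Suc)
      moreover have "(\<Prod>j\<le>n+1. \<zeta> j ^ \<alpha> j) = \<zeta> i ^ \<alpha> i * (\<Prod>j\<in>{..n+1} - {i}. \<zeta> j ^ \<alpha> j)"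
        using i by (intro prod.remove) auto
      moreover have "of_nat (\<alpha> i) * (a * g) * b * c = of_nat (\<alpha> i) * (g * ((a * b) * c))" for a b c :: "complex fps"
        by (simp only: mult_ac)
      ultimately show ?thesis by (simp only:)
    qed simp
    hence "(\<Sum>i\<le>n+1. of_nat (\<alpha> i) * (\<zeta> i * g) * \<zeta> i ^ (\<alpha> i - 1) * (\<Prod>j\<in>{..n+1} - {i}. \<zeta> j ^ \<alpha> j)) =
        (\<Sum>i\<le>n+1. of_nat (\<alpha> i) * (g * (\<Prod>j\<le>n+1. \<zeta> j ^ \<alpha> j)))"
      by (intro sum.cong refl)
    also have "\<dots> = of_nat (\<Sum>i\<le>n+1. \<alpha> i) * (g * (\<Prod>j\<le>n+1. \<zeta> j ^ \<alpha> j))"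
      by (simp only: sum_distrib_right of_nat_sum)
    also have "(\<Sum>i\<le>n+1. \<alpha> i) = d" using that by (simp add: mindices_def)
    finally show ?thesis by (simp only: mult.assoc)
  qed
  show ?thesis
    unfolding form_variation_def form_series_def
    by (subst sum_distrib_left[of "of_nat d * g"]) (intro sum.cong refl, simp only: key, rule mult.left_commute)
qed

definition linearised :: "nat \<Rightarrow> nat \<Rightarrow> (coord \<Rightarrow> complex) \<Rightarrow> (coord \<Rightarrow> complex) \<Rightarrow> complex fps" where
  "linearised n d x v = form_series n d (coefs v) (jet_series x) +
     form_variation n d (coefs x) (jet_series x) (jet_series v)"

definition equation :: "nat \<Rightarrow> nat \<Rightarrow> nat \<Rightarrow> (coord \<Rightarrow> complex) \<Rightarrow> complex" where
  "equation n d m x = fps_nth (form_series n d (coefs x) (jet_series x)) m"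

lemma poly_equation: "equation n d m \<in> poly_funs"
proof -
  have "(\<lambda>x. fps_nth (form_series n d (coefs x) (jet_series x)) m) \<in> poly_funs"
    by (intro poly_series_nth poly_series_form poly_coefs poly_series_jet)
  moreover have "equation n d m = (\<lambda>x. fps_nth (form_series n d (coefs x) (jet_series x)) m)"
    by (rule ext) (rule equation_def)
  ultimately show ?thesis by simp
qed

lemma in_cone_equation: "in_cone n d x \<longleftrightarrow> (\<forall>m\<le>n. equation n d m x = 0)"
  by (simp add: in_cone_def agree_def equation_def)

lemma line_deriv: "((\<lambda>s. x i + s * v i) has_field_derivative v i) (at (s0 :: complex))"
  by (auto intro!: derivative_eq_intros)

lemma equation_line_deriv:
  "((\<lambda>s. equation n d m (\<lambda>i. x i + s * v i)) has_field_derivative fps_nth (linearised n d x v) m) (at 0)"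
proof -
  have "series_deriv (\<lambda>s. jet_series (\<lambda>i. x i + s * v i) k) (jet_series v k) 0" for k
    unfolding series_deriv_def jet_series_nth by (intro allI DERIV_cdivide line_deriv)
  moreover have "((\<lambda>s. coefs (\<lambda>i. x i + s * v i) \<alpha>) has_field_derivative coefs v \<alpha>) (at 0)" for \<alpha>
    unfolding coefs_def by (rule line_deriv)
  ultimately have "series_deriv (\<lambda>s. form_series n d (coefs (\<lambda>i. x i + s * v i)) (jet_series (\<lambda>i. x i + s * v i)))
    (form_series n d (coefs v) (jet_series (\<lambda>i. x i + 0 * v i)) +
     form_variation n d (coefs (\<lambda>i. x i + 0 * v i)) (jet_series (\<lambda>i. x i + 0 * v i)) (jet_series v)) 0"
    by (rule series_deriv_form[rotated])
  from series_deriv_nth[OF this] show ?thesis by (simp add: equation_def linearised_def)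
qed

lemma vec_apply_equation:
  assumes "v \<in> chart_vecs n d c"
  shows "vec_apply n d c v x (equation n d m) = fps_nth (linearised n d x v) m"
proof -
  have "((\<lambda>s. equation n d m (\<lambda>i. x i + s * v i)) has_field_derivative
      vec_apply n d c v (\<lambda>i. x i + 0 * v i) (equation n d m)) (at 0)"
    by (rule vec_apply_curve[OF poly_equation assms]) (rule line_deriv)
  from DERIV_unique[OF this equation_line_deriv] show ?thesis by simp
qed


section \<open>Tangent spaces\<close>

text \<open>
  Only the factor of degree \<open>n\<close> is rewritten, so that the weight does not depend on \<open>d\<close>.
\<close>

lemma monomial_time_shift:
  assumes n: "n \<ge> 1" and u: "u \<le> n + 1" and k: "k \<le> n + 1" and \<beta>: "\<beta> \<in> mindices (n+1) n"
    and \<gamma>: "\<gamma> \<in> mindices (n+1) r" and d: "n + r = d"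
  shows "\<exists>V w. (\<forall>\<alpha>. weighted n (n\<^sup>2 + 2 * n) 0 (\<lambda>x. V x \<alpha>)) \<and>
    (\<forall>x \<alpha>. \<alpha> \<notin> mindices (n+1) d \<longrightarrow> V x \<alpha> = 0) \<and>
    (\<forall>x. V x = (\<lambda>\<alpha>. \<Sum>i\<le>n. w i x * monomial (\<lambda>m. \<gamma> m + binary_index k i u (n - i) m) \<alpha>)) \<and>
    (\<forall>x. agree n (form_series n d (V x) (jet_series x))
       (fps_const (bend_factor n u k x) * fps_X ^ l * series_monomial n (jet_series x) (\<lambda>i. \<beta> i + \<gamma> i)))"
proof -
  obtain w where w: "\<And>i. i \<le> n \<Longrightarrow> weighted n (n\<^sup>2 + 2 * n) 0 (w i)"
    and ag: "\<And>x. agree n (\<Sum>i\<le>n. fps_const (w i x) * (jet_series x k ^ i * jet_series x u ^ (n - i)))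
       (fps_const (bend_factor n u k x) * fps_X ^ l * series_monomial n (jet_series x) \<beta>)"
    using weighted_time_shift[OF n u k \<beta>, of l] by blast
  define V where "V x = (\<lambda>\<alpha>. \<Sum>i\<le>n. w i x * monomial (\<lambda>m. \<gamma> m + binary_index k i u (n - i) m) \<alpha>)" for x
  have idx: "(\<lambda>m. \<gamma> m + binary_index k i u (n - i) m) \<in> mindices (n+1) d" if "i \<le> n" for i
  proof -
    have "binary_index k i u (n - i) \<in> mindices (n+1) n" using k u that by (intro binary_index_mindices) auto
    from mindices_add[OF \<gamma> this] show ?thesis using d by (simp add: add.commute)
  qed
  have "weighted n (n\<^sup>2 + 2 * n) 0 (\<lambda>x. V x \<alpha>)" for \<alpha>
  proof -
    have "weighted n (n\<^sup>2 + 2 * n) 0 (\<lambda>x. monomial (\<lambda>m. \<gamma> m + binary_index k i u (n - i) m) \<alpha> * w i x)" if "i \<in> {..n}" for i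
      using that by (intro weighted_cmult w) simp
    hence "weighted n (n\<^sup>2 + 2 * n) 0 (\<lambda>x. \<Sum>i\<le>n. monomial (\<lambda>m. \<gamma> m + binary_index k i u (n - i) m) \<alpha> * w i x)"
      by (rule weighted_sum)
    thus ?thesis unfolding V_def by (simp only: mult.commute)
  qed
  moreover have "V x \<alpha> = 0" if "\<alpha> \<notin> mindices (n+1) d" for x \<alpha>
    unfolding V_def
  proof (rule sum.neutral, rule ballI)
    fix i assume "i \<in> {..n}"
    hence "\<alpha> \<noteq> (\<lambda>m. \<gamma> m + binary_index k i u (n - i) m)" using idx[of i] that by auto
    thus "w i x * monomial (\<lambda>m. \<gamma> m + binary_index k i u (n - i) m) \<alpha> = 0" by (simp add: monomial_def)
  qed
  moreover have "agree n (form_series n d (V x) (jet_series x))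
       (fps_const (bend_factor n u k x) * fps_X ^ l * series_monomial n (jet_series x) (\<lambda>i. \<beta> i + \<gamma> i))" for x
  proof -
    have "form_series n d (V x) (jet_series x) =
        (\<Sum>i\<le>n. fps_const (w i x) * form_series n d (monomial (\<lambda>m. \<gamma> m + binary_index k i u (n - i) m)) (jet_series x))"
      unfolding V_def by (rule form_series_sum) simp
    also have "\<dots> = (\<Sum>i\<le>n. fps_const (w i x) * (series_monomial n (jet_series x) \<gamma> *
        (jet_series x k ^ i * jet_series x u ^ (n - i))))"
      by (intro sum.cong refl)
         (simp only: form_series_monomial[OF idx] atMost_iff series_monomial_add series_monomial_binary_index[OF k u])
    also have "\<dots> = series_monomial n (jet_series x) \<gamma> *
        (\<Sum>i\<le>n. fps_const (w i x) * (jet_series x k ^ i * jet_series x u ^ (n - i)))"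
      by (simp only: sum_distrib_left mult.left_commute)
    also have "agree n \<dots> (series_monomial n (jet_series x) \<gamma> *
        (fps_const (bend_factor n u k x) * fps_X ^ l * series_monomial n (jet_series x) \<beta>))"
      by (intro agree_mult agree_refl ag)
    also have "\<dots> = fps_const (bend_factor n u k x) * fps_X ^ l * series_monomial n (jet_series x) (\<lambda>i. \<beta> i + \<gamma> i)"
      unfolding series_monomial_add by (simp only: mult_ac)
    finally show ?thesis .
  qed
  moreover have "\<forall>x. V x = (\<lambda>\<alpha>. \<Sum>i\<le>n. w i x * monomial (\<lambda>m. \<gamma> m + binary_index k i u (n - i) m) \<alpha>)"
    by (simp add: V_def)
  ultimately show ?thesis by blast
qed

lemma mindices_split:
  assumes "\<alpha> \<in> mindices m d" "r \<le> d"
  shows "\<exists>\<beta> \<gamma>. \<beta> \<in> mindices m r \<and> \<gamma> \<in> mindices m (d - r) \<and> (\<forall>i. \<alpha> i = \<beta> i + \<gamma> i)"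
  using assms
proof (induction r)
  case 0
  thus ?case by (intro exI[of _ "\<lambda>_. 0"] exI[of _ \<alpha>]) (simp add: mindices_def)
next
  case (Suc r)
  then obtain \<beta> \<gamma> where H: "\<beta> \<in> mindices m r" "\<gamma> \<in> mindices m (d - r)" "\<And>i. \<alpha> i = \<beta> i + \<gamma> i"
    using Suc.IH[OF Suc.prems(1)] by auto
  have "(\<Sum>i\<le>m. \<gamma> i) \<noteq> 0" using H(2) Suc.prems by (simp add: mindices_def)
  then obtain j where j: "j \<le> m" "\<gamma> j \<noteq> 0" by (meson atMost_iff sum.neutral)
  define \<gamma>' where "\<gamma>' = \<gamma>(j := \<gamma> j - 1)"
  have eq: "\<gamma> i = power_index j 1 i + \<gamma>' i" for i using j by (simp add: \<gamma>'_def power_index_def)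
  have "(\<lambda>i. \<beta> i + power_index j 1 i) \<in> mindices m (r + 1)"
    by (rule mindices_add[OF H(1) power_index_mindices[OF j(1)]])
  moreover have "\<gamma>' \<in> mindices m (d - Suc r)"
  proof -
    have "(\<Sum>i\<le>m. \<gamma> i) = (\<Sum>i\<le>m. power_index j 1 i) + (\<Sum>i\<le>m. \<gamma>' i)"
      by (simp only: eq sum.distrib)
    moreover have "(\<Sum>i\<le>m. power_index j 1 i) = 1"
      using power_index_mindices[OF j(1), of 1] by (simp add: mindices_def)
    moreover have "(\<Sum>i\<le>m. \<gamma> i) = d - r" using H(2) by (simp add: mindices_def)
    ultimately have "(\<Sum>i\<le>m. \<gamma>' i) = d - Suc r" by arith
    moreover have "\<forall>i>m. \<gamma>' i = 0" using H(2) j by (simp add: mindices_def \<gamma>'_def)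
    ultimately show ?thesis by (simp add: mindices_def)
  qed
  ultimately show ?case using H(3) eq by (intro exI[of _ "\<lambda>i. \<beta> i + power_index j 1 i"] exI[of _ \<gamma>']) simp
qed

lemma form_time_shift:
  assumes n: "n \<ge> 1" and d: "d > n" and u: "u \<le> n + 1" and k: "k \<le> n + 1" and \<alpha>: "\<alpha> \<in> mindices (n+1) d"
  shows "\<exists>V. (\<forall>\<alpha>'. weighted n (n\<^sup>2 + 2 * n) 0 (\<lambda>x. V x \<alpha>')) \<and>
    (\<forall>x \<alpha>'. \<alpha>' \<notin> mindices (n+1) d \<longrightarrow> V x \<alpha>' = 0) \<and>
    (\<forall>x. agree n (form_series n d (V x) (jet_series x))
       (fps_const (bend_factor n u k x) * fps_X ^ l * series_monomial n (jet_series x) \<alpha>))"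
proof -
  obtain \<beta> \<gamma> where H: "\<beta> \<in> mindices (n+1) n" "\<gamma> \<in> mindices (n+1) (d - n)" "\<And>i. \<alpha> i = \<beta> i + \<gamma> i"
    using mindices_split[OF \<alpha>, of n] d by auto
  have "\<alpha> = (\<lambda>i. \<beta> i + \<gamma> i)" using H(3) by (rule ext)
  thus ?thesis using monomial_time_shift[OF n u k H(1,2), of d l] d by auto
qed

lemma tangent_space_linearised:
  assumes v: "v \<in> tangent_space n d c p" and c: "c \<in> charts n d"
  shows "agree n (linearised n d (chart_map n d c p) v) 0"
proof -
  obtain u b where ub: "c = (u, b)" by (cases c)
  have vv: "v \<in> chart_vecs n d c" using v by (simp add: tangent_space_def)
  have "fps_nth (linearised n d (chart_map n d c p) v) m = 0" if "m \<le> n" for m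
  proof -
    have "\<forall>x\<in>Jvert_chart n d c. equation n d m x = 0"
      using Jvert_chart_iff[OF c[unfolded ub]] that unfolding ub in_cone_equation by blast
    hence "vec_apply n d c v (chart_map n d c p) (equation n d m) = 0"
      using v poly_equation unfolding tangent_space_def by blast
    thus ?thesis unfolding vec_apply_equation[OF vv] .
  qed
  thus ?thesis by (simp add: agree_def)
qed

lemma chart_vecsD:
  assumes "v \<in> chart_vecs n d (u, b)"
  shows "v (Jet u l) = 0" "v (Coef b) = 0" "\<alpha> \<notin> mindices (n+1) d \<Longrightarrow> v (Coef \<alpha>) = 0" "k > n + 1 \<or> l > n \<Longrightarrow> v (Jet k l) = 0"
  using assms by (auto simp: chart_vecs_def free_coords_def)

text \<open>
  The equations are linear in the form, so a straight line consists of solutions.  This applies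
  to singular points as well.
\<close>

lemma tangent_vertical:
  assumes c: "(u, b) \<in> charts n d" and p: "p \<in> Jvert n d \<inter> chart_dom n d (u, b)"
    and v: "v \<in> chart_vecs n d (u, b)" and vj: "\<And>k l. v (Jet k l) = 0"
    and lin: "agree n (linearised n d (chart_map n d (u, b) p) v) 0"
  shows "v \<in> tangent_space n d (u, b) p"
proof -
  define x where "x = chart_map n d (u, b) p"
  have xs: "x \<in> chart_space n d (u, b)" using chart_map_in_space[OF c] p by (simp add: x_def)
  have xc: "in_cone n d x" using Jvert_iff[OF c, of p] p unfolding x_def by blast
  show ?thesis
  proof (rule tangent_spaceI[OF v])
    show "((\<lambda>s. x i + s * v i) has_field_derivative v i) (at 0)" for i by (rule line_deriv)
    show "(\<lambda>i. x i + 0 * v i) = chart_map n d (u, b) p" by (simp add: x_def)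
    have "(\<lambda>i. x i + s * v i) \<in> Jvert_chart n d (u, b)" for s
    proof -
      have cs: "(\<lambda>i. x i + s * v i) \<in> chart_space n d (u, b)"
        using xs v chart_vecsD(1,2)[OF v] by (auto simp: chart_space_def chart_vecs_def)
      have j: "jet_series (\<lambda>i. x i + s * v i) = jet_series x"
        by (rule ext) (simp add: jet_series_def vj)
      have "jet_series v = (\<lambda>k. 0)" by (rule ext, rule fps_ext) (simp add: jet_series_nth vj)
      hence "linearised n d x v = form_series n d (coefs v) (jet_series x)"
        by (simp add: linearised_def form_variation_def)
      hence fv: "agree n (form_series n d (coefs v) (jet_series x)) 0" using lin by (simp add: x_def)
      have "form_series n d (coefs (\<lambda>i. x i + s * v i)) (jet_series (\<lambda>i. x i + s * v i)) =
          form_series n d (coefs x) (jet_series x) + fps_const s * form_series n d (coefs v) (jet_series x)"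
        unfolding j form_series_linear[symmetric] by (intro form_series_cong refl) (simp add: coefs_def)
      also have "agree n \<dots> (0 + fps_const s * 0)"
        by (intro agree_add agree_mult agree_refl fv xc[unfolded in_cone_def])
      finally have "in_cone n d (\<lambda>i. x i + s * v i)" by (simp add: in_cone_def)
      thus ?thesis using Jvert_chart_iff[OF c] cs by blast
    qed
    thus "\<forall>\<^sub>F s in nhds 0. (\<lambda>i. x i + s * v i) \<in> Jvert_chart n d (u, b)" by simp
  qed
qed

lemma bend_factor_chart:
  assumes "x \<in> chart_space n d (u, b)"
  shows "bend_factor n u k x = x (Jet k 1) ^ ((n + 1) * n div 2)"
  using chart_spaceD(1,4)[OF assms] by (simp add: bend_factor_def bend_def)

text \<open>
  At a point where the disc moves, the straight line in the direction of a first-order solution is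
  corrected to a curve of solutions, by subtracting multiples of the forms whose values along the
  disc are the powers of the time.
\<close>

lemma tangent_moving:
  assumes n: "n \<ge> 1" and d: "d > n" and c: "(u, b) \<in> charts n d"
    and p: "p \<in> Jvert n d \<inter> chart_dom n d (u, b)"
    and k: "k \<le> n + 1" "chart_map n d (u, b) p (Jet k 1) \<noteq> 0"
    and v: "v \<in> chart_vecs n d (u, b)"
    and lin: "agree n (linearised n d (chart_map n d (u, b) p) v) 0"
  shows "v \<in> tangent_space n d (u, b) p"
proof -
  define x where "x = chart_map n d (u, b) p"
  have xs: "x \<in> chart_space n d (u, b)" using chart_map_in_space[OF c] p by (simp add: x_def)
  have xc: "in_cone n d x" using Jvert_iff[OF c, of p] p unfolding x_def by blast
  have u: "u \<le> n + 1" and b: "b \<in> mindices (n+1) d" using c by (auto simp: charts_def)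
  have "\<forall>l. \<exists>V. (\<forall>\<alpha>'. weighted n (n\<^sup>2 + 2 * n) 0 (\<lambda>x. V x \<alpha>')) \<and>
    (\<forall>x \<alpha>'. \<alpha>' \<notin> mindices (n+1) d \<longrightarrow> V x \<alpha>' = 0) \<and>
    (\<forall>x. agree n (form_series n d (V x) (jet_series x))
       (fps_const (bend_factor n u k x) * fps_X ^ l * series_monomial n (jet_series x) (power_index u d)))"
    using form_time_shift[OF n d u k(1) power_index_mindices[OF u]] by blast
  then obtain V where V: "\<forall>l. (\<forall>\<alpha>'. weighted n (n\<^sup>2 + 2 * n) 0 (\<lambda>x. V l x \<alpha>')) \<and>
    (\<forall>x \<alpha>'. \<alpha>' \<notin> mindices (n+1) d \<longrightarrow> V l x \<alpha>' = 0) \<and>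
    (\<forall>x. agree n (form_series n d (V l x) (jet_series x))
       (fps_const (bend_factor n u k x) * fps_X ^ l * series_monomial n (jet_series x) (power_index u d)))"
    unfolding choice_iff by (elim exE)
  define y where "y s = (\<lambda>i. x i + s * v i)" for s
  define \<phi> where "\<phi> s = bend_factor n u k (y s)" for s
  \<comment> \<open>The defect of the straight line is of second order, so removing it does not change the velocity.\<close>
  define A where "A s \<alpha> = y s (Coef \<alpha>) - (\<Sum>m\<le>n. equation n d m (y s) / \<phi> s * V m (y s) \<alpha>)" for s \<alpha>
  define z where "z s i = (case i of Jet k l \<Rightarrow> y s (Jet k l) | Coef \<alpha> \<Rightarrow> A s \<alpha>)" for s i
  have y0: "y 0 = x" by (simp add: y_def)
  have yd: "((\<lambda>s. y s i) has_field_derivative v i) (at 0)" for i unfolding y_def by (rule line_deriv)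
  have poly_diff_ex: "\<exists>D. ((\<lambda>s. f (y s)) has_field_derivative D) (at 0)" if "f \<in> poly_funs" for f
    using vec_apply_curve[OF that v yd] by blast
  have bf: "bend_factor n u k \<in> poly_funs" by (rule weighted_poly[OF weighted_bend_factor[OF n u k(1)]])
  have \<phi>0: "\<phi> 0 \<noteq> 0" unfolding \<phi>_def y0 bend_factor_chart[OF xs] using k(2) by (simp add: x_def)
  have E0: "equation n d m (y 0) = 0" if "m \<le> n" for m
    using xc that unfolding y0 in_cone_equation by blast
  have Ed: "((\<lambda>s. equation n d m (y s)) has_field_derivative 0) (at 0)" if "m \<le> n" for m
    using equation_line_deriv[of n d m x v] lin that unfolding y_def x_def by (simp add: agree_def)
  have Ad: "((\<lambda>s. A s \<alpha>) has_field_derivative v (Coef \<alpha>)) (at 0)" for \<alpha>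
  proof -
    have "((\<lambda>s. equation n d m (y s) / \<phi> s * V m (y s) \<alpha>) has_field_derivative 0) (at 0)" if m: "m \<le> n" for m
    proof -
      obtain D1 where D1: "(\<phi> has_field_derivative D1) (at 0)"
        using poly_diff_ex[OF bf] unfolding \<phi>_def by blast
      have "(\<lambda>x. V m x \<alpha>) \<in> poly_funs" using V weighted_poly by blast
      then obtain D2 where D2: "((\<lambda>s. V m (y s) \<alpha>) has_field_derivative D2) (at 0)"
        using poly_diff_ex by blast
      show ?thesis
        using DERIV_mult[OF DERIV_divide[OF Ed[OF m] D1 \<phi>0] D2] by (simp add: E0[OF m])
    qed
    hence "((\<lambda>s. y s (Coef \<alpha>) - (\<Sum>m\<le>n. equation n d m (y s) / \<phi> s * V m (y s) \<alpha>)) has_field_derivative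
        v (Coef \<alpha>) - (\<Sum>m\<le>n. 0)) (at 0)"
      by (intro DERIV_diff DERIV_sum yd) auto
    thus ?thesis by (simp add: A_def)
  qed
  have A0: "A 0 \<alpha> = x (Coef \<alpha>)" for \<alpha>
    using E0 by (simp add: A_def y0)
  have Ab: "A 0 b = 1" unfolding A0 by (rule chart_spaceD(2)[OF xs])
  have yJ: "y s (Jet u l) = (if l = 0 then 1 else 0)" for s l
    using chart_spaceD(1,4)[OF xs] chart_vecsD(1)[OF v] by (simp add: y_def)
  have yu: "jet_series (y s) u = 1" for s
    by (rule fps_ext) (simp add: jet_series_nth yJ)
  have jz: "jet_series (z s) = jet_series (y s)" for s
    by (rule ext) (simp add: jet_series_def z_def)
  have cone: "in_cone n d (z s)" if \<phi>: "\<phi> s \<noteq> 0" for s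
  proof -
    have Vs: "agree n (form_series n d (V m (y s)) (jet_series (y s))) (fps_const (\<phi> s) * fps_X ^ m)" for m
    proof -
      have "agree n (form_series n d (V m (y s)) (jet_series (y s)))
        (fps_const (bend_factor n u k (y s)) * fps_X ^ m * series_monomial n (jet_series (y s)) (power_index u d))"
        using V by blast
      thus ?thesis using series_monomial_power_index[OF u, of "jet_series (y s)" d] yu by (simp add: \<phi>_def)
    qed
    have "form_series n d (coefs (z s)) (jet_series (z s)) =
        form_series n d (\<lambda>\<alpha>. coefs (y s) \<alpha> + (\<Sum>m\<le>n. - (equation n d m (y s) / \<phi> s) * V m (y s) \<alpha>)) (jet_series (y s))"
      unfolding jz by (intro form_series_cong refl) (simp add: coefs_def z_def A_def sum_negf)
    also have "\<dots> = form_series n d (coefs (y s)) (jet_series (y s)) +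
        (\<Sum>m\<le>n. fps_const (- (equation n d m (y s) / \<phi> s)) * form_series n d (V m (y s)) (jet_series (y s)))"
      unfolding form_series_linear(1) by (subst form_series_sum) simp_all
    also have "agree n \<dots> (form_series n d (coefs (y s)) (jet_series (y s)) +
        (\<Sum>m\<le>n. fps_const (- (equation n d m (y s) / \<phi> s)) * (fps_const (\<phi> s) * fps_X ^ m)))"
      by (intro agree_add agree_refl agree_sum agree_mult Vs)
    also have "(\<Sum>m\<le>n. fps_const (- (equation n d m (y s) / \<phi> s)) * (fps_const (\<phi> s) * fps_X ^ m)) =
        (\<Sum>m\<le>n. fps_const (- equation n d m (y s)) * fps_X ^ m)"
      using \<phi> by (intro sum.cong refl) (simp add: mult.assoc[symmetric])
    also have "agree n (form_series n d (coefs (y s)) (jet_series (y s)) +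
        (\<Sum>m\<le>n. fps_const (- equation n d m (y s)) * fps_X ^ m)) 0"
      unfolding agree_def
    proof (intro allI impI)
      fix r assume "r \<le> n"
      have "fps_nth (\<Sum>m\<le>n. fps_const (- equation n d m (y s)) * fps_X ^ m) r =
          (\<Sum>m\<le>n. if m = r then - equation n d m (y s) else 0)"
        unfolding fps_sum_nth by (intro sum.cong refl) (auto simp: fps_X_power_nth)
      also have "\<dots> = - equation n d r (y s)" using \<open>r \<le> n\<close> by simp
      finally show "fps_nth (form_series n d (coefs (y s)) (jet_series (y s)) +
          (\<Sum>m\<le>n. fps_const (- equation n d m (y s)) * fps_X ^ m)) r = fps_nth 0 r"
        by (simp add: equation_def)
    qed
    finally show ?thesis by (simp add: in_cone_def)
  qed
  have vec: "chart_vector n d (u, b) (z s)" for s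
    unfolding chart_vector_def fst_conv snd_conv
  proof (intro allI impI)
    fix i assume i: "i \<notin> free_coords n d (u, b) \<union> {Coef b}"
    have xi: "x i = (if i = Jet u 0 then 1 else 0)"
      by (rule chart_vector_chart_space[OF xs, unfolded chart_vector_def fst_conv snd_conv, rule_format, OF i])
    have vi: "v i = 0" using v i by (simp add: chart_vecs_def)
    show "z s i = (if i = Jet u 0 then 1 else 0)"
    proof (cases i)
      case (Jet k l)
      thus ?thesis using xi vi by (simp add: z_def y_def)
    next
      case (Coef \<alpha>)
      hence "\<alpha> \<notin> mindices (n+1) d" using i by (auto simp: free_coords_def)
      hence "V m (y s) \<alpha> = 0" for m using V by blast
      thus ?thesis using Coef xi vi by (simp add: z_def A_def y_def)
    qed
  qed
  have cont: "isCont (\<lambda>s. A s b) 0" "isCont \<phi> 0"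
    using Ad DERIV_isCont poly_diff_ex[OF bf] unfolding \<phi>_def by blast+
  have ev: "\<forall>\<^sub>F s in nhds 0. f s \<noteq> 0" if "isCont f 0" "f 0 \<noteq> 0" for f :: "complex \<Rightarrow> complex"
  proof -
    have "(f \<longlongrightarrow> f 0) (nhds 0)"
      using that(1) tendsto_at_iff_tendsto_nhds[of f 0] by (simp add: isCont_def)
    thus ?thesis using that(2) by (rule tendsto_imp_eventually_ne)
  qed
  show ?thesis
  proof (rule tangent_spaceI[OF v])
    show "((\<lambda>s. unit_coef b (z s) i) has_field_derivative v i) (at 0)" for i
    proof (cases i)
      case (Jet k l)
      thus ?thesis using yd[of i] by (simp add: unit_coef_def z_def)
    next
      case (Coef \<alpha>)
      have "((\<lambda>s. A s \<alpha> / A s b) has_field_derivative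
          (v (Coef \<alpha>) * A 0 b - A 0 \<alpha> * v (Coef b)) / (A 0 b * A 0 b)) (at 0)"
        by (rule DERIV_divide[OF Ad Ad]) (simp add: Ab)
      thus ?thesis using Coef Ab chart_vecsD(2)[OF v] by (simp add: unit_coef_def z_def)
    qed
    have "z 0 = x" by (rule ext) (simp add: z_def A0 y0 split: coord.split)
    thus "unit_coef b (z 0) = chart_map n d (u, b) p"
      using unit_coef_self[of x b] chart_spaceD(2)[OF xs] by (simp add: x_def)
    have "\<forall>\<^sub>F s in nhds 0. A s b \<noteq> 0" using ev[OF cont(1)] Ab by simp
    moreover have "\<forall>\<^sub>F s in nhds 0. \<phi> s \<noteq> 0" using ev[OF cont(2) \<phi>0] .
    ultimately show "\<forall>\<^sub>F s in nhds 0. unit_coef b (z s) \<in> Jvert_chart n d (u, b)"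
    proof eventually_elim
      case (elim s)
      show ?case by (rule unit_coef_Jvert_chart[OF c vec _ cone[OF elim(2)]]) (use elim(1) in \<open>simp add: z_def\<close>)
    qed
  qed
qed


section \<open>Twisted vector fields from homogeneous fields\<close>

text \<open>
  The derivative of \<open>Z / Z\<^sub>u\<close> and \<open>A / A\<^sub>b\<close> along the field, at a normalised lift.
\<close>

definition field_vec ::
    "nat \<Rightarrow> nat \<Rightarrow> ((coord \<Rightarrow> complex) \<Rightarrow> nat \<Rightarrow> complex fps) \<Rightarrow>
     ((coord \<Rightarrow> complex) \<Rightarrow> (nat \<Rightarrow> nat) \<Rightarrow> complex) \<Rightarrow> chart \<Rightarrow> (coord \<Rightarrow> complex) \<Rightarrow> coord \<Rightarrow> complex" where
  "field_vec n d Zd Ad c x i = (if i \<in> free_coords n d c then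
     (case i of Jet k m \<Rightarrow> fact m * fps_nth (Zd x k - jet_series x k * Zd x (fst c)) m
      | Coef \<alpha> \<Rightarrow> Ad x \<alpha> - x (Coef \<alpha>) * Ad x (snd c)) else 0)"

text \<open>
  The last two conditions ensure tangency: the field satisfies the linearised equations, and
  where the disc does not move it is vertical.
\<close>

definition homogeneous_field ::
    "nat \<Rightarrow> nat \<Rightarrow> nat \<Rightarrow> ((coord \<Rightarrow> complex) \<Rightarrow> nat \<Rightarrow> complex fps) \<Rightarrow>
     ((coord \<Rightarrow> complex) \<Rightarrow> (nat \<Rightarrow> nat) \<Rightarrow> complex) \<Rightarrow> bool" where
  "homogeneous_field n d q Zd Ad \<longleftrightarrow>
     (\<forall>k. poly_series (\<lambda>x. Zd x k)) \<and> (\<forall>\<alpha>. weighted n q 2 (\<lambda>x. Ad x \<alpha>)) \<and>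
     (\<forall>\<rho> \<mu> x y k. rescaled n \<rho> \<mu> x y \<longrightarrow> k \<le> n + 1 \<longrightarrow>
        agree n (Zd y k) (fps_const (fps_nth \<rho> 0 ^ q * \<mu>) * \<rho> * Zd x k)) \<and>
     (\<forall>x. agree n (form_series n d (Ad x) (jet_series x) +
        form_variation n d (coefs x) (jet_series x) (Zd x)) 0) \<and>
     (\<forall>x. (\<forall>k. Zd x k = 0) \<or> (\<exists>u k. u \<le> n + 1 \<and> k \<le> n + 1 \<and> bend u k x \<noteq> 0))"

lemma field_vec_chart_vecs: "field_vec n d Zd Ad c x \<in> chart_vecs n d c"
  by (simp add: chart_vecs_def field_vec_def)

lemma field_vec_jets:
  assumes x: "x \<in> chart_space n d (u, b)" and k: "k \<le> n + 1"
  shows "agree n (jet_series (field_vec n d Zd Ad (u, b) x) k) (Zd x k - jet_series x k * Zd x u)"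
  unfolding agree_def
proof (intro allI impI)
  fix m assume m: "m \<le> n"
  show "fps_nth (jet_series (field_vec n d Zd Ad (u, b) x) k) m = fps_nth (Zd x k - jet_series x k * Zd x u) m"
  proof (cases "k = u")
    case True
    thus ?thesis using jet_series_chart_space[OF x] by (simp add: jet_series_nth field_vec_def free_coords_def)
  next
    case False
    hence "Jet k m \<in> free_coords n d (u, b)" using k m by (simp add: free_coords_def)
    thus ?thesis by (simp add: jet_series_nth field_vec_def)
  qed
qed

lemma field_vec_coefs:
  assumes x: "x \<in> chart_space n d (u, b)" and \<alpha>: "\<alpha> \<in> mindices (n+1) d"
  shows "field_vec n d Zd Ad (u, b) x (Coef \<alpha>) = Ad x \<alpha> - x (Coef \<alpha>) * Ad x b"
proof (cases "\<alpha> = b")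
  case True
  thus ?thesis using chart_spaceD(2)[OF x] by (simp add: field_vec_def free_coords_def)
next
  case False
  hence "Coef \<alpha> \<in> free_coords n d (u, b)" using \<alpha> by (simp add: free_coords_def)
  thus ?thesis by (simp add: field_vec_def)
qed

text \<open>
  Normalising the lift changes the field by infinitesimal rescalings, which preserve the
  equations by Euler's identity.
\<close>

lemma field_vec_tangent:
  assumes n: "n \<ge> 1" and d: "d > n" and F: "homogeneous_field n d q Zd Ad"
    and c: "(u, b) \<in> charts n d" and p: "p \<in> Jvert n d \<inter> chart_dom n d (u, b)"
  shows "field_vec n d Zd Ad (u, b) (chart_map n d (u, b) p) \<in> tangent_space n d (u, b) p"
proof -
  define x where "x = chart_map n d (u, b) p"
  define v where "v = field_vec n d Zd Ad (u, b) x"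
  have xs: "x \<in> chart_space n d (u, b)" using chart_map_in_space[OF c] p by (simp add: x_def)
  have xc: "agree n (form_series n d (coefs x) (jet_series x)) 0"
    using Jvert_iff[OF c, of p] p unfolding x_def in_cone_def by blast
  have u: "u \<le> n + 1" using c by (simp add: charts_def)
  have T1: "agree n (form_series n d (Ad x) (jet_series x) +
        form_variation n d (coefs x) (jet_series x) (Zd x)) 0"
    using F unfolding homogeneous_field_def by blast
  have vv: "v \<in> chart_vecs n d (u, b)" unfolding v_def by (rule field_vec_chart_vecs)
  have lin: "agree n (linearised n d x v) 0"
  proof -
    have "form_series n d (coefs v) (jet_series x) =
        form_series n d (\<lambda>\<alpha>. Ad x \<alpha> + (- Ad x b) * coefs x \<alpha>) (jet_series x)"
      unfolding v_def by (intro form_series_cong refl) (simp add: coefs_def field_vec_coefs[OF xs])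
    also have "\<dots> = form_series n d (Ad x) (jet_series x) + fps_const (- Ad x b) * form_series n d (coefs x) (jet_series x)"
      by (simp only: form_series_linear)
    finally have 1: "form_series n d (coefs v) (jet_series x) = \<dots>" .
    have "agree n (form_variation n d (coefs x) (jet_series x) (jet_series v))
        (form_variation n d (coefs x) (jet_series x) (\<lambda>k. Zd x k - jet_series x k * Zd x u))"
      unfolding v_def by (intro form_variation_agree field_vec_jets[OF xs])
    also have "form_variation n d (coefs x) (jet_series x) (\<lambda>k. Zd x k - jet_series x k * Zd x u) =
        form_variation n d (coefs x) (jet_series x) (Zd x) -
        of_nat d * Zd x u * form_series n d (coefs x) (jet_series x)"
      by (simp only: form_variation_diff form_variation_euler)
    finally have 2: "agree n (linearised n d x v)
        ((form_series n d (Ad x) (jet_series x) + fps_const (- Ad x b) * form_series n d (coefs x) (jet_series x)) +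
         (form_variation n d (coefs x) (jet_series x) (Zd x) -
        of_nat d * Zd x u * form_series n d (coefs x) (jet_series x)))"
      unfolding linearised_def 1 by (intro agree_add agree_refl)
    also have "\<dots> = (form_series n d (Ad x) (jet_series x) + form_variation n d (coefs x) (jet_series x) (Zd x)) +
        (fps_const (- Ad x b) * form_series n d (coefs x) (jet_series x)
         - of_nat d * Zd x u * form_series n d (coefs x) (jet_series x))" by simp
    also have "agree n \<dots> (0 + (fps_const (- Ad x b) * 0 - of_nat d * Zd x u * 0))"
      by (intro agree_add agree_diff agree_mult agree_refl T1 xc)
    finally show ?thesis by simp
  qed
  show ?thesis
  proof (cases "\<exists>k\<le>n+1. x (Jet k 1) \<noteq> 0")
    case True
    then obtain k where "k \<le> n + 1" "x (Jet k 1) \<noteq> 0" by blast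
    thus ?thesis using tangent_moving[OF n d c p, of k v] vv lin unfolding x_def v_def by blast
  next
    case False
    hence "bend i k x = 0" if "i \<le> n + 1" "k \<le> n + 1" for i k
      using that by (simp add: bend_def)
    hence Z0: "Zd x k = 0" for k using F unfolding homogeneous_field_def by blast
    have "v (Jet k l) = 0" for k l by (simp add: v_def field_vec_def Z0)
    thus ?thesis using tangent_vertical[OF c p, of v] vv lin unfolding x_def v_def by blast
  qed
qed

lemma field_vec_poly:
  assumes F: "homogeneous_field n d q Zd Ad"
  shows "(\<lambda>x. field_vec n d Zd Ad c x i) \<in> poly_funs"
proof (cases "i \<in> free_coords n d c")
  case False
  thus ?thesis by (simp add: field_vec_def poly_funs.const)
next
  case True
  have Z: "poly_series (\<lambda>x. Zd x k)" for k using F unfolding homogeneous_field_def by blast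
  have A: "(\<lambda>x. Ad x \<alpha>) \<in> poly_funs" for \<alpha> using F weighted_poly unfolding homogeneous_field_def by blast
  show ?thesis
  proof (cases i)
    case (Jet k m)
    have "(\<lambda>x. fact m * fps_nth (Zd x k - jet_series x k * Zd x (fst c)) m) \<in> poly_funs"
      by (intro poly_funs.mult poly_funs.const poly_series_nth poly_series_diff poly_series_mult Z poly_series_jet)
    thus ?thesis using True Jet by (simp add: field_vec_def)
  next
    case (Coef \<alpha>)
    have "(\<lambda>x. Ad x \<alpha> - x (Coef \<alpha>) * Ad x (snd c)) \<in> poly_funs"
      by (intro poly_diff poly_funs.mult poly_funs.coord A)
    thus ?thesis using True Coef by (simp add: field_vec_def)
  qed
qed


section \<open>Change of chart for vector fields\<close>

text \<open>
  The transition functions are quotients of polynomials, and therefore accessible to the quotient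
  rule.
\<close>

lemma transition_formula:
  assumes c: "(u, b) \<in> charts n d" and c': "(v, a) \<in> charts n d"
    and x: "x \<in> chart_space n d (u, b)" "x (Jet v 0) \<noteq> 0" "x (Coef a) \<noteq> 0"
  shows "k \<le> n + 1 \<Longrightarrow> m \<le> n \<Longrightarrow> transition n d (u, b) (v, a) x (Jet k m) =
      fact m * fps_nth (cleared_series x v k) m / x (Jet v 0) ^ (m + 1)"
    and "transition n d (u, b) (v, a) x (Coef \<alpha>) = x (Coef \<alpha>) / x (Coef a)"
proof -
  obtain p where p: "p \<in> chart_dom n d (u, b)" "chart_map n d (u, b) p = x"
    using chart_map_surj[OF c x(1)] .
  have inj: "inj_on (chart_map n d (u, b)) (chart_dom n d (u, b))"
    using chart_map_inj[OF c] by (intro inj_onI) blast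
  have inv: "inv_into (chart_dom n d (u, b)) (chart_map n d (u, b)) x = p"
    using inv_into_f_f[OF inj p(1)] p(2) by simp
  have p': "p \<in> chart_dom n d (v, a)" using in_chart_dom_iff[OF c p(1) c'] p(2) x(2,3) by simp
  have t: "transition n d (u, b) (v, a) x = chart_map n d (v, a) p"
    by (rule ext) (simp add: transition_def inv)
  show "transition n d (u, b) (v, a) x (Coef \<alpha>) = x (Coef \<alpha>) / x (Coef a)"
    using chart_change(2)[OF p(1) p', of \<alpha>] by (simp add: t p(2) coefs_def divide_inverse mult.commute)
  assume k: "k \<le> n + 1" and m: "m \<le> n"
  have "chart_map n d (v, a) p (Jet k m) = fact m * fps_nth (jet_series x k * inverse (jet_series x v)) m"
    using agree_nth[OF chart_change(1)[OF p(1) p' k] m] by (simp add: p(2) jet_series_nth mult.commute field_simps)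
  thus "transition n d (u, b) (v, a) x (Jet k m) =
      fact m * fps_nth (cleared_series x v k) m / x (Jet v 0) ^ (m + 1)"
    using x(2) by (simp add: t cleared_series_generic[of x v, OF x(2)] dilate_nth)
qed

lemma vec_apply_quotient:
  assumes f: "f \<in> poly_funs" and g: "g \<in> poly_funs" and gx: "g x \<noteq> 0"
    and w: "w \<in> chart_vecs n d (u, b)" and x: "x \<in> chart_space n d (u, b)" "x i1 \<noteq> 0" "x i2 \<noteq> 0"
    and F: "\<And>y. y \<in> chart_space n d (u, b) \<Longrightarrow> y i1 \<noteq> 0 \<Longrightarrow> y i2 \<noteq> 0 \<Longrightarrow> F y = f y / g y"
  shows "((\<lambda>s. f (\<lambda>i. x i + s * w i) / g (\<lambda>i. x i + s * w i)) has_field_derivative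
    vec_apply n d (u, b) w x F) (at 0)"
proof -
  have pd: "pderiv_coord i F x = (pderiv_coord i f x * g x - f x * pderiv_coord i g x) / (g x * g x)"
    if i: "i \<in> free_coords n d (u, b)" for i
  proof -
    have "x(i := s) \<in> chart_space n d (u, b)" for s
      using x(1) i by (auto simp: chart_space_def free_coords_def)
    moreover have "\<forall>\<^sub>F s in nhds (x i). (x(i := s)) j \<noteq> 0" if "x j \<noteq> 0" for j
    proof (cases "j = i")
      case True
      have "((\<lambda>s. s) \<longlongrightarrow> x i) (nhds (x i))" by (rule filterlim_ident)
      from tendsto_imp_eventually_ne[OF this] show ?thesis using that True by simp
    qed (use that in simp)
    hence "\<forall>\<^sub>F s in nhds (x i). (x(i := s)) i1 \<noteq> 0 \<and> (x(i := s)) i2 \<noteq> 0"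
      using x(2,3) by (intro eventually_conj)
    ultimately have "\<forall>\<^sub>F s in nhds (x i). F (x(i := s)) = f (x(i := s)) / g (x(i := s))"
      by (auto elim!: eventually_mono intro: F)
    hence "pderiv_coord i F x = deriv (\<lambda>s. f (x(i := s)) / g (x(i := s))) (x i)"
      unfolding pderiv_coord_def by (rule deriv_cong_ev) simp
    also have "\<dots> = (pderiv_coord i f x * g x - f x * pderiv_coord i g x) / (g x * g x)"
    proof (rule DERIV_imp_deriv)
      have "((\<lambda>s. h (x(i := s))) has_field_derivative pderiv_coord i h x) (at (x i))" if "h \<in> poly_funs" for h
        unfolding pderiv_coord_def using poly_coord_differentiable[OF that] by (simp add: DERIV_deriv_iff_field_differentiable)
      from DERIV_divide[OF this[OF f] this[OF g]] gx
      show "((\<lambda>s. f (x(i := s)) / g (x(i := s))) has_field_derivative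
          (pderiv_coord i f x * g x - f x * pderiv_coord i g x) / (g x * g x)) (at (x i))" by simp
    qed
    finally show ?thesis .
  qed
  have "vec_apply n d (u, b) w x F =
      (\<Sum>i\<in>free_coords n d (u, b). w i * ((pderiv_coord i f x * g x - f x * pderiv_coord i g x) / (g x * g x)))"
    unfolding vec_apply_def by (intro sum.cong refl) (simp only: pd)
  also have "\<dots> = (vec_apply n d (u, b) w x f * g x - f x * vec_apply n d (u, b) w x g) / (g x * g x)"
    unfolding vec_apply_def
    by (simp add: sum_distrib_left sum_distrib_right sum_subtractf[symmetric] sum_divide_distrib algebra_simps)
  finally have eq: "vec_apply n d (u, b) w x F = \<dots>" .
  have "((\<lambda>s. h (\<lambda>i. x i + s * w i)) has_field_derivative vec_apply n d (u, b) w x h) (at 0)" if "h \<in> poly_funs" for h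
  proof -
    have "((\<lambda>s. h (\<lambda>i. x i + s * w i)) has_field_derivative vec_apply n d (u, b) w (\<lambda>i. x i + 0 * w i) h) (at 0)"
      by (rule vec_apply_curve[OF that w]) (rule line_deriv)
    thus ?thesis by simp
  qed
  from DERIV_divide[OF this[OF f] this[OF g]] gx show ?thesis by (simp add: eq)
qed

text \<open>
  The chain rule for \<open>Z \<mapsto> Z / Z\<^sub>v\<close>.  The quotient series is differentiated through the identity
  \<open>(Z / Z\<^sub>v) Z\<^sub>v = Z\<close>; the normalisation terms of the first chart cancel.
\<close>

lemma field_vec_change:
  assumes F: "homogeneous_field n d q Zd Ad"
    and c: "(u, b) \<in> charts n d" and c': "(v, a) \<in> charts n d"
    and p: "p \<in> chart_dom n d (u, b)" and p': "p \<in> chart_dom n d (v, a)"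
    and i: "i \<in> free_coords n d (v, a)"
  defines "x \<equiv> chart_map n d (u, b) p" and "y \<equiv> chart_map n d (v, a) p"
  shows "field_vec n d Zd Ad (v, a) y i = y (Jet u 0) ^ q * y (Coef b) *
     vec_apply n d (u, b) (field_vec n d Zd Ad (u, b) x) x (\<lambda>x. transition n d (u, b) (v, a) x i)"
proof -
  have xs: "x \<in> chart_space n d (u, b)" and ys: "y \<in> chart_space n d (v, a)"
    unfolding x_def y_def by (rule chart_map_in_space[OF c p], rule chart_map_in_space[OF c' p'])
  have u: "u \<le> n + 1" and v: "v \<le> n + 1" and b: "b \<in> mindices (n+1) d" and a: "a \<in> mindices (n+1) d"
    using c c' by (simp_all add: charts_def)
  have xv: "x (Jet v 0) \<noteq> 0" and xa: "x (Coef a) \<noteq> 0"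
    using in_chart_dom_iff[OF c p c'] p' by (simp_all add: x_def)
  define \<rho> where "\<rho> = inverse (jet_series x v)"
  define \<mu> where "\<mu> = inverse (x (Coef a))"
  have z0: "fps_nth (jet_series x v) 0 \<noteq> 0" using xv by (simp add: jet_series_nth)
  have \<rho>1: "\<rho> * jet_series x v = 1" unfolding \<rho>_def by (rule inverse_mult_eq_1[OF z0])
  have ag: "agree n (jet_series y k) (\<rho> * jet_series x k)" if "k \<le> n + 1" for k
    unfolding \<rho>_def x_def y_def by (rule chart_change(1)[OF p p' that])
  have cy: "coefs y \<alpha> = \<mu> * coefs x \<alpha>" for \<alpha>
    using chart_change(2)[OF p p', of \<alpha>] by (simp add: \<mu>_def x_def y_def coefs_def)
  have \<rho>0: "fps_nth \<rho> 0 \<noteq> 0" using z0 by (simp add: \<rho>_def)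
  have res: "rescaled n \<rho> \<mu> x y" using ag cy \<rho>0 by (simp add: rescaled_def)
  have yu: "y (Jet u 0) = fps_nth \<rho> 0"
    using agree_nth[OF ag[OF u] le0] jet_series_chart_space[OF xs] by (simp add: jet_series_nth)
  have yb: "y (Coef b) = \<mu>" using cy[of b] chart_spaceD(2)[OF xs] by (simp add: coefs_def)
  define w where "w = field_vec n d Zd Ad (u, b) x"
  have wv: "w \<in> chart_vecs n d (u, b)" unfolding w_def by (rule field_vec_chart_vecs)
  define \<gamma> where "\<gamma> s = (\<lambda>i. x i + s * w i)" for s
  have \<gamma>0: "\<gamma> 0 = x" by (simp add: \<gamma>_def)
  have Zy: "agree n (Zd y k) (fps_const (fps_nth \<rho> 0 ^ q * \<mu>) * \<rho> * Zd x k)" if "k \<le> n + 1" for k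
    using F res that unfolding homogeneous_field_def by blast
  have Ay: "Ad y \<alpha> = fps_nth \<rho> 0 ^ q * \<mu> ^ 2 * Ad x \<alpha>" for \<alpha>
    using F res weightedD unfolding homogeneous_field_def by blast
  show ?thesis
  proof (cases i)
    case (Coef \<alpha>)
    have \<alpha>: "\<alpha> \<in> mindices (n+1) d" using i Coef by (auto simp: free_coords_def)
    have "((\<lambda>s. \<gamma> s (Coef \<alpha>) / \<gamma> s (Coef a)) has_field_derivative
        vec_apply n d (u, b) w x (\<lambda>x. transition n d (u, b) (v, a) x i)) (at 0)"
      unfolding \<gamma>_def
      by (rule vec_apply_quotient[OF poly_funs.coord poly_funs.coord xa wv xs xv xa])
         (simp add: Coef transition_formula(2)[OF c c'])
    moreover have "((\<lambda>s. \<gamma> s (Coef \<alpha>) / \<gamma> s (Coef a)) has_field_derivative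
        (w (Coef \<alpha>) * \<gamma> 0 (Coef a) - \<gamma> 0 (Coef \<alpha>) * w (Coef a)) / (\<gamma> 0 (Coef a) * \<gamma> 0 (Coef a))) (at 0)"
      unfolding \<gamma>_def by (rule DERIV_divide[OF line_deriv line_deriv]) (simp add: xa)
    ultimately have D: "vec_apply n d (u, b) w x (\<lambda>x. transition n d (u, b) (v, a) x i) =
        (w (Coef \<alpha>) * x (Coef a) - x (Coef \<alpha>) * w (Coef a)) / (x (Coef a) * x (Coef a))"
      unfolding \<gamma>0 by (rule DERIV_unique)
    have wa: "w (Coef \<beta>) = Ad x \<beta> - x (Coef \<beta>) * Ad x b" if "\<beta> \<in> mindices (n+1) d" for \<beta>
      unfolding w_def by (rule field_vec_coefs[OF xs that])
    have y\<alpha>: "y (Coef \<alpha>) = \<mu> * x (Coef \<alpha>)" using cy[of \<alpha>] by (simp add: coefs_def)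
    have xa': "x (Coef a) = inverse \<mu>" and \<mu>0: "\<mu> \<noteq> 0" using xa by (simp_all add: \<mu>_def)
    have "field_vec n d Zd Ad (v, a) y i = Ad y \<alpha> - y (Coef \<alpha>) * Ad y a"
      unfolding Coef by (rule field_vec_coefs[OF ys \<alpha>])
    also have "\<dots> = fps_nth \<rho> 0 ^ q * \<mu> * ((w (Coef \<alpha>) * x (Coef a) - x (Coef \<alpha>) * w (Coef a)) / (x (Coef a) * x (Coef a)))"
      unfolding Ay y\<alpha> wa[OF \<alpha>] wa[OF a] xa' using \<mu>0 by (simp add: field_simps power2_eq_square)
    finally show ?thesis unfolding yu yb w_def[symmetric] D .
  next
    case (Jet k m)
    have k: "k \<le> n + 1" and m: "m \<le> n" and kv: "k \<noteq> v" using i Jet by (auto simp: free_coords_def)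
    define Q where "Q s = jet_series (\<gamma> s) k * inverse (jet_series (\<gamma> s) v)" for s
    define Qm where "Qm r y = fps_nth (cleared_series y v k) r / y (Jet v 0) ^ (r + 1)" for r and y :: "coord \<Rightarrow> complex"
    have nz: "\<forall>\<^sub>F s in nhds 0. \<gamma> s (Jet v 0) \<noteq> 0"
    proof -
      have "isCont (\<lambda>s. \<gamma> s (Jet v 0)) 0" unfolding \<gamma>_def using line_deriv by (rule DERIV_isCont)
      hence "((\<lambda>s. \<gamma> s (Jet v 0)) \<longlongrightarrow> x (Jet v 0)) (nhds 0)"
        using tendsto_at_iff_tendsto_nhds[of "\<lambda>s. \<gamma> s (Jet v 0)" 0] by (simp add: isCont_def \<gamma>0)
      thus ?thesis using xv by (rule tendsto_imp_eventually_ne)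
    qed
    have Qeq: "\<forall>\<^sub>F s in nhds 0. Qm r (\<gamma> s) = fps_nth (Q s) r" for r
      using nz
    proof eventually_elim
      case (elim s)
      thus ?case by (simp add: Qm_def Q_def cleared_series_generic[of "\<gamma> s" v, OF elim] dilate_nth)
    qed
    have QD: "((\<lambda>s. fps_nth (Q s) r) has_field_derivative vec_apply n d (u, b) w x (Qm r)) (at 0)" for r
    proof -
      have "((\<lambda>s. Qm r (\<gamma> s)) has_field_derivative vec_apply n d (u, b) w x (Qm r)) (at 0)"
        unfolding Qm_def \<gamma>_def
        by (rule vec_apply_quotient[OF poly_series_nth[OF poly_series_cleared] poly_power[OF poly_funs.coord] _ wv xs xv xa])
           (simp_all add: xv)
      thus ?thesis by (subst (asm) DERIV_cong_ev[OF refl Qeq refl])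
    qed
    define Q' where "Q' = Abs_fps (\<lambda>r. vec_apply n d (u, b) w x (Qm r))"
    have sQ: "series_deriv Q Q' 0" using QD by (simp add: series_deriv_def Q'_def)
    have sj: "series_deriv (\<lambda>s. jet_series (\<gamma> s) j) (jet_series w j) 0" for j
      unfolding series_deriv_def jet_series_nth \<gamma>_def by (intro allI DERIV_cdivide line_deriv)
    have "series_deriv (\<lambda>s. Q s * jet_series (\<gamma> s) v) (jet_series w k) 0"
      unfolding series_deriv_def
    proof
      fix r
      have "\<forall>\<^sub>F s in nhds 0. fps_nth (jet_series (\<gamma> s) k) r = fps_nth (Q s * jet_series (\<gamma> s) v) r"
        using nz
      proof eventually_elim
        case (elim s)
        hence "inverse (jet_series (\<gamma> s) v) * jet_series (\<gamma> s) v = 1"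
          by (intro inverse_mult_eq_1) (simp add: jet_series_nth)
        thus ?case by (simp add: Q_def mult.assoc)
      qed
      from DERIV_cong_ev[OF refl this refl] series_deriv_nth[OF sj[of k], of r]
      show "((\<lambda>s. fps_nth (Q s * jet_series (\<gamma> s) v) r) has_field_derivative fps_nth (jet_series w k) r) (at 0)"
        by blast
    qed
    from series_deriv_unique[OF this series_deriv_mult[OF sQ sj[of v]]]
    have wk: "jet_series w k = Q' * jet_series x v + Q 0 * jet_series w v" by (simp add: \<gamma>0)
    have Q0: "Q 0 = \<rho> * jet_series x k" by (simp add: Q_def \<gamma>0 \<rho>_def mult.commute)
    have "Q' = Q' * (\<rho> * jet_series x v)" by (simp add: \<rho>1)
    also have "\<dots> = \<rho> * (jet_series w k - \<rho> * jet_series x k * jet_series w v)"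
      using wk by (simp add: Q0 algebra_simps)
    also have "agree n \<dots> (\<rho> * ((Zd x k - jet_series x k * Zd x u) - \<rho> * jet_series x k * (Zd x v - jet_series x v * Zd x u)))"
      unfolding w_def by (intro agree_mult agree_diff agree_refl field_vec_jets[OF xs] k v)
    also have "\<rho> * ((Zd x k - jet_series x k * Zd x u) - \<rho> * jet_series x k * (Zd x v - jet_series x v * Zd x u)) =
        \<rho> * (Zd x k - \<rho> * jet_series x k * Zd x v) - \<rho> * jet_series x k * Zd x u * (1 - \<rho> * jet_series x v)"
      by (simp add: algebra_simps)
    also have "\<dots> = \<rho> * (Zd x k - \<rho> * jet_series x k * Zd x v)" by (simp add: \<rho>1)
    finally have Q'ag: "agree n Q' (\<rho> * (Zd x k - \<rho> * jet_series x k * Zd x v))" .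
    define C where "C = fps_nth \<rho> 0 ^ q * \<mu>"
    have "agree n (Zd y k - jet_series y k * Zd y v)
       (fps_const C * \<rho> * Zd x k - (\<rho> * jet_series x k) * (fps_const C * \<rho> * Zd x v))"
      unfolding C_def by (intro agree_diff agree_mult Zy ag k v)
    also have "fps_const C * \<rho> * Zd x k - (\<rho> * jet_series x k) * (fps_const C * \<rho> * Zd x v) =
        fps_const C * (\<rho> * (Zd x k - \<rho> * jet_series x k * Zd x v))"
      by (simp add: algebra_simps)
    also have "agree n \<dots> (fps_const C * Q')"
      by (intro agree_mult agree_refl agree_sym[OF Q'ag])
    finally have LHS: "agree n (Zd y k - jet_series y k * Zd y v) (fps_const C * Q')" .
    have "field_vec n d Zd Ad (v, a) y i = fact m * fps_nth (Zd y k - jet_series y k * Zd y v) m"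
      using i Jet by (simp add: field_vec_def)
    also have "\<dots> = fact m * (C * vec_apply n d (u, b) w x (Qm m))"
      using agree_nth[OF LHS m] by (simp add: Q'_def)
    also have "fact m * (C * vec_apply n d (u, b) w x (Qm m)) = C * vec_apply n d (u, b) w x (\<lambda>x. transition n d (u, b) (v, a) x i)"
    proof -
      have "((\<lambda>s. (fact m * fps_nth (cleared_series (\<lambda>i. x i + s * w i) v k) m) / (x (Jet v 0) + s * w (Jet v 0)) ^ (m + 1))
          has_field_derivative vec_apply n d (u, b) w x (\<lambda>x. transition n d (u, b) (v, a) x i)) (at 0)"
        by (rule vec_apply_quotient[where f = "\<lambda>x. fact m * fps_nth (cleared_series x v k) m" and
              g = "\<lambda>x. x (Jet v 0) ^ (m + 1)",
              OF poly_funs.mult[OF poly_funs.const poly_series_nth[OF poly_series_cleared]]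
                poly_power[OF poly_funs.coord] _ wv xs xv xa])
           (simp_all add: xv Jet transition_formula(1)[OF c c' _ _ _ k m])
      moreover have "((\<lambda>s. fact m * Qm m (\<gamma> s)) has_field_derivative fact m * vec_apply n d (u, b) w x (Qm m)) (at 0)"
        using QD[of m] by (intro DERIV_cmult) (subst DERIV_cong_ev[OF refl Qeq refl])
      ultimately have "vec_apply n d (u, b) w x (\<lambda>x. transition n d (u, b) (v, a) x i) = fact m * vec_apply n d (u, b) w x (Qm m)"
        by (intro DERIV_unique) (simp_all add: Qm_def \<gamma>_def)
      thus ?thesis by simp
    qed
    finally show ?thesis unfolding C_def yu yb w_def .
  qed
qed

definition field_section ::
    "nat \<Rightarrow> nat \<Rightarrow> ((coord \<Rightarrow> complex) \<Rightarrow> nat \<Rightarrow> complex fps) \<Rightarrow>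
     ((coord \<Rightarrow> complex) \<Rightarrow> (nat \<Rightarrow> nat) \<Rightarrow> complex) \<Rightarrow> chart \<Rightarrow> vjet \<Rightarrow> coord \<Rightarrow> complex" where
  "field_section n d Zd Ad c p = field_vec n d Zd Ad c (chart_map n d c p)"

lemma field_section_twisted:
  assumes n: "n \<ge> 1" and d: "d > n" and F: "homogeneous_field n d q Zd Ad"
  shows "twisted_section n d q 1 (field_section n d Zd Ad)"
  unfolding twisted_section_def field_section_def
proof (intro conjI ballI allI impI)
  fix c p assume "c \<in> charts n d" "p \<in> Jvert n d \<inter> chart_dom n d c"
  thus "field_vec n d Zd Ad c (chart_map n d c p) \<in> tangent_space n d c p"
    using field_vec_tangent[OF n d F] by (cases c) blast
next
  fix c i
  show "\<exists>f\<in>poly_funs. \<forall>p\<in>Jvert n d \<inter> chart_dom n d c.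
      field_vec n d Zd Ad c (chart_map n d c p) i = f (chart_map n d c p)"
    by (rule bexI[OF _ field_vec_poly[OF F, of c i]]) simp
next
  fix u b v a p i
  assume "(u, b) \<in> charts n d" "(v, a) \<in> charts n d"
    "p \<in> Jvert n d \<inter> chart_dom n d (u, b) \<inter> chart_dom n d (v, a)" "i \<in> free_coords n d (v, a)"
  thus "field_vec n d Zd Ad (v, a) (chart_map n d (v, a) p) i =
      chart_map n d (v, a) p (Jet u 0) ^ q * chart_map n d (v, a) p (Coef b) ^ 1 *
      vec_apply n d (u, b) (field_vec n d Zd Ad (u, b) (chart_map n d (u, b) p)) (chart_map n d (u, b) p)
        (\<lambda>x. transition n d (u, b) (v, a) x i)"
    using field_vec_change[OF F, of u b v a p i] by simp
qed


section \<open>Forms vanishing along a disc\<close>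

text \<open>
  By induction on \<open>m\<close> after differentiation, since the derivative of \<open>F\<close> is a unit.
\<close>

lemma power_sum_injective:
  fixes F :: "complex fps"
  assumes F: "fps_nth F 1 \<noteq> 0"
  shows "agree m (\<Sum>i\<le>m. fps_const (c i) * F ^ i) 0 \<Longrightarrow> i \<le> m \<Longrightarrow> c i = 0"
proof (induction m arbitrary: c i)
  case 0
  thus ?case by (simp add: agree_def)
next
  case (Suc m)
  let ?G = "\<Sum>i\<le>Suc m. fps_const (c i) * F ^ i"
  let ?H = "\<Sum>i\<le>m. fps_const (of_nat (Suc i) * c (Suc i)) * F ^ i"
  have F': "fps_nth (fps_deriv F) 0 \<noteq> 0" using F by simp
  have "fps_deriv ?G = (\<Sum>i\<le>Suc m. fps_const (c i) * (of_nat i * fps_deriv F * F ^ (i - 1)))"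
    by (simp only: fps_deriv_sum fps_deriv_mult fps_deriv_const fps_deriv_power') (simp add: fps_of_nat)
  also have "\<dots> = (\<Sum>i\<le>m. fps_const (c (Suc i)) * (of_nat (Suc i) * fps_deriv F * F ^ i))"
    by (subst sum.atMost_Suc_shift) simp
  also have "\<dots> = fps_deriv F * ?H"
    unfolding sum_distrib_left
    by (intro sum.cong refl) (simp only: fps_const_mult[symmetric] fps_of_nat mult_ac)
  finally have GH: "fps_deriv ?G = fps_deriv F * ?H" .
  have "agree m (fps_deriv ?G) 0"
    using Suc.prems(1) by (simp add: agree_def del: sum.atMost_Suc)
  hence A: "agree m (inverse (fps_deriv F) * (fps_deriv F * ?H)) (inverse (fps_deriv F) * 0)"
    unfolding GH by (rule agree_mult[OF agree_refl])
  have e: "inverse (fps_deriv F) * (fps_deriv F * ?H) = ?H"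
    unfolding mult.assoc[symmetric] inverse_mult_eq_1[OF F'] by (rule mult_1_left)
  have "agree m ?H 0" using A unfolding e mult_zero_right .
  hence H: "c (Suc i) = 0" if "i \<le> m" for i
    using Suc.IH[of "\<lambda>i. of_nat (Suc i) * c (Suc i)" i] that by (simp del: of_nat_Suc)
  hence "?G = fps_const (c 0)" by (subst sum.atMost_Suc_shift) simp
  hence "c 0 = 0" using agree_nth[OF Suc.prems(1), of 0] by simp
  thus ?case using H Suc.prems(2) by (cases i) auto
qed

text \<open>
  The values at \<open>x\<close> of the vertical fields with coefficients of the admissible weight.
\<close>

definition vertical_values ::
    "nat \<Rightarrow> nat \<Rightarrow> (coord \<Rightarrow> complex) \<Rightarrow> ((nat \<Rightarrow> nat) \<Rightarrow> complex) set" where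
  "vertical_values n d x = {B. \<exists>W. (\<forall>\<alpha>. weighted n (n\<^sup>2 + 2 * n) 0 (\<lambda>y. W y \<alpha>)) \<and>
     (\<forall>y. agree n (form_series n d (W y) (jet_series y)) 0) \<and> W x = B}"

lemma vertical_valuesI:
  assumes "\<And>\<alpha>. weighted n (n\<^sup>2 + 2 * n) 0 (\<lambda>y. W y \<alpha>)"
    and "\<And>y. agree n (form_series n d (W y) (jet_series y)) 0"
  shows "W x \<in> vertical_values n d x"
  unfolding vertical_values_def using assms by blast

lemma vertical_values_0: "(\<lambda>_. 0) \<in> vertical_values n d x"
  by (rule vertical_valuesI[of n "\<lambda>_ _. 0"]) (simp_all add: weighted_0 form_series_def)

lemma vertical_values_combine:
  assumes "A \<in> vertical_values n d x" "B \<in> vertical_values n d x"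
  shows "(\<lambda>\<alpha>. A \<alpha> + w * B \<alpha>) \<in> vertical_values n d x"
proof -
  obtain V where V: "\<And>\<alpha>. weighted n (n\<^sup>2 + 2 * n) 0 (\<lambda>y. V y \<alpha>)"
    "\<And>y. agree n (form_series n d (V y) (jet_series y)) 0" "V x = A"
    using assms(1) unfolding vertical_values_def by blast
  obtain W where W: "\<And>\<alpha>. weighted n (n\<^sup>2 + 2 * n) 0 (\<lambda>y. W y \<alpha>)"
    "\<And>y. agree n (form_series n d (W y) (jet_series y)) 0" "W x = B"
    using assms(2) unfolding vertical_values_def by blast
  have "(\<lambda>\<alpha>. V x \<alpha> + w * W x \<alpha>) \<in> vertical_values n d x"
  proof (rule vertical_valuesI[of n "\<lambda>y \<alpha>. V y \<alpha> + w * W y \<alpha>"])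
    show "weighted n (n\<^sup>2 + 2 * n) 0 (\<lambda>y. V y \<alpha> + w * W y \<alpha>)" for \<alpha>
      by (intro weighted_add weighted_cmult V W)
    have "agree n (form_series n d (V y) (jet_series y) + fps_const w * form_series n d (W y) (jet_series y)) (0 + fps_const w * 0)" for y
      by (intro agree_add agree_mult agree_refl V W)
    thus "agree n (form_series n d (\<lambda>\<alpha>. V y \<alpha> + w * W y \<alpha>) (jet_series y)) 0" for y
      by (simp only: form_series_linear mult_zero_right add_0)
  qed
  thus ?thesis by (simp only: V(3) W(3))
qed

lemma vertical_values_form:
  assumes "B \<in> vertical_values n d x" shows "agree n (form_series n d B (jet_series x)) 0"
  using assms unfolding vertical_values_def by blast

context
  fixes n d u k :: nat and b :: "nat \<Rightarrow> nat" and x :: "coord \<Rightarrow> complex"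
  assumes n: "n \<ge> 1" and d: "d > n" and u: "u \<le> n + 1" and k: "k \<le> n + 1" and ku: "k \<noteq> u"
    and x: "x \<in> chart_space n d (u, b)" and moving: "x (Jet k 1) \<noteq> 0"
begin

abbreviation line_monomial :: "nat \<Rightarrow> (nat \<Rightarrow> nat) \<Rightarrow> complex" where
  "line_monomial i \<equiv> monomial (binary_index k i u (d - i))"

definition reducible :: "((nat \<Rightarrow> nat) \<Rightarrow> complex) \<Rightarrow> bool" where
  "reducible B \<longleftrightarrow> (\<exists>c. (\<lambda>\<alpha>. B \<alpha> + (-1) * (\<Sum>i\<le>n. c i * line_monomial i \<alpha>)) \<in> vertical_values n d x)"

lemma reducible_vertical: "B \<in> vertical_values n d x \<Longrightarrow> reducible B"
  unfolding reducible_def by (rule exI[of _ "\<lambda>_. 0"]) simp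

lemma reducible_combine:
  assumes "reducible A" "reducible B" shows "reducible (\<lambda>\<alpha>. A \<alpha> + w * B \<alpha>)"
proof -
  obtain a c where a: "(\<lambda>\<alpha>. A \<alpha> + (-1) * (\<Sum>i\<le>n. a i * line_monomial i \<alpha>)) \<in> vertical_values n d x"
    and c: "(\<lambda>\<alpha>. B \<alpha> + (-1) * (\<Sum>i\<le>n. c i * line_monomial i \<alpha>)) \<in> vertical_values n d x"
    using assms unfolding reducible_def by blast
  have "(A \<alpha> + (-1) * (\<Sum>i\<le>n. a i * line_monomial i \<alpha>)) + w * (B \<alpha> + (-1) * (\<Sum>i\<le>n. c i * line_monomial i \<alpha>)) =
      (A \<alpha> + w * B \<alpha>) + (-1) * (\<Sum>i\<le>n. (a i + w * c i) * line_monomial i \<alpha>)" for \<alpha>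
    by (simp add: algebra_simps sum.distrib sum_distrib_left)
  hence "(\<lambda>\<alpha>. (A \<alpha> + w * B \<alpha>) + (-1) * (\<Sum>i\<le>n. (a i + w * c i) * line_monomial i \<alpha>)) \<in> vertical_values n d x"
    using vertical_values_combine[OF a c, of w] by (simp only:)
  thus ?thesis unfolding reducible_def by (intro exI[of _ "\<lambda>i. a i + w * c i"])
qed

lemma reducible_0: "reducible (\<lambda>_. 0)"
  by (rule reducible_vertical[OF vertical_values_0])

lemma reducible_sum:
  "(\<And>i. i \<in> I \<Longrightarrow> reducible (B i)) \<Longrightarrow> reducible (\<lambda>\<alpha>. \<Sum>i\<in>I. w i * B i \<alpha>)"
proof (induction I rule: infinite_finite_induct)
  case (insert i I)
  have "reducible (\<lambda>\<alpha>. (\<Sum>i\<in>I. w i * B i \<alpha>) + w i * B i \<alpha>)"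
    using insert by (intro reducible_combine) auto
  thus ?case using insert.hyps by (simp add: add.commute)
qed (simp_all add: reducible_0)

text \<open>
  For \<open>i > n\<close>, subtract a multiple of the power \<open>n + 1\<close> of
  \<open>Z\<^sub>u(0) Z\<^sub>k - Z\<^sub>k(0) Z\<^sub>u\<close>, which vanishes at the centre of the disc; this needs \<open>d \<ge> n + 1\<close>.
\<close>

lemma reducible_line: "i \<le> d \<Longrightarrow> reducible (line_monomial i)"
proof (induction i rule: less_induct)
  case (less i)
  show ?case
  proof (cases "i \<le> n")
    case True
    have "(\<Sum>j\<le>n. (if j = i then 1 else 0) * line_monomial j \<alpha>) = line_monomial i \<alpha>" for \<alpha>
    proof -
      have "(\<Sum>j\<le>n. (if j = i then 1 else 0) * line_monomial j \<alpha>) = (\<Sum>j\<le>n. if j = i then line_monomial j \<alpha> else 0)"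
        by (intro sum.cong) auto
      thus ?thesis using True by simp
    qed
    hence "(\<lambda>\<alpha>. line_monomial i \<alpha> + (-1) * (\<Sum>j\<le>n. (if j = i then 1 else 0) * line_monomial j \<alpha>)) = (\<lambda>_. 0)"
      by (simp only:) simp
    thus ?thesis unfolding reducible_def using vertical_values_0
      by (intro exI[of _ "\<lambda>j. if j = i then 1 else 0"]) (simp only:)
  next
    case False
    define \<gamma> where "\<gamma> = binary_index k (i - (n+1)) u (d - i)"
    have \<gamma>: "\<gamma> \<in> mindices (n+1) (d - (n+1))"
      unfolding \<gamma>_def using k u False less.prems by (intro binary_index_mindices) auto
    have dd: "d - (n+1) + (n+1) = d" using d by simp
    have idx: "(\<lambda>m. \<gamma> m + binary_index k r u (n + 1 - r) m) = binary_index k (i - (n+1) + r) u (d - (i - (n+1) + r))"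
      if "r \<le> n + 1" for r
      using that False less.prems by (auto simp: \<gamma>_def binary_index_def power_index_def)
    define W where "W y = (\<lambda>\<alpha>. y (Jet u 0) ^ (n\<^sup>2 + 2 * n - (n + 1)) *
        line_power (n+1) k u (y (Jet u 0)) (- y (Jet k 0)) \<gamma> \<alpha>)" for y
    have q: "(n\<^sup>2 + 2 * n - (n + 1)) + (n + 1) = n\<^sup>2 + 2 * n" using n by simp
    have "W x \<in> vertical_values n d x"
    proof (rule vertical_valuesI)
      fix \<alpha>
      have t: "weighted n (n + 1) 0 (\<lambda>y. (of_nat ((n + 1) choose r) * y (Jet u 0) ^ r * (- y (Jet k 0)) ^ (n + 1 - r)) *
          monomial (\<lambda>m. \<gamma> m + binary_index k r u (n + 1 - r) m) \<alpha>)" if "r \<in> {..n+1}" for r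
      proof -
        have "weighted n (r * 1 + (n + 1 - r) * 1) (r * 0 + (n + 1 - r) * 0) (\<lambda>y. y (Jet u 0) ^ r * (- y (Jet k 0)) ^ (n + 1 - r))"
          by (intro weighted_mult weighted_power weighted_uminus weighted_jet_0 u k)
        moreover have "r * 1 + (n + 1 - r) * 1 = n + 1" using that by simp
        ultimately have "weighted n (n + 1) 0 (\<lambda>y. y (Jet u 0) ^ r * (- y (Jet k 0)) ^ (n + 1 - r))" by simp
        from weighted_cmult[OF this, of "of_nat ((n + 1) choose r) * monomial (\<lambda>m. \<gamma> m + binary_index k r u (n + 1 - r) m) \<alpha>"]
        show ?thesis by (simp only: mult_ac)
      qed
      have "weighted n ((n\<^sup>2 + 2 * n - (n + 1)) * 1 + (n + 1)) ((n\<^sup>2 + 2 * n - (n + 1)) * 0 + 0) (\<lambda>y. W y \<alpha>)"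
        unfolding W_def line_power_def by (intro weighted_mult weighted_power weighted_jet_0 u weighted_sum t)
      moreover have e: "(n\<^sup>2 + 2 * n - (n + 1)) * 1 + (n + 1) = n\<^sup>2 + 2 * n" using q by (simp only: mult_1_right)
      ultimately show "weighted n (n\<^sup>2 + 2 * n) 0 (\<lambda>y. W y \<alpha>)" unfolding e by simp
    next
      fix y
      have "fps_nth (fps_const (y (Jet u 0)) * jet_series y k + fps_const (- y (Jet k 0)) * jet_series y u) 0 = 0"
        by (simp add: jet_series_nth)
      hence z: "agree n ((fps_const (y (Jet u 0)) * jet_series y k + fps_const (- y (Jet k 0)) * jet_series y u) ^ (n + 1)) 0"
        by (rule agree_power_zero) simp
      have "form_series n d (W y) (jet_series y) = fps_const (y (Jet u 0) ^ (n\<^sup>2 + 2 * n - (n + 1))) *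
          (series_monomial n (jet_series y) \<gamma> *
           (fps_const (y (Jet u 0)) * jet_series y k + fps_const (- y (Jet k 0)) * jet_series y u) ^ (n + 1))"
        unfolding W_def form_series_linear(2) line_power_form[OF k u \<gamma> dd] ..
      also have "agree n \<dots> (fps_const (y (Jet u 0) ^ (n\<^sup>2 + 2 * n - (n + 1))) * (series_monomial n (jet_series y) \<gamma> * 0))"
        by (intro agree_mult agree_refl z)
      finally show "agree n (form_series n d (W y) (jet_series y)) 0" by simp
    qed
    hence Wr: "reducible (W x)" by (rule reducible_vertical)
    define w where "w r = of_nat ((n + 1) choose r) * (- x (Jet k 0)) ^ (n + 1 - r)" for r
    have "W x = (\<lambda>\<alpha>. \<Sum>r\<le>n+1. w r * line_monomial (i - (n+1) + r) \<alpha>)"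
      unfolding W_def line_power_def
    proof (rule ext)
      fix \<alpha>
      have "(\<Sum>r\<le>n+1. of_nat ((n+1) choose r) * x (Jet u 0) ^ r * (- x (Jet k 0)) ^ (n+1-r) *
            monomial (\<lambda>m. \<gamma> m + binary_index k r u (n+1-r) m) \<alpha>) = (\<Sum>r\<le>n+1. w r * line_monomial (i - (n+1) + r) \<alpha>)"
        by (intro sum.cong refl) (simp only: idx atMost_iff w_def chart_spaceD(1)[OF x] power_one mult_1_right)
      thus "x (Jet u 0) ^ (n\<^sup>2 + 2 * n - (n + 1)) * (\<Sum>r\<le>n+1. of_nat ((n+1) choose r) * x (Jet u 0) ^ r * (- x (Jet k 0)) ^ (n+1-r) *
            monomial (\<lambda>m. \<gamma> m + binary_index k r u (n+1-r) m) \<alpha>) = (\<Sum>r\<le>n+1. w r * line_monomial (i - (n+1) + r) \<alpha>)"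
        by (simp only: chart_spaceD(1)[OF x] power_one mult_1_left)
    qed
    moreover have "(\<Sum>r\<le>n+1. w r * line_monomial (i - (n+1) + r) \<alpha>) =
        (\<Sum>r\<le>n. w r * line_monomial (i - (n+1) + r) \<alpha>) + line_monomial i \<alpha>" for \<alpha>
    proof -
      define g where "g r = w r * line_monomial (i - (n+1) + r) \<alpha>" for r
      have i: "i - (n+1) + (n+1) = i" using False by simp
      have "g (n + 1) = line_monomial i \<alpha>"
        unfolding g_def w_def i by (simp only: binomial_n_n diff_self_eq_0 power_0 of_nat_1 mult_1_left)
      moreover have "(\<Sum>r\<le>n+1. g r) = (\<Sum>r\<le>n. g r) + g (n + 1)" by simp
      ultimately show ?thesis by (simp only: g_def)
    qed
    ultimately have eq: "line_monomial i = (\<lambda>\<alpha>. W x \<alpha> + (-1) * (\<Sum>r\<le>n. w r * line_monomial (i - (n+1) + r) \<alpha>))"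
      by (simp add: fun_eq_iff)
    have "reducible (\<lambda>\<alpha>. \<Sum>r\<le>n. w r * line_monomial (i - (n+1) + r) \<alpha>)"
      by (rule reducible_sum, rule less.IH) (use False less.prems in auto)
    from reducible_combine[OF Wr this, of "-1"] show ?thesis unfolding eq[symmetric] .
  qed
qed

definition off_line :: "(nat \<Rightarrow> nat) \<Rightarrow> nat" where
  "off_line \<alpha> = (\<Sum>i\<in>{..n+1} - {k, u}. \<alpha> i)"

lemma off_line_0:
  assumes \<alpha>: "\<alpha> \<in> mindices (n+1) d" and 0: "off_line \<alpha> = 0"
  shows "\<alpha> k \<le> d" and "\<alpha> = binary_index k (\<alpha> k) u (d - \<alpha> k)"
proof -
  have z: "\<alpha> i = 0" if "i \<noteq> k" "i \<noteq> u" for i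
  proof (cases "i \<le> n + 1")
    case True
    have "\<forall>i\<in>{..n+1} - {k, u}. \<alpha> i = 0" using 0 unfolding off_line_def by (subst (asm) sum_eq_0_iff) auto
    thus ?thesis using True that by simp
  next
    case False
    thus ?thesis using \<alpha> by (simp add: mindices_def)
  qed
  have "(\<Sum>i\<le>n+1. \<alpha> i) = (\<Sum>i\<in>{k, u}. \<alpha> i)"
    using k u z by (intro sum.mono_neutral_right) auto
  hence s: "\<alpha> k + \<alpha> u = d" using \<alpha> ku by (simp add: mindices_def)
  thus "\<alpha> k \<le> d" by simp
  show "\<alpha> = binary_index k (\<alpha> k) u (d - \<alpha> k)"
  proof
    fix i show "\<alpha> i = binary_index k (\<alpha> k) u (d - \<alpha> k) i"
      using z[of i] s ku by (auto simp: binary_index_def power_index_def)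
  qed
qed

text \<open>
  The rewritten factor is chosen to contain a variable other than \<open>Z\<^sub>k\<close> and \<open>Z\<^sub>u\<close>, so that the number
  of such variables decreases.
\<close>

lemma reducible_monomial: "\<alpha> \<in> mindices (n+1) d \<Longrightarrow> reducible (monomial \<alpha>)"
proof (induction "off_line \<alpha>" arbitrary: \<alpha> rule: less_induct)
  case less
  show ?case
  proof (cases "off_line \<alpha> = 0")
    case True
    show ?thesis using off_line_0[OF less.prems True] reducible_line[of "\<alpha> k"] by simp
  next
    case False
    then obtain j where j: "j \<in> {..n+1} - {k, u}" "\<alpha> j \<noteq> 0"
      unfolding off_line_def by (meson sum.neutral)
    define \<alpha>' where "\<alpha>' = \<alpha>(j := \<alpha> j - 1)"
    have \<alpha>eq: "\<alpha> i = power_index j 1 i + \<alpha>' i" for i using j(2) by (simp add: \<alpha>'_def power_index_def)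
    have jn: "j \<le> n + 1" using j(1) by simp
    have "\<alpha>' \<in> mindices (n+1) (d - 1)"
    proof -
      have "(\<Sum>i\<le>n+1. \<alpha> i) = (\<Sum>i\<le>n+1. power_index j 1 i) + (\<Sum>i\<le>n+1. \<alpha>' i)" by (simp only: \<alpha>eq sum.distrib)
      moreover have "(\<Sum>i\<le>n+1. power_index j 1 i) = 1"
        using power_index_mindices[OF jn, of 1] unfolding mindices_def by blast
      moreover have "(\<Sum>i\<le>n+1. \<alpha> i) = d" using less.prems unfolding mindices_def by blast
      ultimately have "(\<Sum>i\<le>n+1. \<alpha>' i) = d - 1" by arith
      moreover have "\<forall>i>n+1. \<alpha>' i = 0" using less.prems jn by (simp add: mindices_def \<alpha>'_def)
      ultimately show ?thesis unfolding mindices_def by blast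
    qed
    moreover have "n - 1 \<le> d - 1" and dn: "d - 1 - (n - 1) = d - n" using d n by simp_all
    ultimately obtain \<beta>' \<gamma> where H: "\<beta>' \<in> mindices (n+1) (n - 1)" "\<gamma> \<in> mindices (n+1) (d - n)" "\<And>i. \<alpha>' i = \<beta>' i + \<gamma> i"
      using mindices_split[of \<alpha>' "n+1" "d - 1" "n - 1"] unfolding dn by blast
    define \<beta> where "\<beta> = (\<lambda>i. \<beta>' i + power_index j 1 i)"
    have \<beta>: "\<beta> \<in> mindices (n+1) n"
      using mindices_add[OF H(1) power_index_mindices[OF jn, of 1]] n by (simp add: \<beta>_def)
    have \<alpha>\<beta>: "\<alpha> = (\<lambda>i. \<beta> i + \<gamma> i)" by (rule ext) (simp add: \<alpha>eq H(3) \<beta>_def)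
    have nd: "n + (d - n) = d" using d by simp
    obtain V w where V: "\<And>\<alpha>. weighted n (n\<^sup>2 + 2 * n) 0 (\<lambda>x. V x \<alpha>)"
      and Vw: "\<And>x. V x = (\<lambda>\<alpha>. \<Sum>i\<le>n. w i x * monomial (\<lambda>m. \<gamma> m + binary_index k i u (n - i) m) \<alpha>)"
      and Vf: "\<And>x. agree n (form_series n d (V x) (jet_series x))
        (fps_const (bend_factor n u k x) * fps_X ^ 0 * series_monomial n (jet_series x) (\<lambda>i. \<beta> i + \<gamma> i))"
      using monomial_time_shift[OF n u k \<beta> H(2) nd, of 0] by blast
    define W where "W y = (\<lambda>\<alpha>''. monomial \<alpha> \<alpha>'' * bend_factor n u k y + (-1) * V y \<alpha>'')" for y
    have "W x \<in> vertical_values n d x"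
    proof (rule vertical_valuesI)
      show "weighted n (n\<^sup>2 + 2 * n) 0 (\<lambda>y. W y \<alpha>'')" for \<alpha>''
        unfolding W_def by (intro weighted_add weighted_cmult weighted_bend_factor n u k V)
      fix y
      have "form_series n d (W y) (jet_series y) =
          form_series n d (\<lambda>\<alpha>''. bend_factor n u k y * monomial \<alpha> \<alpha>'' + (-1) * V y \<alpha>'') (jet_series y)"
        by (intro form_series_cong refl) (simp add: W_def)
      also have "\<dots> = fps_const (bend_factor n u k y) * series_monomial n (jet_series y) \<alpha> +
          fps_const (-1) * form_series n d (V y) (jet_series y)"
        by (simp only: form_series_linear form_series_monomial[OF less.prems])
      also have "agree n \<dots> (fps_const (bend_factor n u k y) * series_monomial n (jet_series y) \<alpha> +
          fps_const (-1) * (fps_const (bend_factor n u k y) * fps_X ^ 0 * series_monomial n (jet_series y) \<alpha>))"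
        using Vf[of y] unfolding \<alpha>\<beta>[symmetric] by (intro agree_add agree_mult agree_refl)
      also have "fps_const (bend_factor n u k y) * series_monomial n (jet_series y) \<alpha> +
          fps_const (-1) * (fps_const (bend_factor n u k y) * fps_X ^ 0 * series_monomial n (jet_series y) \<alpha>) = 0"
        by (simp add: fps_const_neg[symmetric] del: fps_const_neg)
      finally show "agree n (form_series n d (W y) (jet_series y)) 0" .
    qed
    hence Wr: "reducible (W x)" by (rule reducible_vertical)
    have "reducible (\<lambda>\<alpha>''. \<Sum>i\<le>n. w i x * monomial (\<lambda>m. \<gamma> m + binary_index k i u (n - i) m) \<alpha>'')"
    proof (rule reducible_sum)
      fix i assume "i \<in> {..n}"
      hence bi: "binary_index k i u (n - i) \<in> mindices (n+1) n" using k u by (intro binary_index_mindices) auto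
      show "reducible (monomial (\<lambda>m. \<gamma> m + binary_index k i u (n - i) m))"
      proof (rule less.hyps)
        show "(\<lambda>m. \<gamma> m + binary_index k i u (n - i) m) \<in> mindices (n+1) d"
          using mindices_add[OF H(2) bi] d by simp
        have "off_line (\<lambda>m. \<gamma> m + binary_index k i u (n - i) m) = off_line \<gamma>"
          unfolding off_line_def by (intro sum.cong) (auto simp: binary_index_def power_index_def)
        moreover have "off_line \<alpha> = off_line \<beta> + off_line \<gamma>" unfolding off_line_def \<alpha>\<beta> by (rule sum.distrib)
        moreover have "\<beta> j \<le> off_line \<beta>" unfolding off_line_def using j(1) by (intro member_le_sum) auto
        moreover have "\<beta> j \<ge> 1" by (simp add: \<beta>_def power_index_def)
        ultimately show "off_line (\<lambda>m. \<gamma> m + binary_index k i u (n - i) m) < off_line \<alpha>" by linarith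
      qed
    qed
    hence Vr: "reducible (V x)" unfolding Vw .
    define \<phi> where "\<phi> = bend_factor n u k x"
    have \<phi>: "\<phi> \<noteq> 0" unfolding \<phi>_def bend_factor_chart[OF x] using moving by simp
    have "reducible (\<lambda>\<alpha>''. 0 + inverse \<phi> * (W x \<alpha>'' + 1 * V x \<alpha>''))"
      by (intro reducible_combine reducible_0 Wr Vr)
    moreover have "(\<lambda>\<alpha>''. 0 + inverse \<phi> * (W x \<alpha>'' + 1 * V x \<alpha>'')) = monomial \<alpha>"
      using \<phi> by (rule_tac ext) (simp add: W_def \<phi>_def[symmetric])
    ultimately show ?thesis by simp
  qed
qed

text \<open>
  What remains of a vanishing form after the reduction is a polynomial of degree at most \<open>n\<close> in
  \<open>z\<^sub>k\<close> that vanishes along the disc to order \<open>n\<close>; as \<open>z\<^sub>k' \<noteq> 0\<close>, it is zero.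
\<close>

lemma vanishing_forms_spanned:
  assumes B: "\<And>\<alpha>. \<alpha> \<notin> mindices (n+1) d \<Longrightarrow> B \<alpha> = 0"
    and vanish: "agree n (form_series n d B (jet_series x)) 0"
  shows "B \<in> vertical_values n d x"
proof -
  have "reducible (\<lambda>\<alpha>. \<Sum>\<beta>\<in>mindices (n+1) d. B \<beta> * monomial \<beta> \<alpha>)"
    by (intro reducible_sum reducible_monomial)
  moreover have "(\<lambda>\<alpha>. \<Sum>\<beta>\<in>mindices (n+1) d. B \<beta> * monomial \<beta> \<alpha>) = B"
  proof
    fix \<alpha>
    have "(\<Sum>\<beta>\<in>mindices (n+1) d. B \<beta> * monomial \<beta> \<alpha>) = (\<Sum>\<beta>\<in>mindices (n+1) d. if \<beta> = \<alpha> then B \<beta> else 0)"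
      by (intro sum.cong) (auto simp: monomial_def)
    thus "(\<Sum>\<beta>\<in>mindices (n+1) d. B \<beta> * monomial \<beta> \<alpha>) = B \<alpha>"
      using B[of \<alpha>] finite_mindices[of "n+1" d] by simp
  qed
  ultimately have "reducible B" by simp
  then obtain c where c: "(\<lambda>\<alpha>. B \<alpha> + (-1) * (\<Sum>i\<le>n. c i * line_monomial i \<alpha>)) \<in> vertical_values n d x"
    unfolding reducible_def by blast
  have lm: "form_series n d (line_monomial i) (jet_series x) = jet_series x k ^ i" if "i \<le> n" for i
  proof -
    have "binary_index k i u (d - i) \<in> mindices (n+1) d" using k u that d by (intro binary_index_mindices) auto
    from form_series_monomial[OF this, of "jet_series x"] show ?thesis
      unfolding series_monomial_binary_index[OF k u] using jet_series_chart_space[OF x] by simp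
  qed
  have "form_series n d (\<lambda>\<alpha>. B \<alpha> + (-1) * (\<Sum>i\<le>n. c i * line_monomial i \<alpha>)) (jet_series x) =
      form_series n d B (jet_series x) + fps_const (-1) * (\<Sum>i\<le>n. fps_const (c i) * form_series n d (line_monomial i) (jet_series x))"
    unfolding form_series_linear by (subst form_series_sum) simp_all
  also have "(\<Sum>i\<le>n. fps_const (c i) * form_series n d (line_monomial i) (jet_series x)) = (\<Sum>i\<le>n. fps_const (c i) * jet_series x k ^ i)"
    by (intro sum.cong refl) (simp add: lm)
  finally have "agree n (form_series n d B (jet_series x) + fps_const (-1) * (\<Sum>i\<le>n. fps_const (c i) * jet_series x k ^ i)) 0"
    using vertical_values_form[OF c] by simp
  from agree_diff[OF vanish this]
  have "agree n (\<Sum>i\<le>n. fps_const (c i) * jet_series x k ^ i) 0"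
    by (simp add: fps_const_neg[symmetric] del: fps_const_neg)
  hence "c i = 0" if "i \<le> n" for i
    using power_sum_injective[of "jet_series x k" n c i] that moving by (simp add: jet_series_nth)
  hence "(\<lambda>\<alpha>. B \<alpha> + (-1) * (\<Sum>i\<le>n. c i * line_monomial i \<alpha>)) = B" by simp
  thus ?thesis using c by simp
qed

end


section \<open>Sections with a prescribed value\<close>

lemma linearised_combine:
  "linearised n d x (\<lambda>i. v i + r * w i) = linearised n d x v + fps_const r * linearised n d x w"
proof -
  have j: "jet_series (\<lambda>i. v i + r * w i) k = jet_series v k + fps_const r * jet_series w k" for k
    by (rule fps_ext) (simp add: jet_series_nth add_divide_distrib)
  have 1: "form_series n d (coefs (\<lambda>i. v i + r * w i)) (jet_series x) =
      form_series n d (coefs v) (jet_series x) + fps_const r * form_series n d (coefs w) (jet_series x)"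
    unfolding form_series_linear[symmetric] by (intro form_series_cong refl) (simp add: coefs_def)
  have 2: "form_variation n d (coefs x) (jet_series x) (jet_series (\<lambda>i. v i + r * w i)) =
      form_variation n d (coefs x) (jet_series x) (jet_series v) +
      fps_const r * form_variation n d (coefs x) (jet_series x) (jet_series w)"
    unfolding form_variation_def sum_distrib_left sum.distrib[symmetric]
    by (intro sum.cong refl) (simp add: j algebra_simps)
  show ?thesis unfolding linearised_def 1 2 by (simp only: distrib_left add_ac)
qed

lemma linearised_vertical:
  assumes "\<And>k l. v (Jet k l) = 0"
  shows "linearised n d x v = form_series n d (coefs v) (jet_series x)"
proof -
  have "jet_series v = (\<lambda>k. 0)" by (rule ext, rule fps_ext) (simp add: jet_series_nth assms)
  thus ?thesis by (simp add: linearised_def form_variation_def)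
qed

definition replace_index :: "(nat \<Rightarrow> nat) \<Rightarrow> nat \<Rightarrow> nat \<Rightarrow> nat \<Rightarrow> nat" where
  "replace_index \<alpha> i u = (\<lambda>m. (\<alpha>(i := \<alpha> i - 1)) m + power_index u 1 m)"

lemma replace_index_mindices:
  assumes \<alpha>: "\<alpha> \<in> mindices m d" and i: "i \<le> m" "\<alpha> i \<noteq> 0" and u: "u \<le> m"
  shows "replace_index \<alpha> i u \<in> mindices m d"
proof -
  define \<alpha>' where "\<alpha>' = \<alpha>(i := \<alpha> i - 1)"
  have eq: "\<alpha> j = power_index i 1 j + \<alpha>' j" for j using i by (simp add: \<alpha>'_def power_index_def)
  have "(\<Sum>j\<le>m. \<alpha> j) = (\<Sum>j\<le>m. power_index i 1 j) + (\<Sum>j\<le>m. \<alpha>' j)" by (simp only: eq sum.distrib)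
  moreover have "(\<Sum>j\<le>m. power_index i 1 j) = 1" "(\<Sum>j\<le>m. power_index u 1 j) = 1"
    using power_index_mindices[OF i(1), of 1] power_index_mindices[OF u, of 1] unfolding mindices_def by blast+
  moreover have "(\<Sum>j\<le>m. \<alpha> j) = d" and z: "\<forall>j>m. \<alpha> j = 0" using \<alpha> unfolding mindices_def by blast+
  moreover have "(\<Sum>j\<le>m. replace_index \<alpha> i u j) = (\<Sum>j\<le>m. \<alpha>' j) + (\<Sum>j\<le>m. power_index u 1 j)"
    unfolding replace_index_def \<alpha>'_def by (rule sum.distrib)
  ultimately have "(\<Sum>j\<le>m. replace_index \<alpha> i u j) = d" by arith
  moreover have "\<forall>j>m. replace_index \<alpha> i u j = 0" using z i u by (auto simp: replace_index_def power_index_def)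
  ultimately show ?thesis unfolding mindices_def by blast
qed

lemma series_monomial_replace_index:
  assumes "i \<le> n + 1" "u \<le> n + 1"
  shows "series_monomial n \<zeta> (replace_index \<alpha> i u) =
    \<zeta> u * (\<zeta> i ^ (\<alpha> i - 1) * (\<Prod>j\<in>{..n+1} - {i}. \<zeta> j ^ \<alpha> j))"
proof -
  have "series_monomial n \<zeta> (\<alpha>(i := \<alpha> i - 1)) = \<zeta> i ^ (\<alpha>(i := \<alpha> i - 1)) i * (\<Prod>j\<in>{..n+1} - {i}. \<zeta> j ^ (\<alpha>(i := \<alpha> i - 1)) j)"
    unfolding series_monomial_def using assms(1) by (intro prod.remove) auto
  also have "(\<Prod>j\<in>{..n+1} - {i}. \<zeta> j ^ (\<alpha>(i := \<alpha> i - 1)) j) = (\<Prod>j\<in>{..n+1} - {i}. \<zeta> j ^ \<alpha> j)"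
    by (intro prod.cong refl) auto
  finally show ?thesis
    unfolding replace_index_def series_monomial_add
    using series_monomial_power_index[OF assms(2), of \<zeta> 1] by (simp only: fun_upd_same power_one_right mult.commute)
qed

text \<open>
  The disc moves by \<open>Z\<^sub>i \<mapsto> Z\<^sub>i + \<epsilon> C\<^sub>i(t) Z\<^sub>u\<close>, up to the factor.  The resulting variation of the
  equation is a combination of terms \<open>t\<^sup>l Z\<^sup>\<alpha>\<close>, which the forms of lemma
  \<open>form_time_shift\<close> compensate.
\<close>

lemma homogeneous_field_horizontal:
  fixes C :: "nat \<Rightarrow> complex fps" and b :: "nat \<Rightarrow> nat"
  assumes n: "n \<ge> 1" and d: "d > n" and u: "u \<le> n + 1" and k: "k \<le> n + 1"
    and C: "\<And>i m. m > n \<Longrightarrow> fps_nth (C i) m = 0"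
  defines "Zd \<equiv> \<lambda>x i. fps_const (bend_factor n u k x * x (Coef b)) * (C i * jet_series x u)"
  obtains Ad where "homogeneous_field n d (n\<^sup>2 + 2 * n) Zd Ad"
proof -
  define q where "q = n\<^sup>2 + 2 * n"
  have "\<forall>l \<alpha>. \<exists>V. \<alpha> \<in> mindices (n+1) d \<longrightarrow> (\<forall>\<alpha>'. weighted n q 0 (\<lambda>x. V x \<alpha>')) \<and>
    (\<forall>x. agree n (form_series n d (V x) (jet_series x))
       (fps_const (bend_factor n u k x) * fps_X ^ l * series_monomial n (jet_series x) \<alpha>))"
    using form_time_shift[OF n d u k] unfolding q_def by blast
  then obtain V where V: "\<forall>l \<alpha>. \<alpha> \<in> mindices (n+1) d \<longrightarrow> (\<forall>\<alpha>'. weighted n q 0 (\<lambda>x. V l \<alpha> x \<alpha>')) \<and>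
    (\<forall>x. agree n (form_series n d (V l \<alpha> x) (jet_series x))
       (fps_const (bend_factor n u k x) * fps_X ^ l * series_monomial n (jet_series x) \<alpha>))"
    unfolding choice_iff by (elim exE)
  define I where "I = (SIGMA \<alpha>:mindices (n+1) d. {i. i \<le> n + 1 \<and> \<alpha> i \<noteq> 0} \<times> {..n})"
  have I: "finite I" unfolding I_def by (auto intro!: finite_SigmaI finite_mindices)
  define w where "w t x = - x (Coef b) * (x (Coef (fst t)) * (of_nat (fst t (fst (snd t))) * fps_nth (C (fst (snd t))) (snd (snd t))))"
    for t :: "(nat \<Rightarrow> nat) \<times> nat \<times> nat" and x :: "coord \<Rightarrow> complex"
  define VV where "VV t = V (snd (snd t)) (replace_index (fst t) (fst (snd t)) u)" for t :: "(nat \<Rightarrow> nat) \<times> nat \<times> nat"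
  define Ad where "Ad x \<alpha> = (\<Sum>t\<in>I. w t x * VV t x \<alpha>)" for x \<alpha>
  have idx: "replace_index \<alpha> i u \<in> mindices (n+1) d" if "(\<alpha>, i, l) \<in> I" for \<alpha> i l
    using that u by (auto simp: I_def intro: replace_index_mindices)
  have wAd: "weighted n q 2 (\<lambda>x. Ad x \<alpha>)" for \<alpha>
    unfolding Ad_def
  proof (rule weighted_sum)
    fix t assume t: "t \<in> I"
    obtain \<alpha>0 i l where tt: "t = (\<alpha>0, i, l)" by (cases t)
    have "weighted n q 0 (\<lambda>x. VV t x \<alpha>)"
      using V idx[OF t[unfolded tt]] unfolding VV_def tt by simp
    from weighted_mult[OF weighted_mult[OF weighted_coef[of n b] weighted_mult[OF weighted_coef[of n \<alpha>0] weighted_const[of n "- (of_nat (\<alpha>0 i) * fps_nth (C i) l)"]]] this]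
    show "weighted n q 2 (\<lambda>x. w t x * VV t x \<alpha>)"
      unfolding w_def tt by (simp add: numeral_2_eq_2)
  qed
  have T1: "agree n (form_series n d (Ad x) (jet_series x) + form_variation n d (coefs x) (jet_series x) (Zd x)) 0" for x
  proof -
    define \<zeta> where "\<zeta> = jet_series x"
    define \<psi> where "\<psi> = bend_factor n u k x * x (Coef b)"
    define P where "P \<alpha> i = \<zeta> i ^ (\<alpha> i - 1) * (\<Prod>j\<in>{..n+1} - {i}. \<zeta> j ^ \<alpha> j)" for \<alpha> i
    have Ct: "(\<Sum>l\<le>n. fps_const (fps_nth (C i) l) * fps_X ^ l) = C i" for i
    proof (rule fps_ext)
      fix m
      have "fps_nth (\<Sum>l\<le>n. fps_const (fps_nth (C i) l) * fps_X ^ l) m = (\<Sum>l\<le>n. if l = m then fps_nth (C i) l else 0)"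
        unfolding fps_sum_nth by (intro sum.cong refl) (auto simp: fps_X_power_nth)
      also have "\<dots> = fps_nth (C i) m" using C[of m i] by simp
      finally show "fps_nth (\<Sum>l\<le>n. fps_const (fps_nth (C i) l) * fps_X ^ l) m = fps_nth (C i) m" .
    qed
    have "form_series n d (Ad x) \<zeta> = (\<Sum>t\<in>I. fps_const (w t x) * form_series n d (VV t x) \<zeta>)"
      unfolding Ad_def by (rule form_series_sum[OF I])
    also have "agree n \<dots> (\<Sum>t\<in>I. fps_const (w t x) * (fps_const (bend_factor n u k x) * fps_X ^ snd (snd t) *
        series_monomial n \<zeta> (replace_index (fst t) (fst (snd t)) u)))"
    proof (intro agree_sum agree_mult agree_refl)
      fix t assume t: "t \<in> I"
      obtain \<alpha>0 i l where tt: "t = (\<alpha>0, i, l)" by (cases t)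
      show "agree n (form_series n d (VV t x) \<zeta>) (fps_const (bend_factor n u k x) * fps_X ^ snd (snd t) *
        series_monomial n \<zeta> (replace_index (fst t) (fst (snd t)) u))"
        using V idx[OF t[unfolded tt]] unfolding VV_def tt \<zeta>_def by simp
    qed
    also have "(\<Sum>t\<in>I. fps_const (w t x) * (fps_const (bend_factor n u k x) * fps_X ^ snd (snd t) *
        series_monomial n \<zeta> (replace_index (fst t) (fst (snd t)) u))) =
        (\<Sum>\<alpha>\<in>mindices (n+1) d. \<Sum>(i, l)\<in>{i. i \<le> n + 1 \<and> \<alpha> i \<noteq> 0} \<times> {..n}.
          - (fps_const (x (Coef \<alpha>)) * (of_nat (\<alpha> i) * (fps_const \<psi> * (fps_const (fps_nth (C i) l) * fps_X ^ l * \<zeta> u)) * P \<alpha> i)))"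
    proof -
      define f where "f t = fps_const (w t x) * (fps_const (bend_factor n u k x) * fps_X ^ snd (snd t) *
        series_monomial n \<zeta> (replace_index (fst t) (fst (snd t)) u))" for t
      have "(\<Sum>\<alpha>\<in>mindices (n+1) d. \<Sum>t\<in>{i. i \<le> n + 1 \<and> \<alpha> i \<noteq> 0} \<times> {..n}. f (\<alpha>, t)) = (\<Sum>(\<alpha>, t)\<in>I. f (\<alpha>, t))"
        unfolding I_def by (rule sum.Sigma) (auto intro: finite_mindices)
      also have "\<dots> = (\<Sum>t\<in>I. f t)" by (simp add: case_prod_beta)
      finally have Sf: "(\<Sum>t\<in>I. f t) = (\<Sum>\<alpha>\<in>mindices (n+1) d. \<Sum>t\<in>{i. i \<le> n + 1 \<and> \<alpha> i \<noteq> 0} \<times> {..n}. f (\<alpha>, t))" ..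
      show ?thesis
        unfolding f_def[symmetric] Sf
      proof (intro sum.cong refl, goal_cases)
        case (1 \<alpha> t)
        then obtain i l where t: "t = (i, l)" and i: "i \<le> n + 1" by (cases t) auto
        have wt: "fps_const (w (\<alpha>, i, l) x) * fps_const (bend_factor n u k x) =
            - (fps_const (x (Coef \<alpha>)) * (of_nat (\<alpha> i) * (fps_const \<psi> * fps_const (fps_nth (C i) l))))"
          by (simp add: w_def \<psi>_def fps_of_nat[symmetric] mult_ac)
        have "f (\<alpha>, t) = (fps_const (w (\<alpha>, i, l) x) * fps_const (bend_factor n u k x)) * (fps_X ^ l * (\<zeta> u * P \<alpha> i))"
          unfolding f_def t fst_conv snd_conv series_monomial_replace_index[OF i u] P_def by (simp only: mult_ac)
        thus ?case unfolding wt by (simp add: t mult_ac)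
      qed
    qed
    also have "\<dots> = - form_variation n d (coefs x) \<zeta> (Zd x)"
    proof -
      have "(\<Sum>(i, l)\<in>{i. i \<le> n + 1 \<and> \<alpha> i \<noteq> 0} \<times> {..n}.
          - (fps_const (x (Coef \<alpha>)) * (of_nat (\<alpha> i) * (fps_const \<psi> * (fps_const (fps_nth (C i) l) * fps_X ^ l * \<zeta> u)) * P \<alpha> i))) =
          - (fps_const (x (Coef \<alpha>)) * (\<Sum>i\<le>n+1. of_nat (\<alpha> i) * Zd x i * P \<alpha> i))" for \<alpha>
      proof -
        have "(\<Sum>(i, l)\<in>{i. i \<le> n + 1 \<and> \<alpha> i \<noteq> 0} \<times> {..n}.
          - (fps_const (x (Coef \<alpha>)) * (of_nat (\<alpha> i) * (fps_const \<psi> * (fps_const (fps_nth (C i) l) * fps_X ^ l * \<zeta> u)) * P \<alpha> i))) =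
          (\<Sum>i\<in>{i. i \<le> n + 1 \<and> \<alpha> i \<noteq> 0}. \<Sum>l\<le>n.
          - (fps_const (x (Coef \<alpha>)) * (of_nat (\<alpha> i) * (fps_const \<psi> * (fps_const (fps_nth (C i) l) * fps_X ^ l * \<zeta> u)) * P \<alpha> i)))"
          by (rule sum.cartesian_product[symmetric])
        also have "\<dots> = (\<Sum>i\<in>{i. i \<le> n + 1 \<and> \<alpha> i \<noteq> 0}. - (fps_const (x (Coef \<alpha>)) *
            (of_nat (\<alpha> i) * (fps_const \<psi> * ((\<Sum>l\<le>n. fps_const (fps_nth (C i) l) * fps_X ^ l) * \<zeta> u)) * P \<alpha> i)))"
          by (simp only: sum_negf sum_distrib_left sum_distrib_right)
        also have "\<dots> = (\<Sum>i\<in>{i. i \<le> n + 1 \<and> \<alpha> i \<noteq> 0}. - (fps_const (x (Coef \<alpha>)) * (of_nat (\<alpha> i) * Zd x i * P \<alpha> i)))"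
          unfolding Ct by (simp only: Zd_def \<psi>_def \<zeta>_def)
        also have "\<dots> = (\<Sum>i\<le>n+1. - (fps_const (x (Coef \<alpha>)) * (of_nat (\<alpha> i) * Zd x i * P \<alpha> i)))"
          by (rule sum.mono_neutral_left) auto
        finally show ?thesis by (simp only: sum_negf sum_distrib_left)
      qed
      thus ?thesis unfolding form_variation_def by (simp only: sum_negf P_def coefs_def mult.assoc)
    qed
    finally have "agree n (form_series n d (Ad x) \<zeta>) (- form_variation n d (coefs x) \<zeta> (Zd x))" .
    from agree_add[OF this agree_refl[of n "form_variation n d (coefs x) \<zeta> (Zd x)"]]
    show ?thesis by (simp add: \<zeta>_def)
  qed
  have wb: "weighted n (q + 0) (0 + 1) (\<lambda>x. bend_factor n u k x * x (Coef b))"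
    unfolding q_def by (intro weighted_mult weighted_bend_factor weighted_coef n u k)
  have "homogeneous_field n d q Zd Ad"
    unfolding homogeneous_field_def
  proof (intro conjI allI impI)
    show "poly_series (\<lambda>x. Zd x i)" for i
      unfolding Zd_def
      by (intro poly_series_mult poly_series_const poly_series_fixed poly_series_jet weighted_poly[OF wb])
    show "weighted n q 2 (\<lambda>x. Ad x \<alpha>)" for \<alpha> by (rule wAd)
    fix x
    show "agree n (form_series n d (Ad x) (jet_series x) + form_variation n d (coefs x) (jet_series x) (Zd x)) 0" by (rule T1)
    show "(\<forall>i. Zd x i = 0) \<or> (\<exists>u k. u \<le> n + 1 \<and> k \<le> n + 1 \<and> bend u k x \<noteq> 0)"
    proof (cases "bend u k x = 0")
      case True
      have "(n + 1) * n div 2 \<noteq> 0" using n by (cases n) auto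
      hence "bend_factor n u k x = 0" using True by (simp add: bend_factor_def)
      thus ?thesis by (simp add: Zd_def)
    qed (use u k in blast)
  next
    fix \<rho> \<mu> x y i assume r: "rescaled n \<rho> \<mu> x y" and i: "i \<le> n + 1"
    have "bend_factor n u k y * y (Coef b) = fps_nth \<rho> 0 ^ q * \<mu> * (bend_factor n u k x * x (Coef b))"
      using weightedD[OF wb r] by simp
    hence "Zd y i = fps_const (fps_nth \<rho> 0 ^ q * \<mu> * (bend_factor n u k x * x (Coef b))) * (C i * jet_series y u)"
      by (simp only: Zd_def)
    also have "agree n \<dots> (fps_const (fps_nth \<rho> 0 ^ q * \<mu> * (bend_factor n u k x * x (Coef b))) * (C i * (\<rho> * jet_series x u)))"
      using r u by (intro agree_mult agree_refl) (simp add: rescaled_def)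
    also have "\<dots> = fps_const (fps_nth \<rho> 0 ^ q * \<mu>) * \<rho> * Zd x i"
      unfolding Zd_def by (simp only: fps_const_mult[symmetric] mult_ac)
    finally show "agree n (Zd y i) (fps_const (fps_nth \<rho> 0 ^ q * \<mu>) * \<rho> * Zd x i)" .
  qed
  thus ?thesis unfolding q_def by (rule that)
qed

lemma homogeneous_field_add_vertical:
  assumes F: "homogeneous_field n d q Zd Ad" and W: "\<And>\<alpha>. weighted n q 0 (\<lambda>y. W y \<alpha>)"
    and Wf: "\<And>y. agree n (form_series n d (W y) (jet_series y)) 0"
  shows "homogeneous_field n d q Zd (\<lambda>y \<alpha>. Ad y \<alpha> + y (Coef b) ^ 2 * W y \<alpha>)"
proof -
  have "weighted n q 2 (\<lambda>y. Ad y \<alpha> + y (Coef b) ^ 2 * W y \<alpha>)" for \<alpha>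
  proof -
    have "weighted n (2 * 0 + q) (2 * 1 + 0) (\<lambda>y. y (Coef b) ^ 2 * W y \<alpha>)"
      by (intro weighted_mult weighted_power weighted_coef W)
    thus ?thesis using F unfolding homogeneous_field_def by (intro weighted_add) auto
  qed
  moreover have "agree n (form_series n d (\<lambda>\<alpha>. Ad x \<alpha> + x (Coef b) ^ 2 * W x \<alpha>) (jet_series x) +
        form_variation n d (coefs x) (jet_series x) (Zd x)) 0" for x
  proof -
    have "agree n (form_series n d (Ad x) (jet_series x) + form_variation n d (coefs x) (jet_series x) (Zd x) +
        fps_const (x (Coef b) ^ 2) * form_series n d (W x) (jet_series x)) (0 + fps_const (x (Coef b) ^ 2) * 0)"
      using F unfolding homogeneous_field_def by (intro agree_add agree_mult agree_refl Wf) blast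
    thus ?thesis unfolding form_series_linear by (simp add: add_ac)
  qed
  ultimately show ?thesis using F unfolding homogeneous_field_def by blast
qed

text \<open>
  In a chart with \<open>Z\<^sub>u = 1\<close> a horizontal field matches the jet components of \<open>v\<close>.  The difference is
  a form vanishing along the disc, hence the value of a vertical field.
\<close>

lemma field_with_value:
  assumes n: "n \<ge> 1" and d: "d > n" and c: "(u, b) \<in> charts n d"
    and p: "p \<in> Jvert n d \<inter> chart_dom n d (u, b)"
    and k: "k \<le> n + 1" "chart_map n d (u, b) p (Jet k 1) \<noteq> 0"
    and v: "v \<in> tangent_space n d (u, b) p"
  obtains T where "twisted_section n d (n\<^sup>2 + 2 * n) 1 T" "T (u, b) p = v"
proof -
  define x where "x = chart_map n d (u, b) p"
  have xs: "x \<in> chart_space n d (u, b)" using chart_map_in_space[OF c] p by (simp add: x_def)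
  have u: "u \<le> n + 1" and b: "b \<in> mindices (n+1) d" using c by (simp_all add: charts_def)
  have moving: "x (Jet k 1) \<noteq> 0" using k(2) by (simp add: x_def)
  have ku: "k \<noteq> u" using moving chart_spaceD(4)[OF xs, of 1] by auto
  have vv: "v \<in> chart_vecs n d (u, b)" using v by (simp add: tangent_space_def)
  define \<phi> where "\<phi> = bend_factor n u k x"
  have \<phi>: "\<phi> \<noteq> 0" unfolding \<phi>_def bend_factor_chart[OF xs] using moving by simp
  define C where "C i = Abs_fps (\<lambda>m. if m \<le> n \<and> i \<le> n + 1 then v (Jet i m) / fact m / \<phi> else 0)" for i
  define Zd where "Zd = (\<lambda>x i. fps_const (bend_factor n u k x * x (Coef b)) * (C i * jet_series x u))"
  obtain Ad where F: "homogeneous_field n d (n\<^sup>2 + 2 * n) Zd Ad"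
    using homogeneous_field_horizontal[OF n d u k(1), of C b] unfolding Zd_def by (auto simp: C_def)
  define s where "s = field_vec n d Zd Ad (u, b) x"
  have Zx: "Zd x i = fps_const \<phi> * C i" for i
    unfolding Zd_def jet_series_chart_space[OF xs] using chart_spaceD(2)[OF xs] by (simp add: \<phi>_def)
  have Cu: "C u = 0" by (rule fps_ext) (simp add: C_def chart_vecsD(1)[OF vv])
  have jets: "field_vec n d Zd A (u, b) x (Jet i m) = v (Jet i m)" for A i m
  proof (cases "Jet i m \<in> free_coords n d (u, b)")
    case True
    hence "i \<le> n + 1" "m \<le> n" by (auto simp: free_coords_def)
    thus ?thesis using True \<phi> by (simp add: field_vec_def Zx Cu) (simp add: C_def)
  next
    case False
    thus ?thesis using vv by (simp add: field_vec_def chart_vecs_def)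
  qed
  define r where "r = (\<lambda>i. v i + (-1) * s i)"
  have rj: "r (Jet i m) = 0" for i m by (simp add: r_def s_def jets)
  have "s \<in> tangent_space n d (u, b) p"
    unfolding s_def x_def by (rule field_vec_tangent[OF n d F c p])
  hence "agree n (linearised n d x v + fps_const (-1) * linearised n d x s) (0 + fps_const (-1) * 0)"
    unfolding x_def using tangent_space_linearised[OF v c] tangent_space_linearised[OF _ c]
    by (intro agree_add agree_mult agree_refl)
  hence "agree n (linearised n d x r) 0" unfolding r_def linearised_combine by simp
  hence rf: "agree n (form_series n d (coefs r) (jet_series x)) 0"
    unfolding linearised_vertical[of r, OF rj] .
  have sv: "s \<in> chart_vecs n d (u, b)" unfolding s_def by (rule field_vec_chart_vecs)
  have r0: "coefs r \<alpha> = 0" if "\<alpha> \<notin> mindices (n+1) d" for \<alpha>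
    using chart_vecsD(3)[OF vv that] chart_vecsD(3)[OF sv that] by (simp add: coefs_def r_def)
  have rb: "coefs r b = 0"
    using chart_vecsD(2)[OF vv] chart_vecsD(2)[OF sv] by (simp add: coefs_def r_def)
  have "coefs r \<in> vertical_values n d x"
    by (rule vanishing_forms_spanned[OF n d u k(1) ku xs moving r0 rf])
  then obtain W where W: "\<And>\<alpha>. weighted n (n\<^sup>2 + 2 * n) 0 (\<lambda>y. W y \<alpha>)"
    "\<And>y. agree n (form_series n d (W y) (jet_series y)) 0" "W x = coefs r"
    unfolding vertical_values_def by blast
  define A where "A = (\<lambda>y \<alpha>. Ad y \<alpha> + y (Coef b) ^ 2 * W y \<alpha>)"
  have FA: "homogeneous_field n d (n\<^sup>2 + 2 * n) Zd A"
    unfolding A_def by (rule homogeneous_field_add_vertical[OF F W(1,2)])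
  have "field_vec n d Zd A (u, b) x i = v i" for i
  proof (cases i)
    case (Jet k m)
    thus ?thesis using jets by simp
  next
    case (Coef \<alpha>)
    show ?thesis
    proof (cases "\<alpha> \<in> mindices (n+1) d")
      case True
      have "field_vec n d Zd A (u, b) x i = A x \<alpha> - x (Coef \<alpha>) * A x b"
        unfolding Coef by (rule field_vec_coefs[OF xs True])
      also have "\<dots> = (Ad x \<alpha> - x (Coef \<alpha>) * Ad x b) + coefs r \<alpha>"
        using chart_spaceD(2)[OF xs] rb by (simp add: A_def W(3))
      also have "Ad x \<alpha> - x (Coef \<alpha>) * Ad x b = s (Coef \<alpha>)"
        unfolding s_def by (rule field_vec_coefs[OF xs True, symmetric])
      finally show ?thesis by (simp add: Coef coefs_def r_def)
    next
      case False
      thus ?thesis using Coef chart_vecsD(3)[OF vv False] chart_vecsD(3)[OF field_vec_chart_vecs False] by simp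
    qed
  qed
  hence "field_section n d Zd A (u, b) p = v" unfolding field_section_def x_def[symmetric] by (rule ext)
  with field_section_twisted[OF n d FA] show ?thesis by (rule that)
qed


section \<open>Frames\<close>

lemma frame_coordinates:
  assumes "finite S" shows "\<exists>T. is_frame (card S) T {v. \<forall>i. i \<notin> S \<longrightarrow> v i = 0}"
proof -
  obtain h where h: "bij_betw h {0..<card S} S" using ex_bij_betw_nat_finite[OF assms] by blast
  define T where "T l = (\<lambda>i. if i = h l then 1 else 0 :: complex)" for l
  have hS: "h l \<in> S" if "l < card S" for l using h that by (auto simp: bij_betw_def)
  have sum: "(\<Sum>l<card S. w l * T l (h m)) = w m" if m: "m < card S" for w :: "nat \<Rightarrow> complex" and m
  proof -
    have "(\<Sum>l<card S. w l * T l (h m)) = (\<Sum>l<card S. if l = m then w l else 0)"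
    proof (intro sum.cong refl)
      fix l assume "l \<in> {..<card S}"
      hence "h m = h l \<longleftrightarrow> l = m" using h m by (auto simp: bij_betw_def inj_on_def)
      thus "w l * T l (h m) = (if l = m then w l else 0)" by (simp add: T_def)
    qed
    thus ?thesis using m by simp
  qed
  have out: "(\<Sum>l<card S. w l * T l i) = 0" if "i \<notin> S" for w :: "nat \<Rightarrow> complex" and i
    using that hS by (intro sum.neutral) (auto simp: T_def)
  have rep: "v = (\<lambda>i. \<Sum>l<card S. v (h l) * T l i)" if "\<forall>i. i \<notin> S \<longrightarrow> v i = 0" for v
  proof
    fix i show "v i = (\<Sum>l<card S. v (h l) * T l i)"
    proof (cases "i \<in> S")
      case True
      hence "i \<in> h ` {0..<card S}" using h by (simp add: bij_betw_def)
      then obtain m where "m < card S" "i = h m" by auto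
      thus ?thesis using sum[of m "\<lambda>l. v (h l)"] by simp
    next
      case False
      thus ?thesis using out[of i "\<lambda>l. v (h l)"] that by simp
    qed
  qed
  have "{v. \<forall>i. i \<notin> S \<longrightarrow> v i = 0} = {v. \<exists>w::nat \<Rightarrow> complex. v = (\<lambda>i. \<Sum>l<card S. w l * T l i)}"
  proof (intro set_eqI iffI; unfold mem_Collect_eq)
    fix v :: "coord \<Rightarrow> complex" assume "\<forall>i. i \<notin> S \<longrightarrow> v i = 0"
    from rep[OF this] show "\<exists>w::nat \<Rightarrow> complex. v = (\<lambda>i. \<Sum>l<card S. w l * T l i)"
      by (rule exI[of _ "\<lambda>l. v (h l)"])
  next
    fix v :: "coord \<Rightarrow> complex" assume "\<exists>w::nat \<Rightarrow> complex. v = (\<lambda>i. \<Sum>l<card S. w l * T l i)"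
    thus "\<forall>i. i \<notin> S \<longrightarrow> v i = 0" using out by (elim exE) simp
  qed
  moreover have "\<forall>l<card S. w l = 0" if "\<forall>i. (\<Sum>l<card S. w l * T l i) = 0" for w :: "nat \<Rightarrow> complex"
    using sum[of _ w] that by simp
  ultimately show ?thesis unfolding is_frame_def by blast
qed

definition linear_functional :: "((coord \<Rightarrow> complex) \<Rightarrow> complex) \<Rightarrow> bool" where
  "linear_functional f \<longleftrightarrow> (\<forall>v w r. f (\<lambda>i. v i + r * w i) = f v + r * f w)"

lemma linear_functionalD: "linear_functional f \<Longrightarrow> f (\<lambda>i. v i + r * w i) = f v + r * f w"
  by (simp add: linear_functional_def)

lemma linear_functional_0: "linear_functional f \<Longrightarrow> f (\<lambda>_. 0) = 0"
  using linear_functionalD[of f "\<lambda>_. 0" 1 "\<lambda>_. 0"] by simp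

lemma linear_functional_sum:
  fixes k :: nat
  assumes f: "linear_functional f"
  shows "f (\<lambda>i. \<Sum>l<k. w l * T l i) = (\<Sum>l<k. w l * f (T l))"
proof (induction k)
  case 0
  show ?case using linear_functional_0[OF f] by simp
next
  case (Suc k)
  have "f (\<lambda>i. (\<Sum>l<k. w l * T l i) + w k * T k i) = f (\<lambda>i. \<Sum>l<k. w l * T l i) + w k * f (T k)"
    by (rule linear_functionalD[OF f])
  thus ?case using Suc by simp
qed

lemma frame_permute:
  assumes F: "is_frame k T V" and \<pi>: "bij_betw \<pi> {..<k} {..<k}"
  shows "is_frame k (T \<circ> \<pi>) V"
proof -
  obtain \<sigma> where \<sigma>: "bij_betw \<sigma> {..<k} {..<k}" "\<And>l. l < k \<Longrightarrow> \<sigma> (\<pi> l) = l" "\<And>l. l < k \<Longrightarrow> \<pi> (\<sigma> l) = l"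
  proof
    show "bij_betw (inv_into {..<k} \<pi>) {..<k} {..<k}" by (rule bij_betw_inv_into[OF \<pi>])
    show "inv_into {..<k} \<pi> (\<pi> l) = l" if "l < k" for l using bij_betw_inv_into_left[OF \<pi>] that by simp
    show "\<pi> (inv_into {..<k} \<pi> l) = l" if "l < k" for l using bij_betw_inv_into_right[OF \<pi>] that by simp
  qed
  have s: "(\<Sum>l<k. w (\<pi> l) * (T \<circ> \<pi>) l i) = (\<Sum>l<k. w l * T l i)" for w :: "nat \<Rightarrow> complex" and i
    using sum.reindex_bij_betw[OF \<pi>, of "\<lambda>l. w l * T l i"] by simp
  have s': "(\<Sum>l<k. w l * (T \<circ> \<pi>) l i) = (\<Sum>l<k. w (\<sigma> l) * T l i)" for w :: "nat \<Rightarrow> complex" and i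
  proof -
    have "(\<Sum>l<k. w l * (T \<circ> \<pi>) l i) = (\<Sum>l<k. w (\<sigma> (\<pi> l)) * (T \<circ> \<pi>) l i)" using \<sigma>(2) by (intro sum.cong) auto
    thus ?thesis using s[of "\<lambda>l. w (\<sigma> l)"] by simp
  qed
  have V: "V = {v. \<exists>w::nat \<Rightarrow> complex. v = (\<lambda>i. \<Sum>l<k. w l * T l i)}" using F by (simp add: is_frame_def)
  have "V = {v. \<exists>w::nat \<Rightarrow> complex. v = (\<lambda>i. \<Sum>l<k. w l * (T \<circ> \<pi>) l i)}"
  proof (intro set_eqI iffI)
    fix v assume "v \<in> V"
    then obtain w :: "nat \<Rightarrow> complex" where "v = (\<lambda>i. \<Sum>l<k. w l * T l i)" unfolding V by blast
    hence "v = (\<lambda>i. \<Sum>l<k. w (\<pi> l) * (T \<circ> \<pi>) l i)" unfolding s .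
    thus "v \<in> {v. \<exists>w::nat \<Rightarrow> complex. v = (\<lambda>i. \<Sum>l<k. w l * (T \<circ> \<pi>) l i)}"
      unfolding mem_Collect_eq by (rule exI[of _ "\<lambda>l. w (\<pi> l)"])
  next
    fix v assume "v \<in> {v. \<exists>w::nat \<Rightarrow> complex. v = (\<lambda>i. \<Sum>l<k. w l * (T \<circ> \<pi>) l i)}"
    then obtain w :: "nat \<Rightarrow> complex" where "v = (\<lambda>i. \<Sum>l<k. w l * (T \<circ> \<pi>) l i)" by blast
    hence "v = (\<lambda>i. \<Sum>l<k. w (\<sigma> l) * T l i)" unfolding s' .
    thus "v \<in> V" unfolding V mem_Collect_eq by (rule exI[of _ "\<lambda>l. w (\<sigma> l)"])
  qed
  moreover have "\<forall>l<k. w l = 0" if "\<forall>i. (\<Sum>l<k. w l * (T \<circ> \<pi>) l i) = 0" for w :: "nat \<Rightarrow> complex"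
  proof -
    have "\<forall>i. (\<Sum>l<k. w (\<sigma> l) * T l i) = 0" using that unfolding s' .
    hence z: "w (\<sigma> l) = 0" if "l < k" for l
      using F that unfolding is_frame_def by (elim conjE allE[of _ "\<lambda>l. w (\<sigma> l)"]) blast
    show ?thesis
    proof (intro allI impI)
      fix l assume l: "l < k"
      hence "\<pi> l < k" using \<pi> by (auto simp: bij_betw_def)
      from z[OF this] show "w l = 0" using \<sigma>(2)[OF l] by simp
    qed
  qed
  ultimately show ?thesis unfolding is_frame_def by blast
qed

text \<open>Eliminate a frame vector on which \<open>f\<close> does not vanish.\<close>

lemma frame_hyperplane:
  assumes F: "is_frame (Suc k) T V" and f: "linear_functional f" and v0: "v0 \<in> V" "f v0 \<noteq> 0"
  shows "\<exists>T'. is_frame k T' {v \<in> V. f v = 0}"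
proof -
  have "\<exists>m<Suc k. f (T m) \<noteq> 0"
  proof (rule ccontr)
    assume "\<not> (\<exists>m<Suc k. f (T m) \<noteq> 0)"
    moreover obtain w :: "nat \<Rightarrow> complex" where "v0 = (\<lambda>i. \<Sum>l<Suc k. w l * T l i)"
      using F v0(1) unfolding is_frame_def by blast
    ultimately have "f v0 = (\<Sum>l<Suc k. w l * 0)"
      using linear_functional_sum[OF f, of w T "Suc k"] by simp
    thus False using v0(2) by simp
  qed
  then obtain m where m: "m < Suc k" "f (T m) \<noteq> 0" by blast
  define \<pi> where "\<pi> l = (if l = m then k else if l = k then m else l)" for l
  have "bij_betw \<pi> {..<Suc k} {..<Suc k}"
    by (rule bij_betw_byWitness[where f' = \<pi>]) (use m(1) in \<open>auto simp: \<pi>_def\<close>)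
  from frame_permute[OF F this] have F1: "is_frame (Suc k) (T \<circ> \<pi>) V" .
  define S where "S = T \<circ> \<pi>"
  have Sk: "f (S k) \<noteq> 0" using m(2) by (auto simp: S_def \<pi>_def)
  have V: "V = {v. \<exists>w::nat \<Rightarrow> complex. v = (\<lambda>i. \<Sum>l<Suc k. w l * S l i)}"
    and ind: "\<And>w::nat \<Rightarrow> complex. \<forall>i. (\<Sum>l<Suc k. w l * S l i) = 0 \<Longrightarrow> \<forall>l<Suc k. w l = 0"
    using F1 unfolding is_frame_def S_def by blast+
  define T' where "T' l = (\<lambda>i. S l i - f (S l) / f (S k) * S k i)" for l
  have extend: "(\<Sum>l<k. w l * T' l i) = (\<Sum>l<Suc k. (if l < k then w l else - (\<Sum>j<k. w j * f (S j)) / f (S k)) * S l i)"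
    for w :: "nat \<Rightarrow> complex" and i
  proof -
    have "(\<Sum>l<k. w l * T' l i) = (\<Sum>l<k. w l * S l i) - (\<Sum>j<k. w j * f (S j)) / f (S k) * S k i"
      by (simp add: T'_def algebra_simps sum_subtractf sum_divide_distrib sum_distrib_left sum_distrib_right)
    thus ?thesis by simp
  qed
  have "{v \<in> V. f v = 0} = {v. \<exists>w::nat \<Rightarrow> complex. v = (\<lambda>i. \<Sum>l<k. w l * T' l i)}"
  proof (intro set_eqI iffI)
    fix v assume "v \<in> {v \<in> V. f v = 0}"
    then obtain w :: "nat \<Rightarrow> complex" where w: "v = (\<lambda>i. \<Sum>l<Suc k. w l * S l i)" and fv: "f v = 0"
      unfolding V by blast
    have "(\<Sum>l<k. w l * f (S l)) + w k * f (S k) = 0"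
      using fv linear_functional_sum[OF f, of w S "Suc k"] unfolding w by simp
    hence wk: "w k = - (\<Sum>j<k. w j * f (S j)) / f (S k)" using Sk by (simp add: field_simps add_eq_0_iff2)
    have "v = (\<lambda>i. \<Sum>l<k. w l * T' l i)"
      unfolding extend w
      by (intro ext sum.cong refl arg_cong2[of _ _ _ _ "(*)"]) (auto simp: wk less_Suc_eq)
    thus "v \<in> {v. \<exists>w::nat \<Rightarrow> complex. v = (\<lambda>i. \<Sum>l<k. w l * T' l i)}" by blast
  next
    fix v assume "v \<in> {v. \<exists>w::nat \<Rightarrow> complex. v = (\<lambda>i. \<Sum>l<k. w l * T' l i)}"
    then obtain w :: "nat \<Rightarrow> complex" where w: "v = (\<lambda>i. \<Sum>l<k. w l * T' l i)" by blast
    have "f (T' l) = 0" for l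
    proof -
      have "f (\<lambda>i. S l i + (- (f (S l) / f (S k))) * S k i) = f (S l) + (- (f (S l) / f (S k))) * f (S k)"
        by (rule linear_functionalD[OF f])
      thus ?thesis using Sk by (simp add: T'_def)
    qed
    hence "f v = 0" unfolding w linear_functional_sum[OF f] by simp
    moreover have "v \<in> V"
      unfolding w extend V mem_Collect_eq
      by (rule exI[of _ "\<lambda>l. if l < k then w l else - (\<Sum>j<k. w j * f (S j)) / f (S k)"]) (rule refl)
    ultimately show "v \<in> {v \<in> V. f v = 0}" by simp
  qed
  moreover have "\<forall>l<k. w l = 0" if "\<forall>i. (\<Sum>l<k. w l * T' l i) = 0" for w :: "nat \<Rightarrow> complex"
  proof -
    have "\<forall>i. (\<Sum>l<Suc k. (if l < k then w l else - (\<Sum>j<k. w j * f (S j)) / f (S k)) * S l i) = 0"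
      using that unfolding extend .
    hence "\<forall>l<Suc k. (if l < k then w l else - (\<Sum>j<k. w j * f (S j)) / f (S k)) = 0" by (rule ind)
    thus ?thesis by (metis less_SucI)
  qed
  ultimately show ?thesis unfolding is_frame_def by blast
qed

lemma frame_kernel:
  assumes F: "is_frame k0 T V" and V: "V = {v. \<forall>i. i \<notin> S \<longrightarrow> v i = 0}"
    and f: "\<And>m. m < r \<Longrightarrow> linear_functional (f m)"
    and e: "\<And>m. m < r \<Longrightarrow> e m \<in> V" "\<And>m l. m < r \<Longrightarrow> l < r \<Longrightarrow> f l (e m) = (if l = m then 1 else 0)"
  shows "m \<le> r \<Longrightarrow> m \<le> k0 \<and> (\<exists>T'. is_frame (k0 - m) T' {v \<in> V. \<forall>l<m. f l v = 0})"
proof (induction m)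
  case 0
  show ?case using F by auto
next
  case (Suc m)
  then obtain T' where T': "is_frame (k0 - m) T' {v \<in> V. \<forall>l<m. f l v = 0}" and mk: "m \<le> k0" by auto
  have em: "e m \<in> {v \<in> V. \<forall>l<m. f l v = 0}" "f m (e m) = 1" using e Suc.prems by auto
  have "k0 - m \<noteq> 0"
  proof
    assume "k0 - m = 0"
    hence "{v \<in> V. \<forall>l<m. f l v = 0} = {\<lambda>_. 0}" using T' by (simp add: is_frame_def)
    hence "e m = (\<lambda>_. 0)" using em(1) by blast
    thus False using em(2) linear_functional_0[OF f[of m]] Suc.prems by simp
  qed
  hence k: "k0 - m = Suc (k0 - Suc m)" by simp
  have "\<exists>T'. is_frame (k0 - Suc m) T' {v \<in> {v \<in> V. \<forall>l<m. f l v = 0}. f m v = 0}"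
    by (rule frame_hyperplane[OF T'[unfolded k] f em(1)]) (use Suc.prems em(2) in auto)
  moreover have "{v \<in> {v \<in> V. \<forall>l<m. f l v = 0}. f m v = 0} = {v \<in> V. \<forall>l<Suc m. f l v = 0}"
    by (auto simp: less_Suc_eq)
  ultimately show ?case using k by simp
qed


section \<open>Smoothness away from the exceptional locus\<close>

lemma linear_functional_linearised: "linear_functional (\<lambda>v. fps_nth (linearised n d x v) m)"
  unfolding linear_functional_def by (simp add: linearised_combine)

text \<open>
  The forms whose values along the disc are the powers of the time, corrected by multiples of the
  given form so as to preserve the normalisation.
\<close>

lemma dual_vectors:
  assumes n: "n \<ge> 1" and d: "d > n" and c: "(u, b) \<in> charts n d"
    and p: "p \<in> Jvert n d \<inter> chart_dom n d (u, b)"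
    and k: "k \<le> n + 1" "chart_map n d (u, b) p (Jet k 1) \<noteq> 0"
  obtains e where "\<And>m. e m \<in> chart_vecs n d (u, b)"
    "\<And>m l. l \<le> n \<Longrightarrow> fps_nth (linearised n d (chart_map n d (u, b) p) (e m)) l = (if l = m then 1 else 0)"
proof -
  define x where "x = chart_map n d (u, b) p"
  have xs: "x \<in> chart_space n d (u, b)" using chart_map_in_space[OF c] p by (simp add: x_def)
  have xc: "in_cone n d x" using Jvert_iff[OF c, of p] p unfolding x_def by blast
  have u: "u \<le> n + 1" and b: "b \<in> mindices (n+1) d" using c by (simp_all add: charts_def)
  define \<phi> where "\<phi> = bend_factor n u k x"
  have \<phi>: "\<phi> \<noteq> 0" unfolding \<phi>_def bend_factor_chart[OF xs] using k(2) by (simp add: x_def)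
  have mono: "series_monomial n (jet_series x) (power_index u d) = 1"
    using series_monomial_power_index[OF u, of "jet_series x" d] jet_series_chart_space[OF xs] by simp
  have "\<forall>m. \<exists>B. (\<forall>\<alpha>. \<alpha> \<notin> mindices (n+1) d \<longrightarrow> B \<alpha> = 0) \<and>
      agree n (form_series n d B (jet_series x)) (fps_const \<phi> * fps_X ^ m)"
  proof
    fix m
    obtain V where V: "\<forall>x \<alpha>'. \<alpha>' \<notin> mindices (n+1) d \<longrightarrow> V x \<alpha>' = 0"
      "\<forall>x. agree n (form_series n d (V x) (jet_series x))
       (fps_const (bend_factor n u k x) * fps_X ^ m * series_monomial n (jet_series x) (power_index u d))"
      using form_time_shift[OF n d u k(1) power_index_mindices[OF u], of m] by blast
    have "agree n (form_series n d (V x) (jet_series x)) (fps_const \<phi> * fps_X ^ m * 1)"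
      using V(2)[rule_format, of x] unfolding mono \<phi>_def .
    thus "\<exists>B. (\<forall>\<alpha>. \<alpha> \<notin> mindices (n+1) d \<longrightarrow> B \<alpha> = 0) \<and>
      agree n (form_series n d B (jet_series x)) (fps_const \<phi> * fps_X ^ m)"
      using V(1) by (intro exI[of _ "V x"]) simp
  qed
  then obtain B where B': "\<forall>m. (\<forall>\<alpha>. \<alpha> \<notin> mindices (n+1) d \<longrightarrow> B m \<alpha> = 0) \<and>
      agree n (form_series n d (B m) (jet_series x)) (fps_const \<phi> * fps_X ^ m)"
    unfolding choice_iff by (elim exE)
  have B: "\<alpha> \<notin> mindices (n+1) d \<Longrightarrow> B m \<alpha> = 0"
    "agree n (form_series n d (B m) (jet_series x)) (fps_const \<phi> * fps_X ^ m)" for m \<alpha>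
    using B' by blast+
  \<comment> \<open>The multiple of \<open>x\<close> keeps the coefficient of \<open>b\<close> fixed and does not contribute to the equations.\<close>
  define e where "e m i = (case i of Jet k l \<Rightarrow> 0 | Coef \<alpha> \<Rightarrow> inverse \<phi> * (B m \<alpha> + (- B m b) * coefs x \<alpha>))" for m i
  show ?thesis
  proof (rule that)
    fix m
    have "e m i = 0" if i: "i \<notin> free_coords n d (u, b)" for i
    proof (cases i)
      case (Coef \<alpha>)
      hence "\<alpha> \<notin> mindices (n+1) d \<or> \<alpha> = b" using i by (auto simp: free_coords_def)
      thus ?thesis using Coef B(1) chart_spaceD(2)[OF xs] chart_spaceD(5)[OF xs _ b]
        by (auto simp: e_def coefs_def)
    qed (simp add: e_def)
    thus "e m \<in> chart_vecs n d (u, b)" by (simp add: chart_vecs_def)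
    fix l assume l: "l \<le> n"
    have "linearised n d x (e m) = form_series n d (coefs (e m)) (jet_series x)"
      by (rule linearised_vertical) (simp add: e_def)
    also have "\<dots> = form_series n d (\<lambda>\<alpha>. inverse \<phi> * (B m \<alpha> + (- B m b) * coefs x \<alpha>)) (jet_series x)"
      by (intro form_series_cong refl) (simp add: coefs_def e_def)
    also have "\<dots> = fps_const (inverse \<phi>) * (form_series n d (B m) (jet_series x) +
        fps_const (- B m b) * form_series n d (coefs x) (jet_series x))"
      by (simp only: form_series_linear)
    also have "agree n \<dots> (fps_const (inverse \<phi>) * (fps_const \<phi> * fps_X ^ m + fps_const (- B m b) * 0))"
      by (intro agree_mult agree_add agree_refl B xc[unfolded in_cone_def])
    also have "fps_const (inverse \<phi>) * (fps_const \<phi> * fps_X ^ m + fps_const (- B m b) * 0) = fps_X ^ m"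
      using \<phi> by (simp add: mult.assoc[symmetric])
    finally have "agree n (linearised n d x (e m)) (fps_X ^ m)" .
    from agree_nth[OF this l] show "fps_nth (linearised n d (chart_map n d (u, b) p) (e m)) l = (if l = m then 1 else 0)"
      by (simp add: x_def fps_X_power_nth)
  qed
qed

lemma tangent_space_moving:
  assumes "n \<ge> 1" "d > n" "(u, b) \<in> charts n d" "p \<in> Jvert n d \<inter> chart_dom n d (u, b)"
    "k \<le> n + 1" "chart_map n d (u, b) p (Jet k 1) \<noteq> 0"
  shows "tangent_space n d (u, b) p =
    {v \<in> chart_vecs n d (u, b). \<forall>l<n+1. fps_nth (linearised n d (chart_map n d (u, b) p) v) l = 0}"
proof (intro set_eqI iffI)
  fix v assume v: "v \<in> tangent_space n d (u, b) p"
  thus "v \<in> {v \<in> chart_vecs n d (u, b). \<forall>l<n+1. fps_nth (linearised n d (chart_map n d (u, b) p) v) l = 0}"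
    using tangent_space_linearised[OF v assms(3)] by (auto simp: tangent_space_def agree_def)
next
  fix v assume "v \<in> {v \<in> chart_vecs n d (u, b). \<forall>l<n+1. fps_nth (linearised n d (chart_map n d (u, b) p) v) l = 0}"
  hence "v \<in> chart_vecs n d (u, b)" "agree n (linearised n d (chart_map n d (u, b) p) v) 0"
    by (auto simp: agree_def)
  thus "v \<in> tangent_space n d (u, b) p" by (rule tangent_moving[OF assms])
qed

lemma tangent_space_frame:
  assumes "n \<ge> 1" "d > n" "(u, b) \<in> charts n d" "p \<in> Jvert n d \<inter> chart_dom n d (u, b)"
    "k \<le> n + 1" "chart_map n d (u, b) p (Jet k 1) \<noteq> 0"
  shows "\<exists>T. is_frame (card (free_coords n d (u, b)) - (n + 1)) T (tangent_space n d (u, b) p)"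
proof -
  obtain e where e: "\<And>m. e m \<in> chart_vecs n d (u, b)"
    "\<And>m l. l \<le> n \<Longrightarrow> fps_nth (linearised n d (chart_map n d (u, b) p) (e m)) l = (if l = m then 1 else 0)"
    using dual_vectors[OF assms] by blast
  have cv: "chart_vecs n d (u, b) = {v. \<forall>i. i \<notin> free_coords n d (u, b) \<longrightarrow> v i = 0}" by (simp add: chart_vecs_def)
  obtain T where "is_frame (card (free_coords n d (u, b))) T (chart_vecs n d (u, b))"
    using frame_coordinates[OF free_coords_finite[of n d "(u, b)"]] unfolding cv by blast
  from frame_kernel[OF this cv, of "n + 1" "\<lambda>m v. fps_nth (linearised n d (chart_map n d (u, b) p) v) m" e "n + 1"] e
  show ?thesis unfolding tangent_space_moving[OF assms] by (auto simp: linear_functional_linearised)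
qed

lemma smooth_moving:
  assumes n: "n \<ge> 1" and d: "d > n" and p: "p \<in> Jvert n d"
    and moving: "\<And>u b. (u, b) \<in> charts n d \<Longrightarrow> p \<in> chart_dom n d (u, b) \<Longrightarrow>
      \<exists>k\<le>n+1. chart_map n d (u, b) p (Jet k 1) \<noteq> 0"
  shows "smooth_codim_at n d p (n + 1)"
  unfolding smooth_codim_at_def
proof (intro ballI impI)
  fix c assume c: "c \<in> charts n d" and pc: "p \<in> chart_dom n d c"
  obtain u b where ub: "c = (u, b)" by (cases c)
  note c = c[unfolded ub] and pc = pc[unfolded ub]
  obtain k where k: "k \<le> n + 1" "chart_map n d (u, b) p (Jet k 1) \<noteq> 0" using moving[OF c pc] by blast
  have pp: "p \<in> Jvert n d \<inter> chart_dom n d (u, b)" using p pc by simp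
  obtain e where e: "\<And>m. e m \<in> chart_vecs n d (u, b)"
    "\<And>m l. l \<le> n \<Longrightarrow> fps_nth (linearised n d (chart_map n d (u, b) p) (e m)) l = (if l = m then 1 else 0)"
    using dual_vectors[OF n d c pp k] by blast
  have eq: "x \<in> Jvert_chart n d c \<longleftrightarrow> (\<forall>i<n+1. equation n d i x = 0)" if "x \<in> chart_space n d c" for x
    using that Jvert_chart_iff[OF c] unfolding ub in_cone_equation by (auto simp: less_Suc_eq_le)
  have ind: "\<forall>i<n+1. w i = 0"
    if H: "\<forall>v\<in>chart_vecs n d c. (\<Sum>i<n+1. w i * vec_apply n d c v (chart_map n d c p) (equation n d i)) = 0"
    for w :: "nat \<Rightarrow> complex"
  proof (intro allI impI)
    fix m assume m: "m < n + 1"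
    have "(\<Sum>i<n+1. w i * vec_apply n d c (e m) (chart_map n d c p) (equation n d i)) = (\<Sum>i<n+1. if i = m then w i else 0)"
      using e unfolding ub by (intro sum.cong refl) (simp add: vec_apply_equation)
    also have "\<dots> = w m" using m by simp
    finally show "w m = 0" using H e(1)[of m] unfolding ub by simp
  qed
  show "\<exists>h\<in>poly_funs. \<exists>f. h (chart_map n d c p) \<noteq> 0 \<and> (\<forall>i<n + 1. f i \<in> poly_funs) \<and>
        (\<forall>x\<in>chart_space n d c. h x \<noteq> 0 \<longrightarrow> (x \<in> Jvert_chart n d c \<longleftrightarrow> (\<forall>i<n + 1. f i x = 0))) \<and>
        (\<forall>w::nat \<Rightarrow> complex.
           (\<forall>v\<in>chart_vecs n d c. (\<Sum>i<n + 1. w i * vec_apply n d c v (chart_map n d c p) (f i)) = 0)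
             \<longrightarrow> (\<forall>i<n + 1. w i = 0))"
    by (intro bexI[of _ "\<lambda>_. 1"] exI[of _ "equation n d"] conjI allI impI ballI)
       (use eq ind poly_equation poly_funs.const in auto)
qed


section \<open>Dimensions\<close>

lemma card_mindices: "card (mindices m d) = (m + d) choose d"
proof -
  have "bij_betw (\<lambda>\<alpha>. map \<alpha> [0..<Suc m]) (mindices m d) {l::nat list. length l = Suc m \<and> sum_list l = d}"
  proof (rule bij_betw_byWitness[where f' = "\<lambda>l i. if i \<le> m then l ! i else 0"])
    show "\<forall>\<alpha>\<in>mindices m d. (\<lambda>i. if i \<le> m then map \<alpha> [0..<Suc m] ! i else 0) = \<alpha>"
      by (auto simp: mindices_def fun_eq_iff nth_append simp del: upt_Suc)
    show "\<forall>l\<in>{l::nat list. length l = Suc m \<and> sum_list l = d}. map (\<lambda>i. if i \<le> m then l ! i else 0) [0..<Suc m] = l"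
      by (auto intro!: nth_equalityI simp del: upt_Suc)
    show "(\<lambda>\<alpha>. map \<alpha> [0..<Suc m]) ` mindices m d \<subseteq> {l. length l = Suc m \<and> sum_list l = d}"
      by (auto simp: mindices_def interv_sum_list_conv_sum_set_nat atLeastLessThanSuc_atLeastAtMost atLeast0AtMost simp del: upt_Suc)
    show "(\<lambda>l i. if i \<le> m then l ! i else 0) ` {l::nat list. length l = Suc m \<and> sum_list l = d} \<subseteq> mindices m d"
      by (auto simp: mindices_def sum_list_sum_nth atLeast0LessThan lessThan_Suc_atMost)
  qed
  hence "card (mindices m d) = card {l::nat list. length l = Suc m \<and> sum_list l = d}" by (rule bij_betw_same_card)
  also have "\<dots> = (d + Suc m - 1) choose d" by (rule card_length_sum_list)
  finally show ?thesis by (simp add: add.commute)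
qed

lemma card_free_coords:
  assumes "(u, b) \<in> charts n d"
  shows "card (free_coords n d (u, b)) = (n + 1) * (n + 1) + (((n + 1 + d) choose d) - 1)"
proof -
  have u: "u \<le> n + 1" and b: "b \<in> mindices (n+1) d" using assms by (simp_all add: charts_def)
  have "free_coords n d (u, b) = case_prod Jet ` (({..n+1} - {u}) \<times> {..n}) \<union> Coef ` (mindices (n+1) d - {b})"
    by (auto simp: free_coords_def)
  also have "card \<dots> = card (case_prod Jet ` (({..n+1} - {u}) \<times> {..n})) + card (Coef ` (mindices (n+1) d - {b}))"
    by (intro card_Un_disjoint) (auto intro: finite_mindices)
  also have "card (case_prod Jet ` (({..n+1} - {u}) \<times> {..n})) = card (({..n+1} - {u}) \<times> {..n})"
    by (rule card_image) (auto simp: inj_on_def)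
  also have "card (Coef ` (mindices (n+1) d - {b})) = card (mindices (n+1) d - {b})"
    by (rule card_image) (auto simp: inj_on_def)
  also have "card (mindices (n+1) d - {b}) = ((n + 1 + d) choose d) - 1"
    using b finite_mindices[of "n+1" d] by (simp add: card_mindices)
  also have "card (({..n+1} - {u}) \<times> {..n}) = (n + 1) * (n + 1)" using u by (simp add: card_cartesian_product)
  finally show ?thesis .
qed


section \<open>Global generation\<close>

text \<open>The transition rule of twisted sections as a linear map on vectors.\<close>

definition chart_jacobian ::
    "nat \<Rightarrow> nat \<Rightarrow> nat \<Rightarrow> chart \<Rightarrow> chart \<Rightarrow> vjet \<Rightarrow> (coord \<Rightarrow> complex) \<Rightarrow> coord \<Rightarrow> complex" where
  "chart_jacobian n d q c c' p v i = (if i \<in> free_coords n d c' then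
     chart_map n d c' p (Jet (fst c) 0) ^ q * chart_map n d c' p (Coef (snd c)) ^ 1 *
       vec_apply n d c v (chart_map n d c p) (\<lambda>x. transition n d c c' x i) else 0)"

lemma vec_apply_sum:
  "vec_apply n d c (\<lambda>i. \<Sum>l<k. w l * T l i) x f = (\<Sum>l<k. w l * vec_apply n d c (T l) x f)" for k :: nat
  unfolding vec_apply_def sum_distrib_left sum_distrib_right
  by (subst sum.swap) (simp only: mult.assoc)

lemma chart_jacobian_sum:
  "chart_jacobian n d q c c' p (\<lambda>i. \<Sum>l<k. w l * T l i) = (\<lambda>i. \<Sum>l<k. w l * chart_jacobian n d q c c' p (T l) i)" for k :: nat
  by (rule ext) (simp add: chart_jacobian_def vec_apply_sum sum_distrib_left mult.left_commute)

lemma twisted_section_jacobian: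
  assumes T: "twisted_section n d q 1 T" and c: "c \<in> charts n d" "c' \<in> charts n d"
    and p: "p \<in> Jvert n d" "p \<in> chart_dom n d c" "p \<in> chart_dom n d c'"
  shows "T c' p = chart_jacobian n d q c c' p (T c p)"
proof
  fix i
  obtain u b v a where cc: "c = (u, b)" "c' = (v, a)" by (cases c, cases c')
  show "T c' p i = chart_jacobian n d q c c' p (T c p) i"
  proof (cases "i \<in> free_coords n d c'")
    case True
    thus ?thesis using T c p unfolding twisted_section_def chart_jacobian_def cc by simp
  next
    case False
    have "T c' p \<in> tangent_space n d c' p" using T c p unfolding twisted_section_def by blast
    thus ?thesis using False by (simp add: chart_jacobian_def tangent_space_def chart_vecs_def)
  qed
qed

text \<open>
  The values of all sections in two charts correspond under inverse linear maps.
\<close>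

lemma frame_transfer:
  assumes T: "\<And>l. l < j \<Longrightarrow> twisted_section n d q 1 (T l)" and c: "c \<in> charts n d" "c' \<in> charts n d"
    and p: "p \<in> Jvert n d" "p \<in> chart_dom n d c" "p \<in> chart_dom n d c'"
    and F: "is_frame j (\<lambda>l. T l c p) (tangent_space n d c p)"
    and sur: "\<And>v. v \<in> tangent_space n d c' p \<Longrightarrow> \<exists>S. twisted_section n d q 1 S \<and> S c' p = v"
  shows "is_frame j (\<lambda>l. T l c' p) (tangent_space n d c' p)"
proof -
  have span: "tangent_space n d c p = {v. \<exists>w::nat \<Rightarrow> complex. v = (\<lambda>i. \<Sum>l<j. w l * T l c p i)}"
    using F by (simp add: is_frame_def)
  have push: "chart_jacobian n d q c c' p (\<lambda>i. \<Sum>l<j. w l * T l c p i) = (\<lambda>i. \<Sum>l<j. w l * T l c' p i)" for w :: "nat \<Rightarrow> complex"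
    unfolding chart_jacobian_sum
    by (intro ext sum.cong refl) (simp add: twisted_section_jacobian[OF T c p])
  have pull: "chart_jacobian n d q c' c p (\<lambda>i. \<Sum>l<j. w l * T l c' p i) = (\<lambda>i. \<Sum>l<j. w l * T l c p i)" for w :: "nat \<Rightarrow> complex"
    unfolding chart_jacobian_sum
    by (intro ext sum.cong refl) (simp add: twisted_section_jacobian[OF T c(2,1) p(1,3,2)])
  have "tangent_space n d c' p = {v. \<exists>w::nat \<Rightarrow> complex. v = (\<lambda>i. \<Sum>l<j. w l * T l c' p i)}"
  proof (intro set_eqI iffI)
    fix v assume "v \<in> tangent_space n d c' p"
    then obtain S where S: "twisted_section n d q 1 S" "S c' p = v" using sur by blast
    have "S c p \<in> tangent_space n d c p" using S(1) c p unfolding twisted_section_def by blast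
    then obtain w :: "nat \<Rightarrow> complex" where w: "S c p = (\<lambda>i. \<Sum>l<j. w l * T l c p i)" unfolding span by blast
    have "v = chart_jacobian n d q c c' p (S c p)" using twisted_section_jacobian[OF S(1) c p] S(2) by simp
    also have "\<dots> = (\<lambda>i. \<Sum>l<j. w l * T l c' p i)" unfolding w push ..
    finally show "v \<in> {v. \<exists>w::nat \<Rightarrow> complex. v = (\<lambda>i. \<Sum>l<j. w l * T l c' p i)}" by blast
  next
    fix v assume "v \<in> {v. \<exists>w::nat \<Rightarrow> complex. v = (\<lambda>i. \<Sum>l<j. w l * T l c' p i)}"
    then obtain w :: "nat \<Rightarrow> complex" where w: "v = (\<lambda>i. \<Sum>l<j. w l * T l c' p i)" by blast
    have Tt: "T l c' p \<in> tangent_space n d c' p" if "l < j" for l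
      using T[OF that] c p unfolding twisted_section_def by blast
    show "v \<in> tangent_space n d c' p"
      unfolding tangent_space_def mem_Collect_eq
    proof (intro conjI ballI impI)
      show "v \<in> chart_vecs n d c'"
        using Tt unfolding w chart_vecs_def tangent_space_def by (auto intro: sum.neutral)
      fix f assume "f \<in> poly_funs" "\<forall>x\<in>Jvert_chart n d c'. f x = 0"
      hence "vec_apply n d c' (T l c' p) (chart_map n d c' p) f = 0" if "l < j" for l
        using Tt[OF that] unfolding tangent_space_def by blast
      thus "vec_apply n d c' v (chart_map n d c' p) f = 0" unfolding w vec_apply_sum by simp
    qed
  qed
  moreover have "\<forall>l<j. w l = 0" if "\<forall>i. (\<Sum>l<j. w l * T l c' p i) = 0" for w :: "nat \<Rightarrow> complex"
  proof -
    have "(\<lambda>i. \<Sum>l<j. w l * T l c' p i) = (\<lambda>i. 0)" using that by blast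
    hence "(\<lambda>i. \<Sum>l<j. w l * T l c p i) = chart_jacobian n d q c' c p (\<lambda>i. 0)" unfolding pull[symmetric] by simp
    also have "\<dots> = (\<lambda>i. 0)" by (rule ext) (simp add: chart_jacobian_def vec_apply_def)
    finally have "\<forall>i. (\<Sum>l<j. w l * T l c p i) = 0" by meson
    thus ?thesis using F unfolding is_frame_def by blast
  qed
  ultimately show ?thesis unfolding is_frame_def by blast
qed

theorem mainTheorem1:
  fixes n d N j :: nat
  assumes "n \<ge> 2" and "d > n"
    and "N = fact (n + 1 + d) div (fact (n + 1) * fact d) - 1"
    and "j = (n + 1) + N + n * (n + 1) - (n + 1)"
  shows
    "(\<forall>(u, b)\<in>charts n d. \<forall>p\<in>Jvert n d \<inter> chart_dom n d (u, b).
        p \<in> Sigma_tilde n d \<longleftrightarrow>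
          (\<forall>k\<in>{..n+1} - {u}. chart_map n d (u, b) p (Jet k 1) = 0)) \<and>
     (\<forall>p\<in>Jvert n d - Sigma_tilde n d.
        smooth_codim_at n d p (n + 1) \<and> smooth_dim_at n d p j) \<and>
     (\<forall>p\<in>Jvert n d - Sigma_tilde n d.
        \<exists>T. (\<forall>l<j. twisted_section n d (n\<^sup>2 + 2 * n) 1 (T l)) \<and>
            (\<forall>c\<in>charts n d. p \<in> chart_dom n d c \<longrightarrow>
               is_frame j (\<lambda>l. T l c p) (tangent_space n d c p)))"
proof -
  have n: "n \<ge> 1" and d: "d > n" using assms(1,2) by auto
  have Sigma: "p \<in> Sigma_tilde n d \<longleftrightarrow> (\<forall>k\<in>{..n+1} - {u}. chart_map n d (u, b) p (Jet k 1) = 0)"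
    if "(u, b) \<in> charts n d" "p \<in> Jvert n d \<inter> chart_dom n d (u, b)" for u b p
    unfolding Sigma_tilde_eq[OF n d] by (rule flat_jets_iff[OF n that])
  have moving: "\<exists>k\<le>n+1. chart_map n d (u, b) p (Jet k 1) \<noteq> 0"
    if "p \<in> Jvert n d - Sigma_tilde n d" "(u, b) \<in> charts n d" "p \<in> chart_dom n d (u, b)" for u b p
    using Sigma[OF that(2), of p] that(1,3) by auto
  have dim: "card (free_coords n d c) = (n + 1) + j" if "c \<in> charts n d" for c
  proof -
    obtain u b where ub: "c = (u, b)" by (cases c)
    have "(n + 1 + d) choose d = fact (n + 1 + d) div (fact d * fact (n + 1))"
      using binomial_fact'[of d "n + 1 + d"] by simp
    hence "N = ((n + 1 + d) choose d) - 1" unfolding assms(3) by (simp only: mult.commute)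
    moreover have "j = N + n * (n + 1)" unfolding assms(4) by simp
    ultimately show ?thesis using card_free_coords[OF that[unfolded ub]] unfolding ub by simp
  qed
  have smooth: "smooth_codim_at n d p (n + 1)" if "p \<in> Jvert n d - Sigma_tilde n d" for p
    by (rule smooth_moving[OF n d]) (use that moving[OF that] in auto)
  have frame: "\<exists>T. (\<forall>l<j. twisted_section n d (n\<^sup>2 + 2 * n) 1 (T l)) \<and>
            (\<forall>c\<in>charts n d. p \<in> chart_dom n d c \<longrightarrow> is_frame j (\<lambda>l. T l c p) (tangent_space n d c p))"
    if p: "p \<in> Jvert n d - Sigma_tilde n d" for p
  proof -
    have pJ: "p \<in> Jvert n d" using p by simp
    hence "p \<in> vjets n d" by (auto simp: Jvert_def)
    then obtain c0 where c0: "c0 \<in> charts n d" "p \<in> chart_dom n d c0" by (rule vjets_cover)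
    have sur: "\<exists>S. twisted_section n d (n\<^sup>2 + 2 * n) 1 S \<and> S c p = v"
      if c: "c \<in> charts n d" "p \<in> chart_dom n d c" and v: "v \<in> tangent_space n d c p" for c v
    proof -
      obtain u b where ub: "c = (u, b)" by (cases c)
      obtain k where k: "k \<le> n + 1" "chart_map n d (u, b) p (Jet k 1) \<noteq> 0"
        using moving[OF p c[unfolded ub]] by blast
      show ?thesis
        using field_with_value[OF n d c(1)[unfolded ub] _ k v[unfolded ub]] pJ c(2) unfolding ub by blast
    qed
    obtain B where B: "is_frame j B (tangent_space n d c0 p)"
    proof -
      obtain u b where ub: "c0 = (u, b)" by (cases c0)
      obtain k where k: "k \<le> n + 1" "chart_map n d (u, b) p (Jet k 1) \<noteq> 0"
        using moving[OF p c0[unfolded ub]] by blast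
      have "card (free_coords n d (u, b)) - (n + 1) = j" using dim[OF c0(1)] unfolding ub by simp
      thus ?thesis
        using tangent_space_frame[OF n d c0(1)[unfolded ub] _ k] pJ c0(2) that unfolding ub by auto
    qed
    have Bt: "B l \<in> tangent_space n d c0 p" if "l < j" for l
    proof -
      have Bl: "B l = (\<lambda>i. \<Sum>m<j. (if m = l then 1 else 0) * B m i)"
      proof
        fix i
        have "(\<Sum>m<j. (if m = l then 1 else 0) * B m i) = (\<Sum>m<j. if m = l then B m i else 0)"
          by (intro sum.cong) auto
        thus "B l i = (\<Sum>m<j. (if m = l then 1 else 0) * B m i)" using that by simp
      qed
      have span: "tangent_space n d c0 p = {v. \<exists>w::nat \<Rightarrow> complex. v = (\<lambda>i. \<Sum>l<j. w l * B l i)}"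
        using B unfolding is_frame_def by (rule conjunct1)
      show ?thesis unfolding span mem_Collect_eq by (rule exI, rule Bl)
    qed
    have "\<forall>l. \<exists>S. l < j \<longrightarrow> twisted_section n d (n\<^sup>2 + 2 * n) 1 S \<and> S c0 p = B l"
      using sur[OF c0 Bt] by blast
    then obtain T where T: "\<forall>l. l < j \<longrightarrow> twisted_section n d (n\<^sup>2 + 2 * n) 1 (T l) \<and> T l c0 p = B l"
      unfolding choice_iff by (elim exE)
    have F0: "is_frame j (\<lambda>l. T l c0 p) (tangent_space n d c0 p)"
    proof -
      have "(\<Sum>l<j. w l * T l c0 p i) = (\<Sum>l<j. w l * B l i)" for w :: "nat \<Rightarrow> complex" and i
        using T by (intro sum.cong) auto
      thus ?thesis using B unfolding is_frame_def by simp
    qed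
    have "is_frame j (\<lambda>l. T l c p) (tangent_space n d c p)" if c: "c \<in> charts n d" "p \<in> chart_dom n d c" for c
    proof (rule frame_transfer[where c = c0])
      show "is_frame j (\<lambda>l. T l c0 p) (tangent_space n d c0 p)" by (rule F0)
      show "twisted_section n d (n\<^sup>2 + 2 * n) 1 (T l)" if "l < j" for l using T that by blast
      show "\<exists>S. twisted_section n d (n\<^sup>2 + 2 * n) 1 S \<and> S c p = v" if "v \<in> tangent_space n d c p" for v
        by (rule sur[OF c that])
    qed (fact c0 c pJ)+
    thus ?thesis using T by (intro exI[of _ T] conjI allI impI ballI) simp_all
  qed
  have smooth_dim: "smooth_dim_at n d p j" if "p \<in> Jvert n d - Sigma_tilde n d" for p
    unfolding smooth_dim_at_def by (intro exI[of _ "n + 1"] conjI smooth that ballI dim)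
  show ?thesis
  proof (intro conjI ballI)
    fix c assume "c \<in> charts n d"
    thus "case c of (u, b) \<Rightarrow> \<forall>p\<in>Jvert n d \<inter> chart_dom n d (u, b).
        p \<in> Sigma_tilde n d \<longleftrightarrow> (\<forall>k\<in>{..n+1} - {u}. chart_map n d (u, b) p (Jet k 1) = 0)"
      using Sigma by (cases c) simp
  qed (fact smooth smooth_dim frame)+
qed

end
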